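(* Let $1\leq k\leq\infty$ and let $M^1=I$ or $M^1=\mathbb{S}^1$. The topological group $\mathrm{Diff}_+^k(M^1)$ is locally (OB) and has a well-defined, non-trivial quasi-isometry class if and only if $k<\infty$.
   Context: $I=[0,1]$, and $\mathbb{S}^1$ is the circle, viewed as $[0,1]$ with $0$ and $1$ identified. For $1\leq k\leq\infty$, $\mathrm{Diff}_+^k(M^1)$ is the group (under composition) of orientation-preserving $C^k$-diffeomorphisms of $M^1$, with its usual $C^k$-topology: for $k<\infty$ this is induced by the metric $\rho_k(f,g)=\sup_{x\in M^1}d_{M^1}(f(x),g(x))+\sum_{j=1}^k\sup_{x\in M^1}|f^{(j)}(x)-g^{(j)}(x)|$, where $d_I$ is the usual distance, $d_{\mathbb{S}^1}([x],[y])=|e^{2\pi i x}-e^{2\pi i y}|$, and derivatives of circle maps are those of their lifts to $\mathbb{R}$; for $k=\infty$ it is the topology generated by all the metrics $\rho_j$, $1\le j<\infty$. It is a connected Polish group. A subset $\Sigma$ of a separable metrizable group $G$ has the property (OB) relative to $G$ if $\Sigma$ has finite diameter with respect to every right-invariant metric on $G$ compatible with the topology of $G$. (For a connected Polish group $G$ this is equivalent to: for every open neighborhood $U$ of the identity there is a positive integer $r$ with $\Sigma\subseteq U^r$.) $G$ is locally (OB) if it has a neighborhood of the identity with the property (OB) relative to $G$. For a symmetric generating set $\Sigma$ of $G$, the right Cayley metric is the right-invariant metric $d_\Sigma(f,g)=\min\{n\geq 0: fg^{-1}\in\Sigma^n\}$ (with $\Sigma^0=\{e\}$). $G$ has a well-defined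 quasi-isometry class if it is generated as a group by an open subset with the property (OB) relative to $G$; by results of Rosendal, all Cayley metrics $d_\Sigma$ with $\Sigma$ an open symmetric generating set having the property (OB) relative to $G$ are then mutually quasi-isometric (via the identity map), and the quasi-isometry class of $G$ is the class of these metrics. The class is non-trivial if it is not the quasi-isometry class of a one-point space. A map $\phi:(X,d_X)\to(Y,d_Y)$ of metric spaces is a quasi-isometry if there are $L\geq1$, $C\geq0$ with $\frac1L d_X(x,x')-C\leq d_Y(\phi(x),\phi(x'))\leq L d_X(x,x')+C$ for all $x,x'\in X$ and every point of $Y$ is within distance $C$ of $\phi(X)$. *)

theory Defs
  imports "HOL-Analysis.Analysis" "HOL-Algebra.Bij" "HOL-Algebra.Generated_Groups"
begin

section \<open>Coarse geometry of topological groups\<close>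

text \<open>A topological group is given by a group \<open>G\<close> of HOL-Algebra and a topology \<open>T\<close> on its carrier.\<close>

definition right_invariant_compatible_metric ::
    "('a, 'm) monoid_scheme \<Rightarrow> 'a topology \<Rightarrow> ('a \<Rightarrow> 'a \<Rightarrow> real) \<Rightarrow> bool" where
  "right_invariant_compatible_metric G T d \<longleftrightarrow>
     Metric_space (carrier G) d \<and>
     Metric_space.mtopology (carrier G) d = T \<and>
     (\<forall>f\<in>carrier G. \<forall>g\<in>carrier G. \<forall>h\<in>carrier G. d (f \<otimes>\<^bsub>G\<^esub> h) (g \<otimes>\<^bsub>G\<^esub> h) = d f g)"

definition property_OB :: "('a, 'm) monoid_scheme \<Rightarrow> 'a topology \<Rightarrow> 'a set \<Rightarrow> bool" where
  "property_OB G T A \<longleftrightarrow> A \<subseteq> carrier G \<and>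
     (\<forall>d. right_invariant_compatible_metric G T d \<longrightarrow> (\<exists>B. \<forall>f\<in>A. \<forall>g\<in>A. d f g \<le> B))"

definition locally_OB :: "('a, 'm) monoid_scheme \<Rightarrow> 'a topology \<Rightarrow> bool" where
  "locally_OB G T \<longleftrightarrow>
     (\<exists>N U. openin T U \<and> \<one>\<^bsub>G\<^esub> \<in> U \<and> U \<subseteq> N \<and> property_OB G T N)"

definition has_qi_class :: "('a, 'm) monoid_scheme \<Rightarrow> 'a topology \<Rightarrow> bool" where
  "has_qi_class G T \<longleftrightarrow>
     (\<exists>A. openin T A \<and> generate G A = carrier G \<and> property_OB G T A)"

primrec set_power :: "('a, 'm) monoid_scheme \<Rightarrow> 'a set \<Rightarrow> nat \<Rightarrow> 'a set" where
  "set_power G A 0 = {\<one>\<^bsub>G\<^esub>}"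
| "set_power G A (Suc n) = set_power G A n <#>\<^bsub>G\<^esub> A"

definition symmetric_generating_set :: "('a, 'm) monoid_scheme \<Rightarrow> 'a set \<Rightarrow> bool" where
  "symmetric_generating_set G A \<longleftrightarrow>
     A \<subseteq> carrier G \<and> (\<forall>f\<in>A. inv\<^bsub>G\<^esub> f \<in> A) \<and> generate G A = carrier G"

definition cayley_metric :: "('a, 'm) monoid_scheme \<Rightarrow> 'a set \<Rightarrow> 'a \<Rightarrow> 'a \<Rightarrow> real" where
  "cayley_metric G A f g = real (LEAST n. f \<otimes>\<^bsub>G\<^esub> inv\<^bsub>G\<^esub> g \<in> set_power G A n)"

definition quasi_isometry ::
    "'a set \<Rightarrow> ('a \<Rightarrow> 'a \<Rightarrow> real) \<Rightarrow> 'b set \<Rightarrow> ('b \<Rightarrow> 'b \<Rightarrow> real) \<Rightarrow> ('a \<Rightarrow> 'b) \<Rightarrow> bool" where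
  "quasi_isometry X dX Y dY \<phi> \<longleftrightarrow> \<phi> \<in> X \<rightarrow> Y \<and>
     (\<exists>L C. L \<ge> 1 \<and> C \<ge> 0 \<and>
        (\<forall>x\<in>X. \<forall>x'\<in>X. 1 / L * dX x x' - C \<le> dY (\<phi> x) (\<phi> x') \<and>
                       dY (\<phi> x) (\<phi> x') \<le> L * dX x x' + C) \<and>
        (\<forall>y\<in>Y. \<exists>x\<in>X. dY y (\<phi> x) \<le> C))"

definition quasi_isometric ::
    "'a set \<Rightarrow> ('a \<Rightarrow> 'a \<Rightarrow> real) \<Rightarrow> 'b set \<Rightarrow> ('b \<Rightarrow> 'b \<Rightarrow> real) \<Rightarrow> bool" where
  "quasi_isometric X dX Y dY \<longleftrightarrow> (\<exists>\<phi>. quasi_isometry X dX Y dY \<phi>)"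

text \<open>The metrics that represent the quasi-isometry class of \<open>G\<close>.\<close>

definition qi_class_metrics ::
    "('a, 'm) monoid_scheme \<Rightarrow> 'a topology \<Rightarrow> ('a \<Rightarrow> 'a \<Rightarrow> real) set" where
  "qi_class_metrics G T =
     {cayley_metric G A | A. openin T A \<and> symmetric_generating_set G A \<and> property_OB G T A}"

text \<open>The representing metrics are mutually quasi-isometric, so non-triviality can be tested on
  any of them. The first conjunct keeps the definition from being vacuous; it follows from
  \<open>has_qi_class\<close>, since \<open>A \<union> A\<inverse>\<close> is open and has the property (OB) whenever \<open>A\<close> does.\<close>

definition nontrivial_qi_class :: "('a, 'm) monoid_scheme \<Rightarrow> 'a topology \<Rightarrow> bool" where
  "nontrivial_qi_class G T \<longleftrightarrow>
     qi_class_metrics G T \<noteq> {} \<and>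
     (\<forall>d\<in>qi_class_metrics G T. \<not> quasi_isometric (carrier G) d {()} (\<lambda>_ _. 0))"


section \<open>Functions of class \<open>C\<^sup>k\<close> on a set of reals\<close>

text \<open>Derivatives are taken within \<open>S\<close>, so they are one-sided at the end points of an interval.\<close>

definition iter_deriv :: "real set \<Rightarrow> nat \<Rightarrow> (real \<Rightarrow> real) \<Rightarrow> real \<Rightarrow> real" where
  "iter_deriv S j f = ((\<lambda>g x. vector_derivative g (at x within S)) ^^ j) f"

definition Ck_on :: "enat \<Rightarrow> real set \<Rightarrow> (real \<Rightarrow> real) \<Rightarrow> bool" where
  "Ck_on k S f \<longleftrightarrow>
     (\<forall>j. enat j < k \<longrightarrow> iter_deriv S j f differentiable_on S) \<and>
     (\<forall>j. enat j \<le> k \<longrightarrow> continuous_on S (iter_deriv S j f))"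


section \<open>The \<open>C\<^sup>k\<close>-topology\<close>

text \<open>The metric \<open>\<rho>\<^sub>n\<close> on a set \<open>C\<close> of self-maps of \<open>M\<close>; \<open>D j f\<close> is the \<open>j\<close>-th derivative of \<open>f\<close> in
  the coordinate \<open>x \<in> [0,1]\<close>. The value off \<open>C\<close> is irrelevant, but the library's \<open>Metric_space\<close>
  demands non-negativity and symmetry there as well.\<close>

definition Ck_metric ::
    "'a::metric_space set \<Rightarrow> (nat \<Rightarrow> ('a \<Rightarrow> 'a) \<Rightarrow> real \<Rightarrow> real) \<Rightarrow> ('a \<Rightarrow> 'a) set \<Rightarrow>
     nat \<Rightarrow> ('a \<Rightarrow> 'a) \<Rightarrow> ('a \<Rightarrow> 'a) \<Rightarrow> real" where
  "Ck_metric M D C n f g =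
     (if f \<in> C \<and> g \<in> C
      then (SUP x\<in>M. dist (f x) (g x)) + (\<Sum>j=1..n. SUP x\<in>{0..1}. \<bar>D j f x - D j g x\<bar>)
      else 0)"

definition Ck_topology ::
    "'a::metric_space set \<Rightarrow> (nat \<Rightarrow> ('a \<Rightarrow> 'a) \<Rightarrow> real \<Rightarrow> real) \<Rightarrow> ('a \<Rightarrow> 'a) set \<Rightarrow>
     enat \<Rightarrow> ('a \<Rightarrow> 'a) topology" where
  "Ck_topology M D C k =
     (case k of
        enat n \<Rightarrow> Metric_space.mtopology C (Ck_metric M D C n)
      | \<infinity> \<Rightarrow> topology_generated_by
               {U. \<exists>n\<ge>1. openin (Metric_space.mtopology C (Ck_metric M D C n)) U})"

lemma Metric_space_Ck_metric:
  fixes M :: "'a::metric_space set"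
  assumes M: "M \<noteq> {}" "bounded M" and C: "C \<subseteq> Bij M"
    and D: "\<And>j f. 1 \<le> j \<Longrightarrow> j \<le> n \<Longrightarrow> f \<in> C \<Longrightarrow> continuous_on {0..1} (D j f)"
  shows "Metric_space C (Ck_metric M D C n)"
proof -
  obtain B where B: "\<And>x y. x \<in> M \<Longrightarrow> y \<in> M \<Longrightarrow> dist x y \<le> B"
    using M(2) by (metis bounded_two_points)
  have inM: "f x \<in> M" if "f \<in> C" "x \<in> M" for f x
    using that C by (force simp: Bij_def bij_betw_def)
  define s where "s = (\<lambda>(f :: 'a \<Rightarrow> 'a) (g :: 'a \<Rightarrow> 'a). SUP x\<in>M. dist (f x) (g x))"
  define t where "t = (\<lambda>j f g. SUP x\<in>{0..1::real}. \<bar>D j f x - D j g x\<bar>)"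
  have s_bdd: "bdd_above ((\<lambda>x. dist (f x) (g x)) ` M)" if "f \<in> C" "g \<in> C" for f g
    using B inM that by (auto intro!: bdd_aboveI2)
  have t_bdd: "bdd_above ((\<lambda>x. \<bar>D j f x - D j g x\<bar>) ` {0..1})"
    if "1 \<le> j" "j \<le> n" "f \<in> C" "g \<in> C" for j f g
    by (intro bounded_imp_bdd_above compact_imp_bounded compact_continuous_image
        continuous_intros D that compact_Icc)
  have s_ge: "dist (f x) (g x) \<le> s f g" if "f \<in> C" "g \<in> C" "x \<in> M" for f g x
    unfolding s_def using that s_bdd by (intro cSUP_upper) auto
  have t_ge: "\<bar>D j f x - D j g x\<bar> \<le> t j f g"
    if "1 \<le> j" "j \<le> n" "f \<in> C" "g \<in> C" "x \<in> {0..1}" for j f g x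
    unfolding t_def using that t_bdd by (intro cSUP_upper) auto
  have s_nonneg: "0 \<le> s f g" if "f \<in> C" "g \<in> C" for f g
    using M(1) s_ge[OF that] by (metis ex_in_conv order_trans zero_le_dist)
  have t_nonneg: "0 \<le> t j f g" if "1 \<le> j" "j \<le> n" "f \<in> C" "g \<in> C" for j f g
    using t_ge[OF that, of 0] by simp
  have rho: "Ck_metric M D C n f g = s f g + (\<Sum>j=1..n. t j f g)" if "f \<in> C" "g \<in> C" for f g
    using that by (simp add: Ck_metric_def s_def t_def)
  have rho_nonneg: "0 \<le> (\<Sum>j=1..n. t j f g)" if "f \<in> C" "g \<in> C" for f g
    using that t_nonneg by (intro sum_nonneg) auto
  show ?thesis
  proof
    show "0 \<le> Ck_metric M D C n f g" for f g
      using rho s_nonneg rho_nonneg by (cases "f \<in> C \<and> g \<in> C") (auto simp: Ck_metric_def)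
    show "Ck_metric M D C n f g = Ck_metric M D C n g f" for f g
      by (auto simp: Ck_metric_def dist_commute abs_minus_commute)
    show "Ck_metric M D C n f g = 0 \<longleftrightarrow> f = g" if fg: "f \<in> C" "g \<in> C" for f g
    proof
      assume "Ck_metric M D C n f g = 0"
      then have "s f g \<le> 0"
        using rho rho_nonneg fg by (metis add_nonneg_eq_0_iff order_refl s_nonneg)
      then have "f x = g x" if "x \<in> M" for x
        using s_ge[OF fg that] by (meson dist_le_zero_iff order_trans)
      then show "f = g"
        using fg C by (auto simp: Bij_def intro: extensionalityI)
    next
      assume "f = g"
      then show "Ck_metric M D C n f g = 0"
        using M(1) by (simp add: Ck_metric_def)
    qed
    show "Ck_metric M D C n f h \<le> Ck_metric M D C n f g + Ck_metric M D C n g h"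
      if fgh: "f \<in> C" "g \<in> C" "h \<in> C" for f g h
    proof -
      have "s f h \<le> s f g + s g h"
        unfolding s_def using M(1)
      proof (intro cSUP_least)
        fix x assume "x \<in> M"
        then show "dist (f x) (h x) \<le> (SUP x\<in>M. dist (f x) (g x)) + (SUP x\<in>M. dist (g x) (h x))"
          using s_ge[of f g x] s_ge[of g h x] fgh dist_triangle[of "f x" "h x" "g x"]
          by (simp add: s_def)
      qed
      moreover have "t j f h \<le> t j f g + t j g h" if j: "j \<in> {1..n}" for j
        unfolding t_def
      proof (intro cSUP_least)
        fix x :: real assume "x \<in> {0..1}"
        then have "\<bar>D j f x - D j g x\<bar> \<le> t j f g" "\<bar>D j g x - D j h x\<bar> \<le> t j g h"
          using t_ge fgh j by auto
        then show "\<bar>D j f x - D j h x\<bar> \<le>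
            (SUP x\<in>{0..1}. \<bar>D j f x - D j g x\<bar>) + (SUP x\<in>{0..1}. \<bar>D j g x - D j h x\<bar>)"
          unfolding t_def by linarith
      qed auto
      then have "(\<Sum>j=1..n. t j f h) \<le> (\<Sum>j=1..n. t j f g) + (\<Sum>j=1..n. t j g h)"
        unfolding sum.distrib[symmetric] by (rule sum_mono)
      ultimately show ?thesis
        using rho fgh by simp
    qed
  qed
qed


section \<open>Diffeomorphism groups of the interval\<close>

definition diff_interval_set :: "enat \<Rightarrow> (real \<Rightarrow> real) set" where
  "diff_interval_set k =
     {f \<in> Bij {0..1}. Ck_on k {0..1} f \<and> Ck_on k {0..1} (inv_into {0..1} f) \<and>
        strict_mono_on {0..1} f}"

lemma Metric_space_diff_interval:
  assumes "enat n \<le> k"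
  shows "Metric_space (diff_interval_set k) (Ck_metric {0..1} (iter_deriv {0..1}) (diff_interval_set k) n)"
proof (rule Metric_space_Ck_metric)
  fix j and f :: "real \<Rightarrow> real"
  assume "j \<le> n" "f \<in> diff_interval_set k"
  moreover have "enat j \<le> k" using assms \<open>j \<le> n\<close> by (meson enat_ord_simps(1) order_trans)
  ultimately show "continuous_on {0..1} (iter_deriv {0..1} j f)"
    by (simp add: diff_interval_set_def Ck_on_def)
qed (auto simp: diff_interval_set_def)

definition diff_interval :: "enat \<Rightarrow> (real \<Rightarrow> real) monoid" where
  "diff_interval k = BijGroup {0..1} \<lparr>carrier := diff_interval_set k\<rparr>"

definition diff_interval_topology :: "enat \<Rightarrow> (real \<Rightarrow> real) topology" where
  "diff_interval_topology k = Ck_topology {0..1} (iter_deriv {0..1}) (diff_interval_set k) k"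


section \<open>Diffeomorphism groups of the circle\<close>

text \<open>The circle is the unit circle of the complex plane: the class of \<open>x\<close> in \<open>[0,1]\<close> with \<open>0\<close> and
  \<open>1\<close> identified is the point \<open>cis (2 * pi * x)\<close>. The prescribed distance of the circle is then
  \<open>dist\<close>. Smoothness, orientation and derivatives are those of lifts to the real line; two lifts of
  a map differ by an integer constant.\<close>

abbreviation circle :: "complex set" where
  "circle \<equiv> sphere 0 1"

definition circle_lift :: "(complex \<Rightarrow> complex) \<Rightarrow> (real \<Rightarrow> real) \<Rightarrow> bool" where
  "circle_lift f F \<longleftrightarrow>
     continuous_on UNIV F \<and> (\<forall>x. f (cis (2 * pi * x)) = cis (2 * pi * F x))"

definition Ck_circle :: "enat \<Rightarrow> (complex \<Rightarrow> complex) \<Rightarrow> bool" where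
  "Ck_circle k f \<longleftrightarrow> (\<exists>F. circle_lift f F \<and> Ck_on k UNIV F)"

definition orientation_preserving_circle :: "(complex \<Rightarrow> complex) \<Rightarrow> bool" where
  "orientation_preserving_circle f \<longleftrightarrow> (\<exists>F. circle_lift f F \<and> strict_mono F)"

definition circle_deriv :: "nat \<Rightarrow> (complex \<Rightarrow> complex) \<Rightarrow> real \<Rightarrow> real" where
  "circle_deriv j f = iter_deriv UNIV j (SOME F. circle_lift f F)"

definition diff_circle_set :: "enat \<Rightarrow> (complex \<Rightarrow> complex) set" where
  "diff_circle_set k =
     {f \<in> Bij circle. Ck_circle k f \<and> Ck_circle k (inv_into circle f) \<and>
        orientation_preserving_circle f}"

lemma circle_lift_unique:
  assumes "circle_lift f F" "circle_lift f G"
  obtains c where "G = (\<lambda>x. F x + c)"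
proof -
  define h where "h = (\<lambda>x. G x - F x)"
  have int: "h x \<in> \<int>" for x
  proof -
    have "cis (2 * pi * h x) = cis (2 * pi * G x) / cis (2 * pi * F x)"
      by (simp add: h_def cis_divide right_diff_distrib)
    also have "\<dots> = 1"
      using assms by (metis circle_lift_def cis_neq_zero divide_self)
    finally have "cos (2 * pi * h x) = 1"
      by (metis cis.sel(1) one_complex.sel(1))
    then obtain m :: int where "2 * pi * h x = of_int m * 2 * pi"
      using cos_one_2pi_int by auto
    then have "h x = of_int m" by simp
    then show ?thesis by simp
  qed
  have cont: "continuous_on UNIV h"
    unfolding h_def using assms by (auto simp: circle_lift_def intro!: continuous_intros)
  have "h constant_on UNIV"
  proof (rule continuous_discrete_range_constant[OF _ cont])
    fix x
    have "1 \<le> norm (h y - h x)" if "h y \<noteq> h x" for y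
      using that int[of x] int[of y] Ints_nonzero_abs_ge1[of "h y - h x"] by simp
    then show "\<exists>e>0. \<forall>y. y \<in> UNIV \<and> h y \<noteq> h x \<longrightarrow> e \<le> norm (h y - h x)"
      by (intro exI[of _ 1]) auto
  qed simp
  then obtain c where "\<And>x. h x = c" by (auto simp: constant_on_def)
  then have "G = (\<lambda>x. F x + c)" unfolding h_def by (metis add.commute diff_add_cancel)
  then show thesis by (rule that)
qed

lemma circle_deriv_eq:
  assumes "circle_lift f F" "1 \<le> j"
  shows "circle_deriv j f = iter_deriv UNIV j F"
proof -
  have "circle_lift f (SOME F. circle_lift f F)"
    using someI_ex[of "circle_lift f"] assms(1) by blast
  then obtain c where c: "(SOME F. circle_lift f F) = (\<lambda>x. F x + c)"
    using assms(1) circle_lift_unique by blast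
  have "((\<lambda>x. F x + c) has_vector_derivative v) (at x) \<longleftrightarrow> (F has_vector_derivative v) (at x)" for v x
    using has_vector_derivative_add_const by (simp add: add.commute)
  then have "vector_derivative (\<lambda>x. F x + c) (at x) = vector_derivative F (at x)" for x
    by (simp add: vector_derivative_def)
  moreover obtain i where "j = Suc i" using assms(2) by (cases j) auto
  ultimately show ?thesis
    by (simp add: circle_deriv_def c iter_deriv_def funpow_Suc_right del: funpow.simps)
qed

lemma Metric_space_diff_circle:
  assumes "enat n \<le> k"
  shows "Metric_space (diff_circle_set k) (Ck_metric circle circle_deriv (diff_circle_set k) n)"
proof (rule Metric_space_Ck_metric)
  fix j and f :: "complex \<Rightarrow> complex"
  assume j: "1 \<le> j" "j \<le> n" and "f \<in> diff_circle_set k"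
  then obtain F where F: "circle_lift f F" "Ck_on k UNIV F"
    by (auto simp: diff_circle_set_def Ck_circle_def)
  have "enat j \<le> k" using assms \<open>j \<le> n\<close> by (meson enat_ord_simps(1) order_trans)
  then have "continuous_on UNIV (circle_deriv j f)"
    using F j by (simp add: circle_deriv_eq Ck_on_def)
  then show "continuous_on {0..1} (circle_deriv j f)"
    by (rule continuous_on_subset) simp
qed (auto simp: diff_circle_set_def)

definition diff_circle :: "enat \<Rightarrow> (complex \<Rightarrow> complex) monoid" where
  "diff_circle k = BijGroup circle \<lparr>carrier := diff_circle_set k\<rparr>"

definition diff_circle_topology :: "enat \<Rightarrow> (complex \<Rightarrow> complex) topology" where
  "diff_circle_topology k = Ck_topology circle circle_deriv (diff_circle_set k) k"

end

theory Submission
  imports Defs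
begin

text \<open>
  The interval and the circle are handled together: a diffeomorphism is represented by a lift, a
  strictly increasing \<open>C\<^sup>k\<close> bijection \<open>F\<close> of \<open>S\<close>, where \<open>S\<close> is \<open>[0,1]\<close> for the interval and the
  real line for the circle, with \<open>F (x + 1) = F x + 1\<close> whenever \<open>x\<close> and \<open>x + 1\<close> lie in \<open>S\<close>.

  The main tool is the distortion of a lift \<open>F\<close>: the least \<open>c\<close> such that for all \<open>u\<close> of class
  \<open>C\<^sup>n\<close> the derivatives of \<open>u \<circ> F\<close> of orders \<open>1, \<dots>, n\<close> at \<open>x\<close> differ from those of \<open>u\<close> at \<open>F x\<close> by
  at most \<open>c\<close> times the size of the latter. It is the operator norm of (pullback of \<open>n\<close>-jets minus
  the identity), so \<open>1 + c\<close> is submultiplicative under composition, and a distortion \<open>c < 1\<close> of \<open>F\<close>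
  gives \<open>c / (1 - c)\<close> for the inverse of \<open>F\<close>. An induction on the order (\<open>compose_jet_bound\<close>)
  shows that the distortion is at most a constant times the \<open>C\<^sup>n\<close>-distance from \<open>F\<close> to the identity,
  as long as that distance stays bounded, and testing with \<open>u = id\<close> bounds the derivatives of
  \<open>F - id\<close> by the distortion.

  Consequently \<open>ln (1 + c)\<close>, symmetrized under inversion and combined with the displacement of
  points, is a length function on the group (\<open>jet_length\<close>), hence defines a right-invariant metric,
  and its small balls at the identity are the small \<open>C\<^sup>n\<close>-balls. Superposing these lengths with
  cut-offs gives metrics compatible with the \<open>C\<^sup>k\<close>-topology, also for \<open>k = \<infinity>\<close>, and any one of the
  lengths may be added without its cut-off (\<open>compatible_combined_length\<close>).

  For finite \<open>k\<close>, join \<open>f\<close> to the identity by the affine path \<open>f\<^sub>t = (1 - t) id + t f\<close>. The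
  quotient \<open>f\<^sub>s f\<^sub>t\<^sup>-\<^sup>1\<close> differs from the identity by \<open>(s - t) (f - id) \<circ> f\<^sub>t\<^sup>-\<^sup>1\<close>, which is small in
  \<open>C\<^sup>k\<close> for \<open>s\<close> near \<open>t\<close>; if \<open>f\<close> ranges over a small \<open>C\<^sup>k\<close>-ball, it is so uniformly in \<open>f\<close>. The
  uniform statement makes the ball a subset of \<open>V\<^sup>N\<close> for every neighbourhood \<open>V\<close> of the identity,
  hence (OB) (\<open>property_OB_ball\<close>), and the pointwise one shows that every neighbourhood of
  the identity generates the group (\<open>generate_open\<close>). The class is non-trivial because the
  derivative of a diffeomorphism can be arbitrarily close to \<open>0\<close>, so that the length of order \<open>1\<close> is
  unbounded (\<open>combined_length_unbounded\<close>).

  For \<open>k = \<infinity>\<close> a neighbourhood of the identity restricts only finitely many derivatives, say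
  those up to order \<open>n\<close>. The diffeomorphisms \<open>x + a w\<^sup>-\<^sup>n sin (w x)\<close> with small \<open>a\<close> lie in it, but
  their derivatives of order \<open>n + 1\<close> are of size \<open>a w\<close>, so the compatible metric that uses
  the length of order \<open>n + 1\<close> is unbounded on it (\<open>not_locally_OB_if_infinite_order\<close>).
\<close>

section \<open>Right-invariant metrics and the property (OB)\<close>

definition length_function :: "('a, 'm) monoid_scheme \<Rightarrow> ('a \<Rightarrow> real) \<Rightarrow> bool" where
  "length_function G len \<longleftrightarrow>
     (\<forall>f\<in>carrier G. 0 \<le> len f \<and> (len f = 0 \<longleftrightarrow> f = \<one>\<^bsub>G\<^esub>) \<and> len (inv\<^bsub>G\<^esub> f) = len f) \<and>
     (\<forall>f\<in>carrier G. \<forall>g\<in>carrier G. len (f \<otimes>\<^bsub>G\<^esub> g) \<le> len f + len g)"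

definition length_metric :: "('a, 'm) monoid_scheme \<Rightarrow> ('a \<Rightarrow> real) \<Rightarrow> 'a \<Rightarrow> 'a \<Rightarrow> real" where
  "length_metric G len f g =
     (if f \<in> carrier G \<and> g \<in> carrier G then len (f \<otimes>\<^bsub>G\<^esub> inv\<^bsub>G\<^esub> g) else 0)"

lemma length_mult_le:
  "length_function G len \<Longrightarrow> f \<in> carrier G \<Longrightarrow> g \<in> carrier G \<Longrightarrow> len (f \<otimes>\<^bsub>G\<^esub> g) \<le> len f + len g"
  by (simp add: length_function_def)

lemma quasi_isometric_point_imp_bounded:
  assumes "quasi_isometric X d {()} (\<lambda>_ _. 0)"
  obtains B where "\<And>x y. x \<in> X \<Longrightarrow> y \<in> X \<Longrightarrow> d x y \<le> B"
proof -
  obtain \<phi> :: "'a \<Rightarrow> unit" where "quasi_isometry X d {()} (\<lambda>_ _. 0) \<phi>"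
    using assms unfolding quasi_isometric_def by (rule exE)
  note q = this[unfolded quasi_isometry_def, THEN conjunct2]
  obtain Q where "\<exists>C. Q \<ge> 1 \<and> C \<ge> 0 \<and>
        (\<forall>x\<in>X. \<forall>y\<in>X. 1 / Q * d x y - C \<le> 0 \<and> 0 \<le> Q * d x y + C) \<and>
        (\<forall>y\<in>{()}. \<exists>x\<in>X. (0::real) \<le> C)" using q by (rule exE)
  then obtain C where C: "Q \<ge> 1 \<and> C \<ge> 0 \<and>
        (\<forall>x\<in>X. \<forall>y\<in>X. 1 / Q * d x y - C \<le> 0 \<and> 0 \<le> Q * d x y + C) \<and>
        (\<forall>y\<in>{()}. \<exists>x\<in>X. (0::real) \<le> C)" by (rule exE)
  have "d x y \<le> Q * C" if "x \<in> X" "y \<in> X" for x y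
  proof -
    have "1 / Q * d x y - C \<le> 0" using C that by blast
    then show ?thesis using C by (simp add: field_simps)
  qed
  then show thesis by (rule that)
qed

text \<open>A topology is seen by a right-invariant metric through the neighbourhoods of the identity and
  their right translates. Continuity of right translations is therefore the whole interface between
  the group and its topology.\<close>

locale topologized_group = group G for G (structure) +
  fixes T :: "'a topology"
  assumes topspace_T: "topspace T = carrier G"
    and translate_open: "\<lbrakk>openin T U; h \<in> carrier G\<rbrakk> \<Longrightarrow> openin T {f \<in> carrier G. f \<otimes> h \<in> U}"
begin

text \<open>The balls of \<open>len\<close> at the identity form a neighbourhood base there.\<close>

definition compatible_length :: "('a \<Rightarrow> real) \<Rightarrow> bool" where
  "compatible_length len \<longleftrightarrow> length_function G len \<and>
     (\<forall>e>0. \<exists>U. openin T U \<and> \<one> \<in> U \<and> (\<forall>f\<in>U. len f < e)) \<and>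
     (\<forall>U. openin T U \<and> \<one> \<in> U \<longrightarrow> (\<exists>e>0. \<forall>f\<in>carrier G. len f < e \<longrightarrow> f \<in> U))"

lemma compatible_lengthD:
  assumes "compatible_length len"
  shows "length_function G len"
    "0 < e \<Longrightarrow> \<exists>U. openin T U \<and> \<one> \<in> U \<and> (\<forall>f\<in>U. len f < e)"
    "openin T U \<Longrightarrow> \<one> \<in> U \<Longrightarrow> \<exists>e>0. \<forall>f\<in>carrier G. len f < e \<longrightarrow> f \<in> U"
  using assms by (simp_all add: compatible_length_def)

lemma Metric_space_length_metric:
  assumes "length_function G len" shows "Metric_space (carrier G) (length_metric G len)"
proof
  note L = assms[unfolded length_function_def]
  show "0 \<le> length_metric G len f g" for f g
    using L by (simp add: length_metric_def)
  show "length_metric G len f g = length_metric G len g f" for f g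
  proof (cases "f \<in> carrier G \<and> g \<in> carrier G")
    case True
    then have "inv (f \<otimes> inv g) = g \<otimes> inv f" by (simp add: inv_mult_group)
    then have "len (g \<otimes> inv f) = len (f \<otimes> inv g)"
      using L True by (metis inv_closed m_closed)
    then show ?thesis using True by (simp add: length_metric_def)
  qed (auto simp: length_metric_def)
  show "length_metric G len f g = 0 \<longleftrightarrow> f = g" if "f \<in> carrier G" "g \<in> carrier G" for f g
  proof -
    have "f \<otimes> inv g = \<one> \<longleftrightarrow> f = g"
      using that inv_solve_right[of \<one> f g] by auto
    then show ?thesis using L that by (simp add: length_metric_def)
  qed
  show "length_metric G len f h \<le> length_metric G len f g + length_metric G len g h"
    if "f \<in> carrier G" "g \<in> carrier G" "h \<in> carrier G" for f g h
  proof -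
    have "f \<otimes> inv h = (f \<otimes> inv g) \<otimes> (g \<otimes> inv h)"
      using that inv_solve_left[of "inv h" g "g \<otimes> inv h"] by (simp add: m_assoc)
    then show ?thesis using L that by (simp add: length_metric_def)
  qed
qed

text \<open>At the identity the two topologies agree by hypothesis. Right translations are homeomorphisms
  of both, and they carry the identity to any other element.\<close>

lemma right_invariant_compatible_length_metric:
  assumes "compatible_length len"
  shows "right_invariant_compatible_metric G T (length_metric G len)"
proof -
  have L: "length_function G len" using assms by (simp add: compatible_length_def)
  interpret Metric_space "carrier G" "length_metric G len"
    using L by (rule Metric_space_length_metric)
  have ball: "f \<in> mball g e \<longleftrightarrow> f \<in> carrier G \<and> g \<in> carrier G \<and> len (f \<otimes> inv g) < e" for f g e
  proof -
    have lm: "length_metric G len g f = len (f \<otimes> inv g)" if "f \<in> carrier G" "g \<in> carrier G"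
      using that commute[of g f] by (simp add: length_metric_def)
    show ?thesis unfolding in_mball using lm by metis
  qed
  have "openin mtopology U \<longleftrightarrow> openin T U" for U
  proof
    assume U: "openin T U"
    have sub: "U \<subseteq> carrier G" using openin_subset[OF U] topspace_T by simp
    show "openin mtopology U"
      unfolding openin_mtopology
    proof (intro conjI sub allI impI)
      fix g assume g: "g \<in> U"
      then have gc: "g \<in> carrier G" using sub by auto
      have "openin T {f \<in> carrier G. f \<otimes> g \<in> U}" using U gc by (rule translate_open)
      moreover have "\<one> \<in> {f \<in> carrier G. f \<otimes> g \<in> U}" using g gc by simp
      ultimately have "\<exists>e>0. \<forall>f\<in>carrier G. len f < e \<longrightarrow> f \<in> {f \<in> carrier G. f \<otimes> g \<in> U}"
        by (rule compatible_lengthD(3)[OF assms])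
      then obtain e where e: "e > 0" "\<And>f. f \<in> carrier G \<Longrightarrow> len f < e \<Longrightarrow> f \<otimes> g \<in> U"
        by auto
      have "mball g e \<subseteq> U"
      proof
        fix f assume "f \<in> mball g e"
        then have f: "f \<in> carrier G" "len (f \<otimes> inv g) < e" unfolding ball by simp_all
        then have "(f \<otimes> inv g) \<otimes> g \<in> U" using e(2) gc by simp
        then show "f \<in> U" using f gc by (simp add: m_assoc)
      qed
      then show "\<exists>r>0. mball g r \<subseteq> U" using e by blast
    qed
  next
    assume U: "openin mtopology U"
    show "openin T U"
    proof (subst openin_subopen, intro ballI)
      fix g assume g: "g \<in> U"
      then have gc: "g \<in> carrier G" using openin_subset[OF U] by auto
      obtain r where r: "r > 0" "mball g r \<subseteq> U" using U g by (auto simp: openin_mtopology)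
      obtain W where W: "openin T W" "\<one> \<in> W" "\<And>f. f \<in> W \<Longrightarrow> len f < r"
        using compatible_lengthD(2)[OF assms r(1)] by blast
      have "openin T {f \<in> carrier G. f \<otimes> inv g \<in> W}" using W gc by (intro translate_open) auto
      moreover have "g \<in> {f \<in> carrier G. f \<otimes> inv g \<in> W}" using gc W by simp
      moreover have "{f \<in> carrier G. f \<otimes> inv g \<in> W} \<subseteq> U"
      proof
        fix f assume "f \<in> {f \<in> carrier G. f \<otimes> inv g \<in> W}"
        then have "f \<in> mball g r" unfolding ball using W(3) gc by simp
        then show "f \<in> U" using r(2) by (rule subsetD[rotated])
      qed
      ultimately show "\<exists>S. openin T S \<and> g \<in> S \<and> S \<subseteq> U" by blast
    qed
  qed
  then have "mtopology = T" by (simp add: topology_eq)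
  moreover have "length_metric G len (f \<otimes> h) (g \<otimes> h) = length_metric G len f g"
    if "f \<in> carrier G" "g \<in> carrier G" "h \<in> carrier G" for f g h
  proof -
    have "(f \<otimes> h) \<otimes> inv (g \<otimes> h) = f \<otimes> (h \<otimes> inv h) \<otimes> inv g"
      using that m_assoc[of h "inv h" "inv g"] by (simp add: inv_mult_group m_assoc)
    then show ?thesis using that by (simp add: length_metric_def)
  qed
  ultimately show ?thesis
    unfolding right_invariant_compatible_metric_def using Metric_space_axioms by blast
qed

text \<open>The metric of \<open>len\<close> is one of those quantified over in the definition of the property (OB); it
  bounds the distances from one fixed element of \<open>A\<close>, whose own length is the additive error.\<close>

lemma property_OB_imp_length_bounded:
  assumes "property_OB G T A" "compatible_length len"
  obtains B where "\<And>f. f \<in> A \<Longrightarrow> len f \<le> B"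
proof (cases "A = {}")
  case True then show thesis using that by blast
next
  case False
  then obtain a where a: "a \<in> A" by blast
  have L: "length_function G len" using assms by (simp add: compatible_length_def)
  have A: "A \<subseteq> carrier G" using assms(1) by (simp add: property_OB_def)
  have "\<exists>B. \<forall>f\<in>A. \<forall>g\<in>A. length_metric G len f g \<le> B"
    using assms(1) right_invariant_compatible_length_metric[OF assms(2)] unfolding property_OB_def by blast
  then obtain B where B: "\<And>f g. f \<in> A \<Longrightarrow> g \<in> A \<Longrightarrow> length_metric G len f g \<le> B" by blast
  have "len f \<le> B + len a" if f: "f \<in> A" for f
  proof -
    have fa: "f \<in> carrier G" "a \<in> carrier G" using f a A by auto
    then have "(f \<otimes> inv a) \<otimes> a = f" by (simp add: m_assoc)
    moreover have "len ((f \<otimes> inv a) \<otimes> a) \<le> len (f \<otimes> inv a) + len a"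
      using fa by (intro length_mult_le[OF L]) simp_all
    ultimately have "len f \<le> len (f \<otimes> inv a) + len a" by simp
    moreover have "len (f \<otimes> inv a) \<le> B" using B[OF f a] fa by (simp add: length_metric_def)
    ultimately show ?thesis by linarith
  qed
  then show thesis by (rule that)
qed

text \<open>By right invariance the distance between consecutive points \<open>\<phi> i\<close> and \<open>\<phi> (Suc i)\<close> is the
  distance from the identity to their quotient. With \<open>V\<close> the unit ball of a given metric, \<open>N\<close> thus
  bounds the distance from the identity to every point of \<open>A\<close>.\<close>

lemma property_OB_if_chains:
  assumes A: "A \<subseteq> carrier G"
    and chains: "\<And>V. openin T V \<Longrightarrow> \<one> \<in> V \<Longrightarrow> \<exists>N. \<forall>f\<in>A. \<exists>\<phi>. \<phi> 0 = \<one> \<and> \<phi> N = f \<and>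
        (\<forall>i\<le>N. \<phi> i \<in> carrier G) \<and> (\<forall>i<N. \<phi> (Suc i) \<otimes> inv (\<phi> i) \<in> V)"
  shows "property_OB G T A"
  unfolding property_OB_def
proof (intro conjI A allI impI)
  fix d assume "right_invariant_compatible_metric G T d"
  then have M: "Metric_space (carrier G) d" and T: "Metric_space.mtopology (carrier G) d = T"
    and inv: "\<And>f g h. f \<in> carrier G \<Longrightarrow> g \<in> carrier G \<Longrightarrow> h \<in> carrier G \<Longrightarrow> d (f \<otimes> h) (g \<otimes> h) = d f g"
    by (auto simp: right_invariant_compatible_metric_def)
  interpret Metric_space "carrier G" d by (rule M)
  have "openin T (mball \<one> 1)" unfolding T[symmetric] by (rule openin_mball)
  moreover have "\<one> \<in> mball \<one> 1" by simp
  ultimately have "\<exists>N. \<forall>f\<in>A. \<exists>\<phi>. \<phi> 0 = \<one> \<and> \<phi> N = f \<and>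
        (\<forall>i\<le>N. \<phi> i \<in> carrier G) \<and> (\<forall>i<N. \<phi> (Suc i) \<otimes> inv (\<phi> i) \<in> mball \<one> 1)"
    by (rule chains)
  then obtain N where N: "\<forall>f\<in>A. \<exists>\<phi>. \<phi> 0 = \<one> \<and> \<phi> N = f \<and>
        (\<forall>i\<le>N. \<phi> i \<in> carrier G) \<and> (\<forall>i<N. \<phi> (Suc i) \<otimes> inv (\<phi> i) \<in> mball \<one> 1)"
    by (rule exE)
  have bound: "d \<one> f \<le> N" if fA: "f \<in> A" for f
  proof -
    obtain \<phi> where "\<phi> 0 = \<one> \<and> \<phi> N = f \<and> (\<forall>i\<le>N. \<phi> i \<in> carrier G) \<and>
        (\<forall>i<N. \<phi> (Suc i) \<otimes> inv (\<phi> i) \<in> mball \<one> 1)"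
      using bspec[OF N fA] by (rule exE)
    then have \<phi>: "\<phi> 0 = \<one>" "\<phi> N = f" "\<And>i. i \<le> N \<Longrightarrow> \<phi> i \<in> carrier G"
      "\<And>i. i < N \<Longrightarrow> \<phi> (Suc i) \<otimes> inv (\<phi> i) \<in> mball \<one> 1" by simp_all
    have "d \<one> (\<phi> i) \<le> i" if "i \<le> N" for i
      using that
    proof (induction i)
      case (Suc i)
      have c: "\<phi> i \<in> carrier G" "\<phi> (Suc i) \<in> carrier G" using \<phi>(3) Suc.prems by auto
      have "d \<one> (\<phi> (Suc i) \<otimes> inv (\<phi> i)) < 1" using \<phi>(4)[of i] Suc.prems by simp
      also have "d \<one> (\<phi> (Suc i) \<otimes> inv (\<phi> i)) = d (\<one> \<otimes> \<phi> i) (\<phi> (Suc i) \<otimes> inv (\<phi> i) \<otimes> \<phi> i)"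
        using c by (intro inv[symmetric]) auto
      also have "\<dots> = d (\<phi> i) (\<phi> (Suc i))" using c by (simp add: m_assoc)
      finally show ?case using triangle[of \<one> "\<phi> i" "\<phi> (Suc i)"] c Suc by simp
    qed (simp add: \<phi>)
    then show ?thesis using \<phi>(2) by blast
  qed
  have "d f g \<le> 2 * N" if "f \<in> A" "g \<in> A" for f g
  proof -
    have "f \<in> carrier G" "g \<in> carrier G" using that A by blast+
    then have "d f g \<le> d f \<one> + d \<one> g" by (intro triangle) simp_all
    then show ?thesis using bound[OF that(1)] bound[OF that(2)] commute[of f \<one>] by simp
  qed
  then show "\<exists>B. \<forall>f\<in>A. \<forall>g\<in>A. d f g \<le> B" by (intro exI[of _ "real (2 * N)"]) simp
qed

lemma property_OB_subset:
  assumes "property_OB G T A" "B \<subseteq> A" shows "property_OB G T B"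
  unfolding property_OB_def
proof (intro conjI allI impI)
  show "B \<subseteq> carrier G" using assms by (auto simp: property_OB_def)
  fix d assume "right_invariant_compatible_metric G T d"
  then obtain C where "\<forall>f\<in>A. \<forall>g\<in>A. d f g \<le> C" using assms(1) unfolding property_OB_def by blast
  then show "\<exists>C. \<forall>f\<in>B. \<forall>g\<in>B. d f g \<le> C" using assms(2) by (intro exI[of _ C]) blast
qed

lemma set_power_carrier: "A \<subseteq> carrier G \<Longrightarrow> set_power G A n \<subseteq> carrier G"
  by (induction n) (auto simp: set_mult_def)

lemma set_power_mult:
  assumes "A \<subseteq> carrier G" "f \<in> set_power G A m" "g \<in> set_power G A n"
  shows "f \<otimes> g \<in> set_power G A (m + n)"
  using assms(3)
proof (induction n arbitrary: g)
  case 0 then show ?case using assms set_power_carrier[OF assms(1), of m] by auto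
next
  case (Suc n)
  then obtain h a where h: "h \<in> set_power G A n" "a \<in> A" "g = h \<otimes> a" by (auto simp: set_mult_def)
  moreover have "f \<otimes> (h \<otimes> a) = (f \<otimes> h) \<otimes> a"
    using h assms set_power_carrier[OF assms(1)] by (intro m_assoc[symmetric]) auto
  ultimately show ?case using Suc.IH[OF h(1)] by (auto simp: set_mult_def)
qed

lemma set_power_exhausts:
  assumes "symmetric_generating_set G A" "f \<in> carrier G"
  shows "\<exists>n. f \<in> set_power G A n"
proof -
  have A: "A \<subseteq> carrier G" "\<And>f. f \<in> A \<Longrightarrow> inv f \<in> A" "f \<in> generate G A"
    using assms by (auto simp: symmetric_generating_set_def)
  have 1: "a \<in> set_power G A (Suc 0)" if "a \<in> A" for a
    using that A(1) by (force simp: set_mult_def)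
  from A(3) show ?thesis
  proof induction
    case one
    have "\<one> \<in> set_power G A 0" by simp
    then show ?case by (rule exI)
  next
    case (incl h) then show ?case using 1 by blast
  next
    case (inv h) then show ?case using 1 A(2) by blast
  next
    case (eng h1 h2)
    then obtain m n where "h1 \<in> set_power G A m" "h2 \<in> set_power G A n" by blast
    then show ?case by (intro exI[of _ "m + n"] set_power_mult[OF A(1)])
  qed
qed

lemma length_set_power_le:
  assumes L: "length_function G len" and A: "A \<subseteq> carrier G" "\<And>f. f \<in> A \<Longrightarrow> len f \<le> B"
    and f: "f \<in> set_power G A n"
  shows "len f \<le> real n * B"
  using f
proof (induction n arbitrary: f)
  case 0
  have "len \<one> = 0" using L one_closed unfolding length_function_def by blast
  then show ?case using 0 by simp
next
  case (Suc n)
  from Suc.prems obtain h a where h: "h \<in> set_power G A n" "a \<in> A" "f = h \<otimes> a"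
    by (auto simp: set_mult_def)
  have c: "h \<in> carrier G" "a \<in> carrier G"
    using subsetD[OF set_power_carrier[OF A(1)] h(1)] subsetD[OF A(1) h(2)] by this+
  have "len f \<le> len h + len a"
    unfolding h(3) by (rule length_mult_le[OF L c])
  then have "len f \<le> real n * B + B" using Suc.IH[OF h(1)] A(2)[OF h(2)] by linarith
  also have "\<dots> = real (Suc n) * B" by (simp add: distrib_right)
  finally show ?case .
qed

text \<open>A compatible length is bounded by some \<open>B\<close> on an (OB) set \<open>A\<close>, hence by \<open>n * B\<close> on the \<open>n\<close>-fold
  products. A bounded Cayley metric would therefore bound the length on the whole group.\<close>

lemma nontrivial_qi_class_if_unbounded_length:
  assumes A: "openin T A" "symmetric_generating_set G A" "property_OB G T A"
    and len: "compatible_length len" and unbdd: "\<And>B. \<exists>f\<in>carrier G. B < len f"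
  shows "nontrivial_qi_class G T"
proof -
  have L: "length_function G len" using len by (simp add: compatible_length_def)
  have "\<not> quasi_isometric (carrier G) (cayley_metric G A) {()} (\<lambda>_ _. 0)"
    if A: "symmetric_generating_set G A" "property_OB G T A" for A
  proof
    assume "quasi_isometric (carrier G) (cayley_metric G A) {()} (\<lambda>_ _. 0)"
    then obtain C where C: "\<And>f g. f \<in> carrier G \<Longrightarrow> g \<in> carrier G \<Longrightarrow> cayley_metric G A f g \<le> C"
      using quasi_isometric_point_imp_bounded by blast
    have AC: "A \<subseteq> carrier G" using A by (simp add: property_OB_def)
    obtain B where B: "\<And>f. f \<in> A \<Longrightarrow> len f \<le> B"
      using property_OB_imp_length_bounded[OF A(2) len] by blast
    define B' where "B' = max B 0"
    have B': "\<And>f. f \<in> A \<Longrightarrow> len f \<le> B'" "0 \<le> B'" using B by (force simp: B'_def)+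
    obtain f where f: "f \<in> carrier G" "C * B' < len f" using unbdd by blast
    define n where "n = (LEAST n. f \<otimes> inv \<one> \<in> set_power G A n)"
    have "f \<otimes> inv \<one> \<in> set_power G A n"
      unfolding n_def using set_power_exhausts[OF A(1), of f] f by (intro LeastI_ex[of "\<lambda>n. f \<otimes> inv \<one> \<in> set_power G A n"]) simp
    then have "len f \<le> real n * B'" using length_set_power_le[OF L AC B'(1)] f by simp
    moreover have "real n \<le> C"
      using C[OF f(1) one_closed] by (simp add: cayley_metric_def n_def)
    then have "real n * B' \<le> C * B'" using B'(2) by (rule mult_right_mono)
    ultimately show False using f by simp
  qed
  moreover have "cayley_metric G A \<in> qi_class_metrics G T"
    using A unfolding qi_class_metrics_def by blast
  ultimately show ?thesis
    unfolding nontrivial_qi_class_def by (auto simp: qi_class_metrics_def)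
qed

end

section \<open>Calculus of smooth functions of one real coordinate\<close>

text \<open>Derivatives are taken within \<open>S\<close>. The unit interval carries the diffeomorphisms of the interval
  themselves, the real line carries the lifts of circle maps.\<close>

locale coordinate_domain =
  fixes S :: "real set"
  assumes S_cases: "S = {0..1} \<or> S = UNIV"
begin

abbreviation dS :: "nat \<Rightarrow> (real \<Rightarrow> real) \<Rightarrow> real \<Rightarrow> real" where
  "dS \<equiv> iter_deriv S"

lemma not_bot: "at x within S \<noteq> bot" if "x \<in> S"
proof -
  have "connected S" using S_cases by auto
  moreover have "S \<noteq> {a}" for a
  proof -
    have "0 \<in> S" "1 \<in> S" using S_cases by auto
    then show ?thesis by (metis singletonD zero_neq_one)
  qed
  ultimately show ?thesis
    using connected_imp_perfect[of S x] that by (auto simp: trivial_limit_within)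
qed

lemma dS_0 [simp]: "dS 0 f = f"
  by (simp add: iter_deriv_def)

lemma dS_Suc: "dS (Suc j) f = dS j (dS 1 f)"
  by (simp add: iter_deriv_def funpow_Suc_right del: funpow.simps)

lemma dS_shift: "dS j (dS (Suc 0) f) = dS (Suc j) f"
  using dS_Suc[of j f] by (simp only: One_nat_def)

lemma dS_Suc': "dS (Suc j) f = dS 1 (dS j f)"
  by (simp add: iter_deriv_def)

lemma dS_1_eq: "dS 1 f x = d" if "(f has_real_derivative d) (at x within S)" "x \<in> S"
  using that vector_derivative_within[OF not_bot]
  by (simp add: iter_deriv_def has_real_derivative_iff_has_vector_derivative)

lemma has_dS_1: "(f has_real_derivative dS 1 f x) (at x within S)"
  if diff: "f differentiable_on S" "x \<in> S"
proof -
  obtain d where "(f has_real_derivative d) (at x within S)"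
    using diff unfolding differentiable_on_def real_differentiable_def by blast
  then show ?thesis using dS_1_eq that(2) by simp
qed

lemma differentiable_onI: "(\<And>x. x \<in> S \<Longrightarrow> (f has_real_derivative d x) (at x within S)) \<Longrightarrow> f differentiable_on S"
  unfolding differentiable_on_def real_differentiable_def by blast

lemma dS_cong:
  assumes "\<And>x. x \<in> S \<Longrightarrow> f x = g x" "x \<in> S"
  shows "dS j f x = dS j g x"
  using assms(2)
proof (induction j arbitrary: x)
  case (Suc j)
  have "(dS j f has_vector_derivative v) (at x within S) \<longleftrightarrow> (dS j g has_vector_derivative v) (at x within S)" for v
    using has_vector_derivative_transform[OF Suc.prems, of "dS j g" "dS j f"]
      has_vector_derivative_transform[OF Suc.prems, of "dS j f" "dS j g"] Suc.IH by auto
  then show ?case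
    by (simp add: iter_deriv_def vector_derivative_def)
qed (simp add: assms)

lemma Ck_0: "Ck_on 0 S f \<longleftrightarrow> continuous_on S f"
  by (auto simp: Ck_on_def zero_enat_def)

lemma Ck_iff: "Ck_on k S f \<longleftrightarrow> (\<forall>n. enat n \<le> k \<longrightarrow> Ck_on (enat n) S f)"
proof (intro iffI allI impI)
  fix n assume "Ck_on k S f" "enat n \<le> k"
  then show "Ck_on (enat n) S f"
    unfolding Ck_on_def by (meson enat_ord_simps order_less_le_trans order_trans)
next
  assume h: "\<forall>n. enat n \<le> k \<longrightarrow> Ck_on (enat n) S f"
  have "dS j f differentiable_on S" if "enat j < k" for j
  proof -
    have "enat (Suc j) \<le> k" using that by (simp add: Suc_ile_eq)
    then show ?thesis using h unfolding Ck_on_def by (metis enat_ord_simps(2) lessI)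
  qed
  moreover have "continuous_on S (dS j f)" if "enat j \<le> k" for j
    using h that unfolding Ck_on_def by blast
  ultimately show "Ck_on k S f" unfolding Ck_on_def by blast
qed

lemma Ck_mono: "Ck_on k S f \<Longrightarrow> l \<le> k \<Longrightarrow> Ck_on l S f"
  unfolding Ck_iff[of k] Ck_iff[of l] using order_trans by blast

text \<open>This characterization turns every closure property of the class \<open>C\<^sup>k\<close> into an induction on \<open>k\<close>
  driven by the corresponding rule of differentiation.\<close>

lemma Ck_Suc: "Ck_on (enat (Suc n)) S f \<longleftrightarrow> f differentiable_on S \<and> Ck_on (enat n) S (dS 1 f)"
proof -
  have 1: "(\<forall>j<Suc n. P j) \<longleftrightarrow> P 0 \<and> (\<forall>j<n. P (Suc j))" for P by (metis less_Suc_eq_0_disj not_less_eq)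
  have 2: "(\<forall>j\<le>Suc n. P j) \<longleftrightarrow> P 0 \<and> (\<forall>j\<le>n. P (Suc j))" for P
    using 1[of P] by (metis Suc_le_mono le0 not0_implies_Suc)
  show ?thesis unfolding Ck_on_def enat_ord_simps 1 2 dS_Suc
    using differentiable_imp_continuous_on by auto
qed

lemma Ck_cong_imp:
  assumes eq: "\<And>x. x \<in> S \<Longrightarrow> f x = g x" and f: "Ck_on k S f"
  shows "Ck_on k S g"
proof -
  have E: "dS j f x = dS j g x" if "x \<in> S" for j x
    using eq that by (rule dS_cong)
  have "dS j g differentiable_on S" if j: "enat j < k" for j
    unfolding differentiable_on_def
  proof
    fix x assume x: "x \<in> S"
    have "dS j f differentiable (at x within S)"
      using f j x by (simp add: Ck_on_def differentiable_on_def)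
    then show "dS j g differentiable (at x within S)"
      by (rule differentiable_transform_within[OF _ zero_less_one x]) (rule E)
  qed
  moreover have "continuous_on S (dS j g)" if "enat j \<le> k" for j
  proof -
    have "continuous_on S (dS j f)" using f that by (simp add: Ck_on_def)
    then show ?thesis by (subst continuous_on_cong[OF refl E[symmetric]])
  qed
  ultimately show ?thesis unfolding Ck_on_def by blast
qed

lemma Ck_cong: "(\<And>x. x \<in> S \<Longrightarrow> f x = g x) \<Longrightarrow> Ck_on k S f \<longleftrightarrow> Ck_on k S g"
  using Ck_cong_imp[of f g k] Ck_cong_imp[of g f k] by auto

lemma Ck_differentiable: "Ck_on k S f \<Longrightarrow> 1 \<le> k \<Longrightarrow> f differentiable_on S"
  using Ck_mono[of k f "enat (Suc 0)"] Ck_Suc[of 0 f] by (simp add: one_enat_def)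

lemma Ck_SucI:
  assumes "\<And>x. x \<in> S \<Longrightarrow> (f has_real_derivative d x) (at x within S)" "Ck_on (enat n) S d"
  shows "Ck_on (enat (Suc n)) S f"
proof -
  have "Ck_on (enat n) S (dS 1 f)"
    using dS_1_eq[OF assms(1)] assms(2) by (subst Ck_cong[of _ d]) auto
  then show ?thesis using differentiable_onI[OF assms(1)] Ck_Suc by blast
qed

lemma Ck_const: "Ck_on k S (\<lambda>_. c)"
proof -
  have "Ck_on (enat n) S (\<lambda>_. c)" for n c
  proof (induction n arbitrary: c)
    case 0 show ?case by (simp add: Ck_0 flip: zero_enat_def)
  next
    case (Suc n) show ?case by (rule Ck_SucI[where d = "\<lambda>_. 0"]) (auto intro: Suc)
  qed
  then show ?thesis using Ck_iff by blast
qed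

lemma Ck_add:
  assumes "Ck_on k S f" "Ck_on k S g" shows "Ck_on k S (\<lambda>x. f x + g x)"
proof -
  have "Ck_on (enat n) S (\<lambda>x. f x + g x)" if "Ck_on (enat n) S f" "Ck_on (enat n) S g" for n f g
    using that
  proof (induction n arbitrary: f g)
    case 0 then show ?case by (simp add: Ck_0 continuous_on_add flip: zero_enat_def)
  next
    case (Suc n)
    then show ?case
      by (intro Ck_SucI[where d = "\<lambda>x. dS 1 f x + dS 1 g x"] DERIV_add has_dS_1) (auto simp: Ck_Suc)
  qed
  then show ?thesis using Ck_iff assms by blast
qed

lemma Ck_mult:
  assumes "Ck_on k S f" "Ck_on k S g" shows "Ck_on k S (\<lambda>x. f x * g x)"
proof -
  have "Ck_on (enat n) S (\<lambda>x. f x * g x)" if "Ck_on (enat n) S f" "Ck_on (enat n) S g" for n f g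
    using that
  proof (induction n arbitrary: f g)
    case 0 then show ?case by (simp add: Ck_0 continuous_on_mult flip: zero_enat_def)
  next
    case (Suc n)
    then have "Ck_on (enat n) S f" "Ck_on (enat n) S g"
      using Ck_mono by (meson enat_ord_simps(1) le_SucI order_refl)+
    with Suc show ?case
      by (intro Ck_SucI[where d = "\<lambda>x. dS 1 f x * g x + dS 1 g x * f x"] DERIV_mult has_dS_1 Ck_add)
        (auto simp: Ck_Suc)
  qed
  then show ?thesis using Ck_iff assms by blast
qed

lemma Ck_scale: "Ck_on k S f \<Longrightarrow> Ck_on k S (\<lambda>x. c * f x)"
  by (intro Ck_mult Ck_const)

lemma Ck_diff: "Ck_on k S f \<Longrightarrow> Ck_on k S g \<Longrightarrow> Ck_on k S (\<lambda>x. f x - g x)"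
  using Ck_add[of k f "\<lambda>x. - 1 * g x"] Ck_scale[of k g "-1"] by simp

lemma Ck_id: "Ck_on k S (\<lambda>x. x)"
proof -
  have "Ck_on (enat n) S (\<lambda>x. x)" for n
  proof (cases n)
    case 0 then show ?thesis by (simp add: Ck_0 flip: zero_enat_def)
  next
    case (Suc m) show ?thesis unfolding Suc
      by (rule Ck_SucI[where d = "\<lambda>_. 1"]) (auto intro: Ck_const)
  qed
  then show ?thesis using Ck_iff by blast
qed

lemma has_deriv_compose:
  assumes "u differentiable_on S" "F differentiable_on S" "F \<in> S \<rightarrow> S" "x \<in> S"
  shows "((\<lambda>x. u (F x)) has_real_derivative dS 1 u (F x) * dS 1 F x) (at x within S)"
proof -
  have "(u has_real_derivative dS 1 u (F x)) (at (F x) within F ` S)"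
    using has_dS_1[OF assms(1), of "F x"] assms(3,4)
    by (auto simp: Pi_iff intro: has_field_derivative_subset)
  from DERIV_image_chain[OF this has_dS_1[OF assms(2,4)]] show ?thesis
    by (simp add: o_def)
qed

lemma Ck_compose:
  assumes "Ck_on k S u" "Ck_on k S F" "F \<in> S \<rightarrow> S" shows "Ck_on k S (\<lambda>x. u (F x))"
proof -
  have "Ck_on (enat n) S (\<lambda>x. u (F x))" if "Ck_on (enat n) S u" "Ck_on (enat n) S F" for n u
    using that
  proof (induction n arbitrary: u)
    case 0 then show ?case using assms(3)
      by (auto simp: Ck_0 Pi_iff image_subset_iff simp flip: zero_enat_def intro: continuous_on_compose2)
  next
    case (Suc n)
    then have "Ck_on (enat n) S F" using Ck_mono by (meson enat_ord_simps(1) le_SucI order_refl)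
    with Suc show ?case
      by (intro Ck_SucI[where d = "\<lambda>x. dS 1 u (F x) * dS 1 F x"] has_deriv_compose Ck_mult assms(3))
        (auto simp: Ck_Suc)
  qed
  then show ?thesis using Ck_iff assms by blast
qed

lemma Ck_inverse:
  assumes "Ck_on k S f" "\<And>x. x \<in> S \<Longrightarrow> f x \<noteq> 0" shows "Ck_on k S (\<lambda>x. inverse (f x))"
proof -
  have "Ck_on (enat n) S (\<lambda>x. inverse (f x))" if "Ck_on (enat n) S f" for n
    using that
  proof (induction n)
    case 0 then show ?case using assms(2) by (simp add: Ck_0 continuous_on_inverse flip: zero_enat_def)
  next
    case (Suc n)
    then have "Ck_on (enat n) S f" using Ck_mono by (meson enat_ord_simps(1) le_SucI order_refl)
    with Suc show ?case using assms(2)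
      by (intro Ck_SucI[where d = "\<lambda>x. -1 * (inverse (f x) * dS 1 f x * inverse (f x))"] Ck_mult Ck_const)
        (auto simp: Ck_Suc simp del: One_nat_def intro!: DERIV_inverse' has_dS_1)
  qed
  then show ?thesis using Ck_iff assms by blast
qed

text \<open>The derivative of \<open>G\<close> is \<open>1 / (F' \<circ> G)\<close>, which is as smooth as the worse of \<open>F'\<close> and \<open>G\<close>;
  so the smoothness of \<open>G\<close> climbs by one order at a time until it reaches that of \<open>F\<close>.\<close>

lemma Ck_inverse_function:
  assumes F: "Ck_on k S F" "F \<in> S \<rightarrow> S" "1 \<le> k" and G: "G \<in> S \<rightarrow> S"
    and inv: "\<And>x. x \<in> S \<Longrightarrow> F (G x) = x" "\<And>x. x \<in> S \<Longrightarrow> G (F x) = x"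
    and nz: "\<And>x. x \<in> S \<Longrightarrow> dS 1 F x \<noteq> 0" and cont: "continuous_on S G"
  shows "Ck_on k S G"
proof -
  have FS: "F ` S = S" using F(2) G inv by force
  have der: "(G has_real_derivative inverse (dS 1 F (G y))) (at y within S)" if y: "y \<in> S" for y
  proof -
    define x where "x = G y"
    have x: "x \<in> S" "F x = y" using y G inv by (auto simp: x_def)
    have "(F has_derivative (\<lambda>h. dS 1 F x * h)) (at x within S)"
      using has_dS_1[OF Ck_differentiable[OF F(1,3)] x(1)] by (simp add: has_field_derivative_def)
    moreover have "continuous (at (F x) within F ` S) G"
      using cont y x FS by (simp add: continuous_on_eq_continuous_within)
    ultimately have "(G has_derivative (\<lambda>h. inverse (dS 1 F x) * h)) (at (F x) within F ` S)"
      using x nz inv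
      by (intro has_derivative_inverse_within[where f' = "\<lambda>h. dS 1 F x * h"]) (auto intro: bounded_linear_mult_right)
    then show ?thesis using x FS by (simp add: has_field_derivative_def x_def)
  qed
  have "Ck_on (enat n) S G" if "Ck_on (enat n) S F" for n
    using that
  proof (induction n)
    case 0 then show ?case using cont by (simp add: Ck_0 flip: zero_enat_def)
  next
    case (Suc n)
    then have "Ck_on (enat n) S G" using Ck_mono by (meson enat_ord_simps(1) le_SucI order_refl)
    moreover have "Ck_on (enat n) S (dS 1 F)" using Suc.prems Ck_Suc by blast
    ultimately have "Ck_on (enat n) S (\<lambda>y. inverse (dS 1 F (G y)))"
      using nz G by (intro Ck_inverse[OF Ck_compose[OF _ _ G]]) auto
    then show ?case using der by (rule Ck_SucI[rotated])
  qed
  then show ?thesis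
    unfolding Ck_iff[of k G] using F(1)[unfolded Ck_iff[of k F]] by simp
qed

lemma Ck_Suc_le: "Ck_on (enat (Suc n)) S f \<Longrightarrow> Ck_on (enat n) S f"
  using Ck_mono by (meson enat_ord_simps(1) le_SucI order_refl)

lemma dS_lincomb:
  assumes "Ck_on (enat j) S f" "Ck_on (enat j) S g" "x \<in> S"
  shows "dS j (\<lambda>x. a * f x + b * g x) x = a * dS j f x + b * dS j g x"
  using assms
proof (induction j arbitrary: f g)
  case (Suc j)
  have "dS 1 (\<lambda>x. a * f x + b * g x) x = a * dS 1 f x + b * dS 1 g x" if "x \<in> S" for x
    using Suc that by (intro dS_1_eq DERIV_add DERIV_cmult has_dS_1) (auto simp: Ck_Suc)
  then have "dS (Suc j) (\<lambda>x. a * f x + b * g x) x = dS j (\<lambda>x. a * dS 1 f x + b * dS 1 g x) x"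
    unfolding dS_Suc[of j] using Suc.prems(3) by (rule dS_cong)
  then show ?case using Suc by (simp add: Ck_Suc dS_Suc[of j])
qed simp

lemma dS_add: "Ck_on (enat j) S f \<Longrightarrow> Ck_on (enat j) S g \<Longrightarrow> x \<in> S \<Longrightarrow>
    dS j (\<lambda>x. f x + g x) x = dS j f x + dS j g x"
  using dS_lincomb[of j f g x 1 1] by simp

lemma dS_diff: "Ck_on (enat j) S f \<Longrightarrow> Ck_on (enat j) S g \<Longrightarrow> x \<in> S \<Longrightarrow>
    dS j (\<lambda>x. f x - g x) x = dS j f x - dS j g x"
  using dS_lincomb[of j f g x 1 "-1"] by simp

lemma dS_scale: "Ck_on (enat j) S f \<Longrightarrow> x \<in> S \<Longrightarrow> dS j (\<lambda>x. a * f x) x = a * dS j f x"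
  using dS_lincomb[of j f f x a 0] by simp

lemma dS_const: "x \<in> S \<Longrightarrow> dS (Suc j) (\<lambda>_. c) x = 0"
proof (induction j arbitrary: x c)
  case 0 then show ?case using dS_1_eq[of "\<lambda>_. c" 0 x] by simp
next
  case (Suc j)
  have "dS 1 (\<lambda>_. c) x = 0" if "x \<in> S" for x using that by (intro dS_1_eq) auto
  then have "dS (Suc (Suc j)) (\<lambda>_. c) x = dS (Suc j) (\<lambda>_. 0) x"
    unfolding dS_Suc[of "Suc j"] using Suc by (intro dS_cong) auto
  then show ?case using Suc by simp
qed

lemma dS_1_id: "x \<in> S \<Longrightarrow> dS 1 (\<lambda>x. x) x = 1"
  by (intro dS_1_eq) auto

lemma dS_id: "x \<in> S \<Longrightarrow> dS (Suc j) (\<lambda>x. x) x = (if j = 0 then 1 else 0)"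
proof (cases j)
  case (Suc i)
  assume x: "x \<in> S"
  have "dS (Suc j) (\<lambda>x. x) x = dS j (\<lambda>_. 1) x"
    unfolding dS_Suc[of j] using x dS_1_id by (intro dS_cong) auto
  then show ?thesis using dS_const x Suc by simp
qed (use dS_1_id in simp)

lemma leibniz:
  assumes "Ck_on (enat n) S f" "Ck_on (enat n) S g" "x \<in> S"
  shows "dS n (\<lambda>x. f x * g x) x = (\<Sum>l\<le>n. real (n choose l) * (dS l f x * dS (n - l) g x))"
  using assms
proof (induction n arbitrary: f g)
  case (Suc n)
  have f: "Ck_on (enat n) S f" "Ck_on (enat n) S (dS 1 f)" and g: "Ck_on (enat n) S g" "Ck_on (enat n) S (dS 1 g)"
    using Suc.prems Ck_Suc Ck_Suc_le by blast+
  have "dS 1 (\<lambda>x. f x * g x) x = dS 1 f x * g x + f x * dS 1 g x" if "x \<in> S" for x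
  proof -
    have "((\<lambda>x. f x * g x) has_real_derivative (dS 1 f x * g x + dS 1 g x * f x)) (at x within S)"
      using Suc.prems that by (intro DERIV_mult has_dS_1) (auto simp: Ck_Suc)
    then show ?thesis using dS_1_eq that by (simp add: mult.commute)
  qed
  then have "dS (Suc n) (\<lambda>x. f x * g x) x = dS n (\<lambda>x. dS 1 f x * g x + f x * dS 1 g x) x"
    unfolding dS_Suc[of n] using assms(3) by (rule dS_cong)
  also have "\<dots> = dS n (\<lambda>x. dS 1 f x * g x) x + dS n (\<lambda>x. f x * dS 1 g x) x"
    using f g assms(3) by (intro dS_add Ck_mult)
  also have "\<dots> = (\<Sum>l\<le>n. real (n choose l) * (dS (Suc l) f x * dS (n - l) g x))
      + (\<Sum>l\<le>n. real (n choose l) * (dS l f x * dS (Suc (n - l)) g x))"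
    using f g assms(3) Suc.IH by (simp add: dS_shift)
  also have "(\<Sum>l\<le>n. real (n choose l) * (dS l f x * dS (Suc (n - l)) g x))
      = (\<Sum>l\<le>n. real (n choose l) * (dS l f x * dS (Suc n - l) g x))"
    by (intro sum.cong) (auto simp: Suc_diff_le)
  also have "\<dots> = (\<Sum>l\<le>Suc n. real (n choose l) * (dS l f x * dS (Suc n - l) g x))"
    by simp
  also have "\<dots> = dS 0 f x * dS (Suc n) g x
      + (\<Sum>l\<le>n. real (n choose Suc l) * (dS (Suc l) f x * dS (n - l) g x))"
    by (subst sum.atMost_Suc_shift) simp
  also have "(\<Sum>l\<le>n. real (n choose l) * (dS (Suc l) f x * dS (n - l) g x)) + (dS 0 f x * dS (Suc n) g x
      + (\<Sum>l\<le>n. real (n choose Suc l) * (dS (Suc l) f x * dS (n - l) g x)))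
    = dS 0 f x * dS (Suc n) g x + (\<Sum>l\<le>n. real (Suc n choose Suc l) * (dS (Suc l) f x * dS (n - l) g x))"
    by (simp add: sum.distrib algebra_simps)
  also have "\<dots> = (\<Sum>l\<le>Suc n. real (Suc n choose l) * (dS l f x * dS (Suc n - l) g x))"
    by (subst sum.atMost_Suc_shift) simp
  finally show ?case .
qed simp

text \<open>The value of the function itself is left out: two lifts of a circle map differ by a constant,
  and the \<open>C\<^sup>n\<close>-metric measures distances of values on the manifold and not on the line.\<close>

definition jet_norm :: "nat \<Rightarrow> (real \<Rightarrow> real) \<Rightarrow> real \<Rightarrow> real" where
  "jet_norm n u x = (\<Sum>j=1..n. \<bar>dS j u x\<bar>)"

lemma jet_norm_nonneg: "0 \<le> jet_norm n u x"
  by (simp add: jet_norm_def sum_nonneg)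

lemma abs_dS_le_jet_norm: "1 \<le> j \<Longrightarrow> j \<le> n \<Longrightarrow> \<bar>dS j u x\<bar> \<le> jet_norm n u x"
  unfolding jet_norm_def by (intro member_le_sum) auto

lemma jet_norm_dS_1_le: "jet_norm m (dS 1 u) x \<le> jet_norm (Suc m) u x"
proof -
  have "jet_norm m (dS 1 u) x = (\<Sum>j=1..m. \<bar>dS (Suc j) u x\<bar>)" by (simp add: jet_norm_def dS_shift)
  also have "\<dots> = (\<Sum>j=Suc 1..Suc m. \<bar>dS j u x\<bar>)" by (rule sum.shift_bounds_cl_Suc_ivl[symmetric])
  also have "\<dots> \<le> jet_norm (Suc m) u x" unfolding jet_norm_def by (intro sum_mono2) auto
  finally show ?thesis .
qed

end

section \<open>Jets of composite functions\<close>

context coordinate_domain begin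

text \<open>Write \<open>F = id + w\<close>. Then \<open>(u \<circ> F)' = (u' \<circ> F) + (u' \<circ> F) w'\<close>. To the first summand the induction
  hypothesis for \<open>u'\<close> applies. By the Leibniz rule each derivative of the second summand is a
  combination of products of a derivative of \<open>u' \<circ> F\<close>, again controlled by the induction hypothesis,
  with a derivative of \<open>w\<close>, which is at most \<open>e\<close>. The constant depends on \<open>e\<close> only through its bound
  \<open>B\<close>, which makes the estimate linear in \<open>e\<close>.\<close>

lemma compose_jet_bound:
  assumes "0 \<le> B"
  shows "\<exists>K\<ge>0. \<forall>e F u x i. 0 \<le> e \<and> e \<le> B \<and> F \<in> S \<rightarrow> S \<and> Ck_on (enat n) S F \<and> Ck_on (enat n) S u \<and> x \<in> S
     \<and> (\<forall>j\<in>{1..n}. \<bar>dS j (\<lambda>y. F y - y) x\<bar> \<le> e) \<and> i \<le> n \<longrightarrow>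
     \<bar>dS i (\<lambda>y. u (F y)) x - dS i u (F x)\<bar> \<le> K * e * jet_norm n u (F x)" (is "\<exists>K\<ge>0. ?P n K")
proof (induction n)
  case 0
  have "?P 0 0" by (intro allI impI) simp
  then show ?case by blast
next
  case (Suc n)
  then obtain K where K0: "K \<ge> 0" and PK: "?P n K" by (elim exE conjE)
  have K: "\<bar>dS i (\<lambda>y. u (F y)) x - dS i u (F x)\<bar> \<le> K * e * jet_norm n u (F x)"
    if "0 \<le> e" "e \<le> B" "F \<in> S \<rightarrow> S" "Ck_on (enat n) S F" "Ck_on (enat n) S u" "x \<in> S"
      "\<forall>j\<in>{1..n}. \<bar>dS j (\<lambda>y. F y - y) x\<bar> \<le> e" "i \<le> n" for e F u x i
    using PK[rule_format, of e F u x i] that by blast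
  define K' where "K' = K + 2 ^ n * (1 + K * B)"
  have K': "0 \<le> K'" "K \<le> K'" using K0 assms by (auto simp: K'_def)
  have main: "\<bar>dS (Suc i) (\<lambda>y. u (F y)) x - dS (Suc i) u (F x)\<bar> \<le> K' * e * jet_norm (Suc n) u (F x)"
    if e: "0 \<le> e" "e \<le> B" and F: "F \<in> S \<rightarrow> S" "Ck_on (enat (Suc n)) S F" and u: "Ck_on (enat (Suc n)) S u"
      and x: "x \<in> S" and w: "\<And>j. 1 \<le> j \<Longrightarrow> j \<le> Suc n \<Longrightarrow> \<bar>dS j (\<lambda>y. F y - y) x\<bar> \<le> e" and i: "i \<le> n"
    for e F u x i
  proof -
    define v where "v = dS 1 u"
    define w where "w = (\<lambda>y. F y - y)"
    define J where "J = jet_norm (Suc n) u (F x)"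
    have J0: "0 \<le> J" by (simp add: J_def jet_norm_nonneg)
    have Fx: "F x \<in> S" using F x by auto
    have Fn: "Ck_on (enat n) S F" using F(2) by (rule Ck_Suc_le)
    have v: "Ck_on (enat n) S v" using u Ck_Suc by (simp add: v_def)
    have wS: "Ck_on (enat (Suc n)) S w" unfolding w_def by (intro Ck_diff F(2) Ck_id)
    have wn: "Ck_on (enat n) S (dS 1 w)" using wS Ck_Suc by blast
    have vF: "Ck_on (enat n) S (\<lambda>y. v (F y))" by (rule Ck_compose[OF v Fn F(1)])
    have jv: "jet_norm n v (F x) \<le> J" unfolding v_def J_def by (rule jet_norm_dS_1_le)
    have IH: "\<bar>dS l (\<lambda>y. v (F y)) x - dS l v (F x)\<bar> \<le> K * e * J" if "l \<le> n" for l
    proof -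
      have "\<bar>dS l (\<lambda>y. v (F y)) x - dS l v (F x)\<bar> \<le> K * e * jet_norm n v (F x)"
        using that e F(1) Fn v x w by (intro K) (auto simp: w_def)
      also have "\<dots> \<le> K * e * J" using jv K0 e by (intro mult_left_mono) auto
      finally show ?thesis .
    qed
    have le: "enat i \<le> enat n" using i by simp
    have vl: "\<bar>dS l (\<lambda>y. v (F y)) x\<bar> \<le> (1 + K * B) * J" if "l \<le> n" for l
    proof -
      have "\<bar>dS l v (F x)\<bar> \<le> J" unfolding v_def J_def using that
        by (metis Suc_le_mono dS_Suc abs_dS_le_jet_norm le_add1 plus_1_eq_Suc)
      moreover have "K * e * J \<le> K * B * J" using e K0 J0 by (intro mult_right_mono mult_left_mono) auto
      ultimately show ?thesis using IH[OF that] by (simp add: algebra_simps)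
    qed
    have F1: "dS 1 F y = 1 + dS 1 w y" if "y \<in> S" for y
    proof -
      have "dS 1 w y = dS 1 F y - dS 1 (\<lambda>y. y) y"
        unfolding w_def using that F(2) Ck_mono[OF F(2), of 1] Ck_id
        by (metis One_nat_def dS_diff enat_ord_simps(1) le_add1 one_enat_def plus_1_eq_Suc)
      then show ?thesis using dS_1_id that by simp
    qed
    have "dS 1 (\<lambda>y. u (F y)) y = v (F y) + v (F y) * dS 1 w y" if "y \<in> S" for y
      using dS_1_eq[OF has_deriv_compose[of u F y] that] F(2) u F(1) that F1[OF that]
      by (simp add: Ck_Suc v_def algebra_simps)
    then have "dS (Suc i) (\<lambda>y. u (F y)) x = dS i (\<lambda>y. v (F y) + v (F y) * dS 1 w y) x"
      unfolding dS_Suc[of i] using x by (rule dS_cong)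
    also have "\<dots> = dS i (\<lambda>y. v (F y)) x + dS i (\<lambda>y. v (F y) * dS 1 w y) x"
      using vF wn x Ck_mono[OF _ le] by (intro dS_add Ck_mult) auto
    also have "dS i (\<lambda>y. v (F y) * dS 1 w y) x
        = (\<Sum>l\<le>i. real (i choose l) * (dS l (\<lambda>y. v (F y)) x * dS (i - l) (dS 1 w) x))"
      using vF wn x Ck_mono[OF _ le] by (intro leibniz) auto
    finally have eq: "dS (Suc i) (\<lambda>y. u (F y)) x = dS i (\<lambda>y. v (F y)) x
        + (\<Sum>l\<le>i. real (i choose l) * (dS l (\<lambda>y. v (F y)) x * dS (Suc (i - l)) w x))"
      by (simp add: dS_shift)
    have "\<bar>\<Sum>l\<le>i. real (i choose l) * (dS l (\<lambda>y. v (F y)) x * dS (Suc (i - l)) w x)\<bar>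
        \<le> (\<Sum>l\<le>i. real (i choose l) * ((1 + K * B) * J * e))"
    proof (rule order_trans[OF sum_abs], rule sum_mono)
      fix l assume l: "l \<in> {..i}"
      have "\<bar>dS (Suc (i - l)) w x\<bar> \<le> e" unfolding w_def using i by (intro \<open>\<And>j. 1 \<le> j \<Longrightarrow> j \<le> Suc n \<Longrightarrow> \<bar>dS j (\<lambda>y. F y - y) x\<bar> \<le> e\<close>) auto
      then have "\<bar>dS l (\<lambda>y. v (F y)) x\<bar> * \<bar>dS (Suc (i - l)) w x\<bar> \<le> ((1 + K * B) * J) * e"
        using vl[of l] l i by (intro mult_mono) auto
      then show "\<bar>real (i choose l) * (dS l (\<lambda>y. v (F y)) x * dS (Suc (i - l)) w x)\<bar>
          \<le> real (i choose l) * ((1 + K * B) * J * e)"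
        by (simp add: abs_mult mult_left_mono)
    qed
    also have "\<dots> = (\<Sum>l\<le>i. real (i choose l)) * ((1 + K * B) * J * e)"
      by (simp add: sum_distrib_right)
    also have "(\<Sum>l\<le>i. real (i choose l)) = 2 ^ i"
      using choose_row_sum[of i] by (metis of_nat_numeral of_nat_power of_nat_sum)
    also have "2 ^ i * ((1 + K * B) * J * e) \<le> 2 ^ n * ((1 + K * B) * J * e)"
      using i e J0 K0 assms by (intro mult_right_mono power_increasing) auto
    finally have "\<bar>dS (Suc i) (\<lambda>y. u (F y)) x - dS i (\<lambda>y. v (F y)) x\<bar> \<le> 2 ^ n * ((1 + K * B) * J * e)"
      using eq by simp
    moreover have "\<bar>dS i (\<lambda>y. v (F y)) x - dS (Suc i) u (F x)\<bar> \<le> K * e * J"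
      using IH[OF i] unfolding v_def dS_Suc[of i] .
    ultimately show ?thesis by (simp add: K'_def J_def algebra_simps)
  qed
  show ?case
  proof (intro exI[of _ K'] conjI allI impI K'(1))
    fix e F u x i
    assume h: "0 \<le> e \<and> e \<le> B \<and> F \<in> S \<rightarrow> S \<and> Ck_on (enat (Suc n)) S F \<and> Ck_on (enat (Suc n)) S u \<and> x \<in> S
     \<and> (\<forall>j\<in>{1..Suc n}. \<bar>dS j (\<lambda>y. F y - y) x\<bar> \<le> e) \<and> i \<le> Suc n"
    show "\<bar>dS i (\<lambda>y. u (F y)) x - dS i u (F x)\<bar> \<le> K' * e * jet_norm (Suc n) u (F x)"
    proof (cases i)
      case 0 then show ?thesis using h K' jet_norm_nonneg by simp
    next
      case (Suc j) then show ?thesis using h unfolding Suc by (intro main) auto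
    qed
  qed
qed

end

context coordinate_domain begin

text \<open>Pullback by \<open>F\<close> maps the \<open>n\<close>-jet of \<open>u\<close> at \<open>F x\<close> linearly to the \<open>n\<close>-jet of \<open>u \<circ> F\<close> at \<open>x\<close>. In the
  coordinate, both jets are vectors of \<open>n\<close> derivatives, and \<open>c\<close> bounds the operator norm of this map
  minus the identity, uniformly in \<open>x\<close>. Quantifying over \<open>u\<close> avoids writing down the matrix.\<close>

definition distortion_le :: "nat \<Rightarrow> real \<Rightarrow> (real \<Rightarrow> real) \<Rightarrow> bool" where
  "distortion_le n c F \<longleftrightarrow> (\<forall>u. Ck_on (enat n) S u \<longrightarrow> (\<forall>x\<in>S.
     (\<Sum>i=1..n. \<bar>dS i (\<lambda>y. u (F y)) x - dS i u (F x)\<bar>) \<le> c * jet_norm n u (F x)))"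

lemma distortion_leD:
  "distortion_le n c F \<Longrightarrow> Ck_on (enat n) S u \<Longrightarrow> x \<in> S \<Longrightarrow>
    (\<Sum>i=1..n. \<bar>dS i (\<lambda>y. u (F y)) x - dS i u (F x)\<bar>) \<le> c * jet_norm n u (F x)"
  by (simp add: distortion_le_def)

lemma distortion_le_mono:
  assumes "distortion_le n c F" "c \<le> d" shows "distortion_le n d F"
  unfolding distortion_le_def
proof (intro allI impI ballI)
  fix u x assume "Ck_on (enat n) S u" "x \<in> S"
  then have "(\<Sum>i=1..n. \<bar>dS i (\<lambda>y. u (F y)) x - dS i u (F x)\<bar>) \<le> c * jet_norm n u (F x)"
    by (rule distortion_leD[OF assms(1)])
  also have "\<dots> \<le> d * jet_norm n u (F x)" using assms(2) by (intro mult_right_mono jet_norm_nonneg)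
  finally show "(\<Sum>i=1..n. \<bar>dS i (\<lambda>y. u (F y)) x - dS i u (F x)\<bar>) \<le> d * jet_norm n u (F x)" .
qed

lemma distortion_le_id: "distortion_le n 0 (\<lambda>x. x)"
  by (simp add: distortion_le_def)

lemma jet_norm_triangle: "jet_norm n u x \<le> jet_norm n v y + (\<Sum>i=1..n. \<bar>dS i u x - dS i v y\<bar>)"
  unfolding jet_norm_def sum.distrib[symmetric] by (intro sum_mono) auto

lemma jet_norm_compose_le:
  assumes "distortion_le n c F" "Ck_on (enat n) S u" "x \<in> S"
  shows "jet_norm n (\<lambda>y. u (F y)) x \<le> (1 + c) * jet_norm n u (F x)"
  using jet_norm_triangle[of n "\<lambda>y. u (F y)" x u "F x"] distortion_leD[OF assms]
  by (simp add: algebra_simps)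

text \<open>Pullbacks compose, and if \<open>P\<close> and \<open>Q\<close> are at distance \<open>c\<close> and \<open>d\<close> from the identity then
  \<open>Q P - 1 = (Q - 1) P + (P - 1)\<close> has norm at most \<open>d (1 + c) + c\<close>.\<close>

lemma distortion_le_compose:
  assumes F: "distortion_le n c F" "Ck_on (enat n) S F" "F \<in> S \<rightarrow> S" "0 \<le> c"
    and G: "distortion_le n d G" "G \<in> S \<rightarrow> S" "0 \<le> d"
  shows "distortion_le n ((1 + c) * (1 + d) - 1) (\<lambda>x. F (G x))"
  unfolding distortion_le_def
proof (intro allI impI ballI)
  fix u x assume u: "Ck_on (enat n) S u" and x: "x \<in> S"
  define v where "v = (\<lambda>y. u (F y))"
  have v: "Ck_on (enat n) S v" unfolding v_def using u F(2,3) by (rule Ck_compose)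
  have Gx: "G x \<in> S" using G x by auto
  have "(\<Sum>i=1..n. \<bar>dS i (\<lambda>y. u (F (G y))) x - dS i u (F (G x))\<bar>)
      \<le> (\<Sum>i=1..n. \<bar>dS i (\<lambda>y. v (G y)) x - dS i v (G x)\<bar>) + (\<Sum>i=1..n. \<bar>dS i v (G x) - dS i u (F (G x))\<bar>)"
    unfolding sum.distrib[symmetric] v_def by (intro sum_mono) auto
  also have "\<dots> \<le> d * jet_norm n v (G x) + c * jet_norm n u (F (G x))"
    using distortion_leD[OF G(1) v x] distortion_leD[OF F(1) u Gx] by (auto simp: v_def)
  also have "d * jet_norm n v (G x) \<le> d * ((1 + c) * jet_norm n u (F (G x)))"
    using jet_norm_compose_le[OF F(1) u Gx] G(3) by (intro mult_left_mono) (auto simp: v_def)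
  finally show "(\<Sum>i=1..n. \<bar>dS i (\<lambda>y. u (F (G y))) x - dS i u (F (G x))\<bar>)
      \<le> ((1 + c) * (1 + d) - 1) * jet_norm n u (F (G x))"
    by (simp add: algebra_simps)
qed

text \<open>Apply the hypothesis to \<open>u = v \<circ> G\<close>, for which \<open>u \<circ> F = v\<close>. The jet of \<open>u\<close> then differs from that
  of \<open>v\<close> by at most \<open>c\<close> times its own size; for \<open>c < 1\<close> this can be solved for the jet of \<open>u\<close>.\<close>

lemma distortion_le_inverse:
  assumes F: "distortion_le n c F" "F \<in> S \<rightarrow> S" "0 \<le> c" "c < 1"
    and G: "Ck_on (enat n) S G" "G \<in> S \<rightarrow> S"
    and inv: "\<And>x. x \<in> S \<Longrightarrow> F (G x) = x" "\<And>x. x \<in> S \<Longrightarrow> G (F x) = x"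
  shows "distortion_le n (c / (1 - c)) G"
  unfolding distortion_le_def
proof (intro allI impI ballI)
  fix v x assume v: "Ck_on (enat n) S v" and x: "x \<in> S"
  define u where "u = (\<lambda>y. v (G y))"
  have u: "Ck_on (enat n) S u" unfolding u_def using v G by (rule Ck_compose)
  have Gx: "G x \<in> S" using G x by auto
  have "dS i (\<lambda>y. u (F y)) (G x) = dS i v (G x)" for i
    using Gx inv by (intro dS_cong) (auto simp: u_def)
  then have D: "(\<Sum>i=1..n. \<bar>dS i u x - dS i v (G x)\<bar>) \<le> c * jet_norm n u x"
    using distortion_leD[OF F(1) u Gx] inv x by (simp add: abs_minus_commute)
  then have "jet_norm n u x \<le> jet_norm n v (G x) + c * jet_norm n u x"
    using jet_norm_triangle[of n u x v "G x"] by simp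
  then have "jet_norm n u x \<le> jet_norm n v (G x) / (1 - c)"
    using F(4) by (simp add: field_simps)
  then have "c * jet_norm n u x \<le> c * (jet_norm n v (G x) / (1 - c))" using F(3) by (rule mult_left_mono)
  with D show "(\<Sum>i=1..n. \<bar>dS i (\<lambda>y. v (G y)) x - dS i v (G x)\<bar>) \<le> c / (1 - c) * jet_norm n v (G x)"
    by (simp add: u_def)
qed

lemma distortion_le_bound:
  assumes "0 \<le> B"
  obtains K where "K \<ge> 0"
    "\<forall>e F. 0 \<le> e \<and> e \<le> B \<and> F \<in> S \<rightarrow> S \<and> Ck_on (enat n) S F \<and>
      (\<forall>x\<in>S. \<forall>j\<in>{1..n}. \<bar>dS j (\<lambda>y. F y - y) x\<bar> \<le> e) \<longrightarrow> distortion_le n (K * e) F"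
proof -
  from compose_jet_bound[OF assms, of n] obtain K where K0: "K \<ge> 0"
    and K: "\<forall>e F u x i. 0 \<le> e \<and> e \<le> B \<and> F \<in> S \<rightarrow> S \<and> Ck_on (enat n) S F \<and> Ck_on (enat n) S u \<and> x \<in> S
     \<and> (\<forall>j\<in>{1..n}. \<bar>dS j (\<lambda>y. F y - y) x\<bar> \<le> e) \<and> i \<le> n \<longrightarrow>
     \<bar>dS i (\<lambda>y. u (F y)) x - dS i u (F x)\<bar> \<le> K * e * jet_norm n u (F x)"
    by (elim exE conjE)
  have "distortion_le n (real n * K * e) F"
    if h: "0 \<le> e \<and> e \<le> B \<and> F \<in> S \<rightarrow> S \<and> Ck_on (enat n) S F \<and>
      (\<forall>x\<in>S. \<forall>j\<in>{1..n}. \<bar>dS j (\<lambda>y. F y - y) x\<bar> \<le> e)" for e F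
    unfolding distortion_le_def
  proof (intro allI impI ballI)
    fix u x assume u: "Ck_on (enat n) S u" and x: "x \<in> S"
    have "\<bar>dS i (\<lambda>y. u (F y)) x - dS i u (F x)\<bar> \<le> K * e * jet_norm n u (F x)" if "i \<in> {1..n}" for i
      using K[rule_format, of e F u x i] that u x h by simp
    then have "(\<Sum>i=1..n. \<bar>dS i (\<lambda>y. u (F y)) x - dS i u (F x)\<bar>) \<le> (\<Sum>i=1..n. K * e * jet_norm n u (F x))"
      by (rule sum_mono)
    then show "(\<Sum>i=1..n. \<bar>dS i (\<lambda>y. u (F y)) x - dS i u (F x)\<bar>) \<le> real n * K * e * jet_norm n u (F x)"
      by (simp add: algebra_simps)
  qed
  moreover have "real n * K \<ge> 0" using K0 by simp
  ultimately show thesis by (intro that[of "real n * K"]) simp_all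
qed

lemma jet_norm_id: "x \<in> S \<Longrightarrow> 1 \<le> n \<Longrightarrow> jet_norm n (\<lambda>x. x) x = 1"
proof -
  assume x: "x \<in> S" and n: "1 \<le> n"
  have "jet_norm n (\<lambda>x. x) x = (\<Sum>j=1..n. if j = 1 then 1 else 0)"
    unfolding jet_norm_def
  proof (rule sum.cong[OF refl])
    fix j assume "j \<in> {1..n}"
    then obtain i where "j = Suc i" by (cases j) auto
    then show "\<bar>dS j (\<lambda>x. x) x\<bar> = (if j = 1 then 1 else 0)" using dS_id[OF x, of i] by simp
  qed
  also have "\<dots> = 1" using n by simp
  finally show ?thesis .
qed

text \<open>The jet of the identity function at any point is \<open>(1, 0, \<dots>, 0)\<close>, so testing the distortion with
  it compares the jets of \<open>F\<close> and of the identity.\<close>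

lemma jet_norm_diff_id_le:
  assumes F: "distortion_le n c F" "Ck_on (enat n) S F" "F \<in> S \<rightarrow> S" and c: "0 \<le> c" and x: "x \<in> S"
  shows "jet_norm n (\<lambda>y. F y - y) x \<le> c"
proof (cases "n = 0")
  case True then show ?thesis using c by (simp add: jet_norm_def)
next
  case False
  have "dS i (\<lambda>y. F y - y) x = dS i F x - dS i (\<lambda>y. y) (F x)" if i: "i \<in> {1..n}" for i
  proof -
    have le: "enat i \<le> enat n" using i by simp
    obtain i' where "i = Suc i'" using i by (cases i) auto
    then have "dS i (\<lambda>y. y) (F x) = dS i (\<lambda>y. y) x"
      using dS_id[OF x] dS_id[OF funcset_mem[OF F(3) x]] by simp
    then show ?thesis using dS_diff[OF Ck_mono[OF F(2) le] Ck_id x] by simp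
  qed
  then have "jet_norm n (\<lambda>y. F y - y) x = (\<Sum>i=1..n. \<bar>dS i F x - dS i (\<lambda>y. y) (F x)\<bar>)"
    unfolding jet_norm_def by (intro sum.cong) auto
  also have "\<dots> \<le> c * jet_norm n (\<lambda>y. y) (F x)" using distortion_leD[OF F(1) Ck_id x] by simp
  also have "\<dots> = c" using jet_norm_id[of "F x" n] x F(3) False by auto
  finally show ?thesis .
qed

section \<open>Lifts of diffeomorphisms\<close>

text \<open>On the real line this is commutation with the unit translation. On \<open>[0,1]\<close> only \<open>x = 0\<close> is
  concerned and the condition says that \<open>F\<close> fixes both end points.\<close>

definition equivariant :: "(real \<Rightarrow> real) \<Rightarrow> bool" where
  "equivariant F \<longleftrightarrow> (\<forall>x\<in>S. x + 1 \<in> S \<longrightarrow> F (x + 1) = F x + 1)"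

definition lifts :: "enat \<Rightarrow> (real \<Rightarrow> real) set" where
  "lifts k = {F. F \<in> S \<rightarrow> S \<and> Ck_on k S F \<and> equivariant F \<and> strict_mono_on S F \<and>
     (\<exists>G\<in>S \<rightarrow> S. Ck_on k S G \<and> (\<forall>x\<in>S. F (G x) = x \<and> G (F x) = x))}"

lemma liftsD:
  assumes "F \<in> lifts k"
  shows "F \<in> S \<rightarrow> S" "Ck_on k S F" "equivariant F" "strict_mono_on S F"
  using assms by (auto simp: lifts_def)

lemma lifts_id: "(\<lambda>x. x) \<in> lifts k"
  by (auto simp: lifts_def Ck_id equivariant_def strict_mono_on_def intro!: bexI[of _ "\<lambda>x. x"])

lemma lifts_compose:
  assumes F: "F \<in> lifts k" and G: "G \<in> lifts k" shows "(\<lambda>x. F (G x)) \<in> lifts k"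
proof -
  obtain F' where F': "F' \<in> S \<rightarrow> S" "Ck_on k S F'" "\<And>x. x \<in> S \<Longrightarrow> F (F' x) = x \<and> F' (F x) = x"
    using F by (auto simp: lifts_def)
  obtain G' where G': "G' \<in> S \<rightarrow> S" "Ck_on k S G'" "\<And>x. x \<in> S \<Longrightarrow> G (G' x) = x \<and> G' (G x) = x"
    using G by (auto simp: lifts_def)
  note FD = liftsD[OF F] and GD = liftsD[OF G]
  show ?thesis unfolding lifts_def
  proof (intro CollectI conjI bexI[of _ "\<lambda>x. G' (F' x)"])
    show "(\<lambda>x. F (G x)) \<in> S \<rightarrow> S" using FD GD by auto
    show "Ck_on k S (\<lambda>x. F (G x))" by (rule Ck_compose[OF FD(2) GD(2) GD(1)])
    show "equivariant (\<lambda>x. F (G x))"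
      using FD(1,3) GD(1,3) unfolding equivariant_def by (metis funcset_mem)
    show "strict_mono_on S (\<lambda>x. F (G x))"
      using FD(4) GD(1,4) unfolding strict_mono_on_def by (auto simp: Pi_iff)
    show "Ck_on k S (\<lambda>x. G' (F' x))" by (rule Ck_compose[OF G'(2) F'(2) F'(1)])
    show "\<forall>x\<in>S. F (G (G' (F' x))) = x \<and> G' (F' (F (G x))) = x"
      using F' G' FD GD by (auto simp: Pi_iff)
    show "(\<lambda>x. G' (F' x)) \<in> S \<rightarrow> S" using F' G' by auto
  qed
qed

lemma fixes_endpoints:
  assumes "F \<in> S \<rightarrow> S" "equivariant F" "S = {0..1}" shows "F 0 = 0" "F 1 = 1"
proof -
  have "0 \<in> S" "0 + 1 \<in> S" using assms(3) by auto
  then have "F 1 = F 0 + 1" using assms(2) unfolding equivariant_def by (metis add_0)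
  moreover have "F 0 \<in> {0..1}" "F 1 \<in> {0..1}" using assms by auto
  ultimately show "F 0 = 0" "F 1 = 1" by auto
qed

lemma strict_mono_on_less_iff:
  "strict_mono_on S F \<Longrightarrow> x \<in> S \<Longrightarrow> y \<in> S \<Longrightarrow> F x < F y \<longleftrightarrow> x < y" for F :: "real \<Rightarrow> real"
  by (metis linorder_less_linear order_less_asym strict_mono_onD)

lemma lifts_inverse:
  assumes F: "F \<in> lifts k"
  obtains G where "G \<in> lifts k" "\<forall>x\<in>S. F (G x) = x \<and> G (F x) = x"
proof -
  note FD = liftsD[OF F]
  obtain G where G: "G \<in> S \<rightarrow> S" "Ck_on k S G" "\<And>x. x \<in> S \<Longrightarrow> F (G x) = x" "\<And>x. x \<in> S \<Longrightarrow> G (F x) = x"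
    using F by (auto simp: lifts_def)
  have "strict_mono_on S G"
  proof (rule strict_mono_onI)
    fix x y assume "x \<in> S" "y \<in> S" "x < y"
    then show "G x < G y"
      using strict_mono_on_less_iff[OF FD(4), of "G x" "G y"] G by (auto simp: Pi_iff)
  qed
  moreover have "equivariant G"
    unfolding equivariant_def
  proof (intro ballI impI)
    fix x assume x: "x \<in> S" "x + 1 \<in> S"
    show "G (x + 1) = G x + 1"
      using S_cases
    proof
      assume S: "S = {0..1}"
      then have "x = 0" using x by auto
      then show ?thesis using fixes_endpoints[OF FD(1,3) S] G(4)[of 0] G(4)[of 1] S by simp
    next
      assume S: "S = UNIV"
      have "F (G x + 1) = x + 1"
        using FD(3) G(3)[OF x(1)] S unfolding equivariant_def by (metis UNIV_I)
      then show ?thesis using G(4)[of "G x + 1"] S by simp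
    qed
  qed
  ultimately have "G \<in> lifts k"
    using G FD by (auto simp: lifts_def)
  moreover have "\<forall>x\<in>S. F (G x) = x \<and> G (F x) = x" using G(3,4) by blast
  ultimately show thesis by (rule that)
qed

lemma deriv_ge:
  assumes d: "(F has_real_derivative D) (at x within S)" and x: "x \<in> S"
    and m: "\<And>x y. x \<in> S \<Longrightarrow> y \<in> S \<Longrightarrow> x \<le> y \<Longrightarrow> m * (y - x) \<le> F y - F x"
  shows "m \<le> D"
proof (rule tendsto_lowerbound[OF _ _ not_bot[OF x]])
  show "((\<lambda>y. (F y - F x) / (y - x)) \<longlongrightarrow> D) (at x within S)"
    using d by (simp add: has_field_derivative_iff)
  have "m \<le> (F y - F x) / (y - x)" if "y \<in> S" "y \<noteq> x" for y
  proof (cases "x < y")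
    case True then show ?thesis using m[of x y] x that by (simp add: field_simps)
  next
    case False then have "y < x" using that by simp
    then show ?thesis using m[of y x] x that by (simp add: field_simps)
  qed
  then show "\<forall>\<^sub>F y in at x within S. m \<le> (F y - F x) / (y - x)"
    by (auto simp: eventually_at_filter)
qed

text \<open>Expansion by at least \<open>m\<close> makes \<open>F\<close> injective with Lipschitz inverse and its derivative at least
  \<open>m\<close>; surjectivity is the intermediate value theorem.\<close>

lemma liftsI:
  assumes F: "F \<in> S \<rightarrow> S" "Ck_on k S F" "equivariant F" "1 \<le> k"
    and m0: "0 < m" and m: "\<And>x y. x \<in> S \<Longrightarrow> y \<in> S \<Longrightarrow> x \<le> y \<Longrightarrow> m * (y - x) \<le> F y - F x"
  shows "F \<in> lifts k"
proof -
  have cont: "continuous_on S F"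
    using Ck_differentiable[OF F(2,4)] by (rule differentiable_imp_continuous_on)
  have mono: "strict_mono_on S F"
  proof (rule strict_mono_onI)
    fix x y assume "x \<in> S" "y \<in> S" "x < y"
    then have "0 < m * (y - x)" "m * (y - x) \<le> F y - F x"
      using m0 m[of x y] by auto
    then show "F x < F y" by linarith
  qed
  have surj: "\<exists>x\<in>S. F x = y" if y: "y \<in> S" for y
    using S_cases
  proof
    assume S: "S = {0..1}"
    have "\<exists>x. 0 \<le> x \<and> x \<le> 1 \<and> F x = y"
      using fixes_endpoints[OF F(1,3) S] y S cont by (intro IVT') auto
    then show ?thesis using S by auto
  next
    assume S: "S = UNIV"
    define b where "b = (\<bar>y\<bar> + \<bar>F 0\<bar>) / m"
    have b: "0 \<le> b" using m0 by (simp add: b_def)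
    have "m * (b - 0) \<le> F b - F 0" "m * (0 - - b) \<le> F 0 - F (- b)"
      using m[of 0 b] m[of "- b" 0] b S by auto
    moreover have "m * b = \<bar>y\<bar> + \<bar>F 0\<bar>" using m0 by (simp add: b_def)
    ultimately have "F (- b) \<le> y" "y \<le> F b" by (auto simp: right_diff_distrib)
    then have "\<exists>x. - b \<le> x \<and> x \<le> b \<and> F x = y"
      using b cont S by (intro IVT') (auto intro: continuous_on_subset)
    then show ?thesis using S by auto
  qed
  define G where "G = inv_into S F"
  have inj: "inj_on F S" using mono by (rule strict_mono_on_imp_inj_on)
  have img: "F ` S = S" using F(1) surj by force
  have G: "G \<in> S \<rightarrow> S" "\<And>x. x \<in> S \<Longrightarrow> F (G x) = x" "\<And>x. x \<in> S \<Longrightarrow> G (F x) = x"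
    using img inj by (auto simp: G_def inv_into_into f_inv_into_f)
  have lip: "dist (G x) (G y) \<le> (1 / m) * dist x y" if xy: "x \<in> S" "y \<in> S" for x y
  proof -
    have "m * \<bar>G x - G y\<bar> \<le> \<bar>x - y\<bar>"
      using m[of "G x" "G y"] m[of "G y" "G x"] G xy by (cases "G x \<le> G y") (auto simp: Pi_iff)
    then show ?thesis using m0 by (simp add: dist_real_def field_simps)
  qed
  have "(1 / m)-lipschitz_on S G" using lip m0 by (intro lipschitz_onI) auto
  then have "continuous_on S G" by (rule lipschitz_on_continuous_on)
  moreover have "dS 1 F x \<noteq> 0" if "x \<in> S" for x
    using deriv_ge[OF has_dS_1[OF Ck_differentiable[OF F(2,4)] that] that m] m0 by simp
  ultimately have "Ck_on k S G"
    by (intro Ck_inverse_function[OF F(2,1,4) G])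
  then show ?thesis using F mono G by (auto simp: lifts_def)
qed

text \<open>For \<open>t < 1\<close> the identity summand expands by \<open>1 - t\<close>, and the monotone summand only adds to this.\<close>

lemma lifts_convex:
  assumes F: "F \<in> lifts k" and k: "1 \<le> k" and t: "0 \<le> t" "t \<le> 1"
  shows "(\<lambda>x. (1 - t) * x + t * F x) \<in> lifts k"
proof (cases "t = 1")
  case True then show ?thesis using F by simp
next
  case False
  note FD = liftsD[OF F]
  show ?thesis
  proof (rule liftsI)
    show "(\<lambda>x. (1 - t) * x + t * F x) \<in> S \<rightarrow> S"
    proof
      fix x assume x: "x \<in> S"
      have "convex S" using S_cases by auto
      then show "(1 - t) * x + t * F x \<in> S"
        using convexD[of S x "F x" "1 - t" t] x FD(1) t by auto
    qed
    show "Ck_on k S (\<lambda>x. (1 - t) * x + t * F x)"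
      by (intro Ck_add Ck_scale Ck_id FD)
    show "equivariant (\<lambda>x. (1 - t) * x + t * F x)"
      using FD(3) by (simp add: equivariant_def algebra_simps)
    show "(1 - t) * (y - x) \<le> (1 - t) * y + t * F y - ((1 - t) * x + t * F x)"
      if "x \<in> S" "y \<in> S" "x \<le> y" for x y
    proof -
      have "F x \<le> F y" using FD(4) that by (metis nle_le order_le_less strict_mono_onD)
      then have "t * F x \<le> t * F y" using t by (simp add: mult_left_mono)
      then show ?thesis by (simp add: algebra_simps)
    qed
  qed (use k t False in auto)
qed

lemma dS_periodic:
  assumes "equivariant F" "S = UNIV"
  shows "dS (Suc j) F (x + 1) = dS (Suc j) F x"
proof -
  have step: "dS 1 F (x + 1) = dS 1 F x" if "\<And>x. F (x + 1) = F x + c" for F c x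
  proof -
    have "(F has_real_derivative v) (at (x + 1)) \<longleftrightarrow> (F has_real_derivative v) (at x)" for v
    proof -
      have "(F has_real_derivative v) (at (x + 1)) \<longleftrightarrow> ((\<lambda>x. F x + c) has_real_derivative v) (at x)"
        using DERIV_shift[of F v x 1] that by simp
      also have "\<dots> \<longleftrightarrow> (F has_real_derivative v) (at x)"
        using DERIV_add[of "\<lambda>x. F x + c" v x UNIV "\<lambda>x. - c" 0] DERIV_add[of F v x UNIV "\<lambda>x. c" 0] by auto
      finally show ?thesis .
    qed
    then show ?thesis
      using assms(2) by (simp add: iter_deriv_def vector_derivative_def has_real_derivative_iff_has_vector_derivative)
  qed
  show ?thesis
  proof (induction j arbitrary: x)
    case 0
    have "F (x + 1) = F x + 1" for x using assms unfolding equivariant_def by blast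
    from step[of F 1 x, OF this] show ?case by simp
  next
    case (Suc j) then show ?case using step[of "dS (Suc j) F" 0 x] by (simp add: dS_Suc'[of "Suc j"])
  qed
qed

text \<open>The point \<open>y\<close> is the fractional part of \<open>x\<close> on the real line, and the same point serves all \<open>F\<close>.
  Suprema over \<open>[0,1]\<close>, as in the \<open>C\<^sup>n\<close>-metric, thereby control all of \<open>S\<close>.\<close>

lemma reduce_to_unit_interval:
  assumes "x \<in> S"
  obtains y where "y \<in> {0..1}" "y \<in> S"
    "\<forall>F. equivariant F \<longrightarrow> F x - x = F y - y \<and> (\<forall>j\<ge>1. dS j F x = dS j F y)"
  using S_cases
proof
  assume S: "S = {0..1}" then show thesis using assms by (intro that[of x]) auto
next
  assume S: "S = UNIV"
  define y where "y = frac x"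
  have x: "x = y + of_int \<lfloor>x\<rfloor>" by (simp add: y_def frac_def)
  have per: "f (y + of_int i) = f y" if f: "\<And>z. f (z + 1) = f z" for f :: "real \<Rightarrow> real" and i :: int
  proof (induction i rule: int_induct[where k = 0])
    case (step1 i) then show ?case using f[of "y + of_int i"] by (simp add: add.assoc)
  next
    case (step2 i) then show ?case using f[of "y + of_int i - 1"] by (simp add: algebra_simps)
  qed simp
  show thesis
  proof (rule that[of y])
    show "y \<in> {0..1}" unfolding y_def using frac_lt_1[of x] frac_ge_0[of x] by auto
    show "y \<in> S" using S by simp
    have A: "dS j F x = dS j F y" if "equivariant F" "1 \<le> j" for F j
    proof -
      obtain i where i: "j = Suc i" using \<open>1 \<le> j\<close> by (cases j) auto
      show ?thesis unfolding i using per[of "dS (Suc i) F" "\<lfloor>x\<rfloor>"] dS_periodic[OF that(1) S, of i] x by simp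
    qed
    have B: "F x - x = F y - y" if "equivariant F" for F
    proof -
      have "F (z + 1) - (z + 1) = F z - z" for z using that S unfolding equivariant_def by simp
      from per[of "\<lambda>z. F z - z", OF this, of "\<lfloor>x\<rfloor>"] show ?thesis using x by simp
    qed
    show "\<forall>F. equivariant F \<longrightarrow> F x - x = F y - y \<and> (\<forall>j\<ge>1. dS j F x = dS j F y)"
      by (intro allI impI conjI) (erule B, erule A)
  qed
qed

text \<open>A lift is determined up to an integer; the normalization at \<open>0\<close> bounds its displacement uniformly
  over the whole group, so that all rotations are within bounded reach of the identity.\<close>

lemma lift_near_id:
  assumes F: "F \<in> lifts k" and F0: "\<bar>F 0\<bar> \<le> 1" and x: "x \<in> S"
  shows "\<bar>F x - x\<bar> \<le> 2"
proof -
  note FD = liftsD[OF F]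
  obtain y where y: "y \<in> {0..1}" "y \<in> S" "F x - x = F y - y"
    by (rule reduce_to_unit_interval[OF x]) (use FD(3) in blast)
  have S: "0 \<in> S" "1 \<in> S" using S_cases by auto
  have mono: "F a \<le> F b" if "a \<in> S" "b \<in> S" "a \<le> b" for a b
    using FD(4) that by (metis nle_le order_le_less strict_mono_onD)
  have "F 1 = F 0 + 1" using FD(3) S by (auto simp: equivariant_def)
  then show ?thesis using mono[of 0 y] mono[of y 1] S y F0 by auto
qed

lemma sin_derivs:
  assumes "x \<in> S"
  shows "dS (2 * j) (\<lambda>x. sin (w * x)) x = (-1) ^ j * w ^ (2 * j) * sin (w * x)"
    "dS (Suc (2 * j)) (\<lambda>x. sin (w * x)) x = (-1) ^ j * w ^ Suc (2 * j) * cos (w * x)"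
proof -
  have *: "(\<forall>x\<in>S. dS (2 * j) (\<lambda>x. sin (w * x)) x = (-1) ^ j * w ^ (2 * j) * sin (w * x)) \<and>
     (\<forall>x\<in>S. dS (Suc (2 * j)) (\<lambda>x. sin (w * x)) x = (-1) ^ j * w ^ Suc (2 * j) * cos (w * x))"
  proof (induction j)
    case 0
    have "dS 1 (\<lambda>x. sin (w * x)) x = w * cos (w * x)" if "x \<in> S" for x
      using that by (intro dS_1_eq) (auto intro!: derivative_eq_intros)
    then show ?case by simp
  next
    case (Suc j)
    have A: "dS (2 * Suc j) (\<lambda>x. sin (w * x)) x = (-1) ^ Suc j * w ^ (2 * Suc j) * sin (w * x)" if x: "x \<in> S" for x
    proof -
      have "dS (2 * Suc j) (\<lambda>x. sin (w * x)) x = dS 1 (dS (Suc (2 * j)) (\<lambda>x. sin (w * x))) x"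
        using dS_Suc'[of "Suc (2 * j)"] by simp
      also have "\<dots> = dS 1 (\<lambda>x. (-1) ^ j * w ^ Suc (2 * j) * cos (w * x)) x"
        using Suc x by (intro dS_cong) auto
      also have "\<dots> = (-1) ^ Suc j * w ^ (2 * Suc j) * sin (w * x)"
        using x by (intro dS_1_eq) (auto intro!: derivative_eq_intros)
      finally show ?thesis .
    qed
    have "dS (Suc (2 * Suc j)) (\<lambda>x. sin (w * x)) x = (-1) ^ Suc j * w ^ Suc (2 * Suc j) * cos (w * x)" if x: "x \<in> S" for x
    proof -
      have "dS (Suc (2 * Suc j)) (\<lambda>x. sin (w * x)) x = dS 1 (dS (2 * Suc j) (\<lambda>x. sin (w * x))) x"
        using dS_Suc'[of "2 * Suc j"] by simp
      also have "\<dots> = dS 1 (\<lambda>x. (-1) ^ Suc j * w ^ (2 * Suc j) * sin (w * x)) x"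
        using A x by (intro dS_cong) auto
      also have "\<dots> = (-1) ^ Suc j * w ^ Suc (2 * Suc j) * cos (w * x)"
        using x by (intro dS_1_eq) (auto intro!: derivative_eq_intros)
      finally show ?thesis .
    qed
    with A show ?case by blast
  qed
  show "dS (2 * j) (\<lambda>x. sin (w * x)) x = (-1) ^ j * w ^ (2 * j) * sin (w * x)"
    "dS (Suc (2 * j)) (\<lambda>x. sin (w * x)) x = (-1) ^ j * w ^ Suc (2 * j) * cos (w * x)"
    using * assms by blast+
qed

lemma Ck_sin: "Ck_on k S (\<lambda>x. sin (w * x))"
proof -
  have "Ck_on (enat n) S (\<lambda>x. sin (w * x)) \<and> Ck_on (enat n) S (\<lambda>x. cos (w * x))" for n
  proof (induction n)
    case 0 then show ?case by (auto simp: Ck_0 simp flip: zero_enat_def intro!: continuous_intros)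
  next
    case (Suc n)
    have "Ck_on (enat (Suc n)) S (\<lambda>x. sin (w * x))"
      by (rule Ck_SucI[where d = "\<lambda>x. w * cos (w * x)"])
        (use Suc in \<open>auto intro!: derivative_eq_intros Ck_scale\<close>)
    moreover have "Ck_on (enat (Suc n)) S (\<lambda>x. cos (w * x))"
      by (rule Ck_SucI[where d = "\<lambda>x. (- w) * sin (w * x)"])
        (use Suc Ck_scale[of _ "\<lambda>x. sin (w * x)" "- w"] in \<open>auto intro!: derivative_eq_intros\<close>)
    ultimately show ?case by blast
  qed
  then show ?thesis using Ck_iff by blast
qed

lemma abs_sin_diff_le: "\<bar>sin a - sin b\<bar> \<le> \<bar>a - b\<bar>" for a b :: real
proof -
  have "\<bar>sin a - sin b\<bar> = 2 * \<bar>sin ((a - b) / 2)\<bar> * \<bar>cos ((a + b) / 2)\<bar>"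
    by (simp add: sin_diff_sin abs_mult)
  also have "\<dots> \<le> 2 * \<bar>(a - b) / 2\<bar> * 1"
    by (intro mult_mono mult_left_mono abs_sin_x_le_abs_x abs_cos_le_one) auto
  finally show ?thesis by simp
qed

text \<open>The frequency is a multiple of \<open>2 * pi\<close> for the sake of periodicity, and it makes the sine vanish
  at the end points of the interval. The derivative is at least \<open>1 - b * w\<close>.\<close>

lemma sine_lift:
  assumes k: "1 \<le> k" and b: "0 \<le> b" "b * w < 1" and w: "w = 2 * pi * real m"
  shows "(\<lambda>x. x + b * sin (w * x)) \<in> lifts k"
proof (rule liftsI[where m = "1 - b * w"])
  have w0: "0 \<le> w" using w by simp
  show D: "(1 - b * w) * (y - x) \<le> y + b * sin (w * y) - (x + b * sin (w * x))" if "x \<le> y" for x y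
  proof -
    have "\<bar>b * (sin (w * y) - sin (w * x))\<bar> \<le> b * \<bar>w * y - w * x\<bar>"
      using b(1) abs_sin_diff_le[of "w * y" "w * x"] by (simp add: abs_mult mult_left_mono)
    also have "\<bar>w * y - w * x\<bar> = w * (y - x)"
      using that w0 by (simp add: right_diff_distrib[symmetric] abs_mult)
    finally show ?thesis by (simp add: algebra_simps)
  qed
  have sin1: "sin (w * (x + 1)) = sin (w * x)" for x
    using sin.plus_of_nat[of "w * x" m] by (simp add: w algebra_simps)
  show "(\<lambda>x. x + b * sin (w * x)) \<in> S \<rightarrow> S"
  proof
    fix x assume x: "x \<in> S"
    show "x + b * sin (w * x) \<in> S"
      using S_cases
    proof
      assume S: "S = {0..1}"
      have "0 \<le> (1 - b * w) * (x - 0)" "0 \<le> (1 - b * w) * (1 - x)"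
        using x S b(2) by (auto intro!: mult_nonneg_nonneg)
      then show ?thesis using D[of 0 x] D[of x 1] x S sin1[of 0] by auto
    qed simp
  qed
  show "Ck_on k S (\<lambda>x. x + b * sin (w * x))" by (intro Ck_add Ck_id Ck_scale Ck_sin)
  show "equivariant (\<lambda>x. x + b * sin (w * x))" by (simp add: equivariant_def sin1)
qed (use k b in auto)

end

section \<open>The group of diffeomorphisms and its smooth metrics\<close>

text \<open>The manifold \<open>M\<close> is the image of \<open>S\<close> under the coordinate \<open>p\<close>. Lifts and
  diffeomorphisms correspond to each other, so the group structure of \<open>C\<close> and all estimates can be
  obtained from lifts, whose derivatives \<open>D\<close> reads off. A circle map has many lifts; the bound on
  \<open>F 0\<close> keeps the chosen one close to the identity.\<close>

locale diffeo_model = coordinate_domain S for S +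
  fixes M :: "'a::metric_space set" and p :: "real \<Rightarrow> 'a"
    and D :: "nat \<Rightarrow> ('a \<Rightarrow> 'a) \<Rightarrow> real \<Rightarrow> real" and C :: "('a \<Rightarrow> 'a) set" and k :: enat and \<kappa> :: real
  assumes bounded_M: "bounded M" and p_image: "p ` S = M"
    and p_lipschitz: "\<lbrakk>x \<in> S; y \<in> S\<rbrakk> \<Longrightarrow> dist (p x) (p y) \<le> \<kappa> * \<bar>x - y\<bar>"
    and k_ge_1: "1 \<le> k" and C_Bij: "C \<subseteq> Bij M"
    and lift_exists: "f \<in> C \<Longrightarrow> \<exists>F\<in>lifts k. \<bar>F 0\<bar> \<le> 1 \<and> (\<forall>x\<in>S. f (p x) = p (F x))"
    and lift_descends: "F \<in> lifts k \<Longrightarrow> \<exists>f\<in>C. \<forall>x\<in>S. f (p x) = p (F x)"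
    and D_lift: "\<lbrakk>f \<in> C; F \<in> lifts k; \<forall>x\<in>S. f (p x) = p (F x); 1 \<le> j; x \<in> {0..1}\<rbrakk> \<Longrightarrow> D j f x = dS j F x"
begin

definition G :: "('a \<Rightarrow> 'a) monoid" where "G = BijGroup M \<lparr>carrier := C\<rparr>"

abbreviation \<iota> :: "'a \<Rightarrow> 'a" where "\<iota> \<equiv> \<one>\<^bsub>G\<^esub>"

abbreviation gmult (infixl "\<star>" 70) where "f \<star> g \<equiv> f \<otimes>\<^bsub>G\<^esub> g"

abbreviation ginv where "ginv f \<equiv> inv\<^bsub>G\<^esub> f"

definition T :: "('a \<Rightarrow> 'a) topology" where "T = Ck_topology M D C k"

abbreviation \<rho> :: "nat \<Rightarrow> ('a \<Rightarrow> 'a) \<Rightarrow> ('a \<Rightarrow> 'a) \<Rightarrow> real" where "\<rho> \<equiv> Ck_metric M D C"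

definition is_lift :: "(real \<Rightarrow> real) \<Rightarrow> ('a \<Rightarrow> 'a) \<Rightarrow> bool" where
  "is_lift F f \<longleftrightarrow> f \<in> C \<and> F \<in> lifts k \<and> (\<forall>x\<in>S. f (p x) = p (F x))"

lemma is_liftD: "is_lift F f \<Longrightarrow> f \<in> C" "is_lift F f \<Longrightarrow> F \<in> lifts k" "is_lift F f \<Longrightarrow> x \<in> S \<Longrightarrow> f (p x) = p (F x)"
  by (simp_all add: is_lift_def)

lemma lift_maps: "is_lift F f \<Longrightarrow> x \<in> S \<Longrightarrow> F x \<in> S"
  using is_liftD(2) liftsD(1) by blast

lemma lift_Ck: "is_lift F f \<Longrightarrow> enat n \<le> k \<Longrightarrow> Ck_on (enat n) S F"
  using is_liftD(2) liftsD(2) Ck_mono by blast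

lemma obtain_lift:
  assumes "f \<in> C" obtains F where "is_lift F f" "\<bar>F 0\<bar> \<le> 1"
  using lift_exists[OF assms] assms by (auto simp: is_lift_def)

lemma obtain_projection:
  assumes "F \<in> lifts k" obtains f where "is_lift F f"
  using lift_descends[OF assms] assms by (auto simp: is_lift_def)

lemma in_M: "z \<in> M \<Longrightarrow> \<exists>x\<in>S. z = p x"
  using p_image by auto

lemma p_in_M: "x \<in> S \<Longrightarrow> p x \<in> M"
  using p_image by auto

lemma extensional_C: "f \<in> C \<Longrightarrow> f \<in> extensional M"
  using C_Bij by (auto simp: Bij_def)

lemma is_lift_unique:
  assumes "is_lift F f" "is_lift F' g" "\<And>x. x \<in> S \<Longrightarrow> F x = F' x" shows "f = g"
proof (rule extensionalityI)
  show "f \<in> extensional M" "g \<in> extensional M" using assms is_liftD(1) extensional_C by blast+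
  fix z assume "z \<in> M"
  then obtain x where "x \<in> S" "z = p x" using in_M by blast
  then show "f z = g z" using is_liftD(3)[OF assms(1)] is_liftD(3)[OF assms(2)] assms(3) by simp
qed

lemma compose_lift:
  assumes F: "is_lift F f" and H: "is_lift H h"
  shows "is_lift (\<lambda>x. F (H x)) (compose M f h)"
proof -
  have "(\<lambda>x. F (H x)) \<in> lifts k" by (rule lifts_compose[OF is_liftD(2)[OF F] is_liftD(2)[OF H]])
  then obtain g where g: "is_lift (\<lambda>x. F (H x)) g" by (rule obtain_projection)
  have "compose M f h = g"
  proof (rule extensionalityI)
    show "compose M f h \<in> extensional M" "g \<in> extensional M"
      using extensional_C is_liftD(1)[OF g] by (auto simp: compose_def)
    fix z assume "z \<in> M"
    then obtain x where "x \<in> S" "z = p x" using in_M by blast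
    then show "compose M f h z = g z"
      using is_liftD(3)[OF F lift_maps[OF H]] is_liftD(3)[OF H] is_liftD(3)[OF g] p_in_M
      by (simp add: compose_def)
  qed
  then show ?thesis using g by simp
qed

lemma id_lift: "is_lift (\<lambda>x. x) (\<lambda>z\<in>M. z)"
proof -
  obtain g where g: "is_lift (\<lambda>x. x) g" using lifts_id obtain_projection by blast
  have "(\<lambda>z\<in>M. z) = g"
  proof (rule extensionalityI)
    show "(\<lambda>z\<in>M. z) \<in> extensional M" "g \<in> extensional M" using extensional_C is_liftD(1)[OF g] by auto
    fix z assume "z \<in> M"
    then obtain x where "x \<in> S" "z = p x" using in_M by blast
    then show "(\<lambda>z\<in>M. z) z = g z" using is_liftD(3)[OF g] p_in_M by simp
  qed
  then show ?thesis using g by simp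
qed

lemma inverse_lift:
  assumes F: "is_lift F f"
  obtains H h where "is_lift H h" "\<forall>x\<in>S. F (H x) = x \<and> H (F x) = x"
    "compose M h f = (\<lambda>z\<in>M. z)"
proof -
  obtain H where H: "H \<in> lifts k" "\<forall>x\<in>S. F (H x) = x \<and> H (F x) = x"
    by (rule lifts_inverse[OF is_liftD(2)[OF F]])
  obtain h where h: "is_lift H h" using obtain_projection[OF H(1)] by blast
  have "compose M h f = (\<lambda>z\<in>M. z)"
    using compose_lift[OF h F] id_lift by (rule is_lift_unique) (use H(2) in blast)
  then show thesis using that[OF h H(2)] by blast
qed

lemma group_BijM: "group (BijGroup M)"
  by (rule group_BijGroup)

lemma mult_BijM: "f \<in> C \<Longrightarrow> g \<in> C \<Longrightarrow> f \<otimes>\<^bsub>BijGroup M\<^esub> g = compose M f g"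
  using C_Bij by (auto simp: BijGroup_def)

lemma subgroup_C: "subgroup C (BijGroup M)"
proof
  show "C \<subseteq> carrier (BijGroup M)" using C_Bij by (simp add: BijGroup_def)
  show "f \<otimes>\<^bsub>BijGroup M\<^esub> g \<in> C" if fg: "f \<in> C" "g \<in> C" for f g
  proof -
    obtain F where "is_lift F f" using obtain_lift fg by blast
    moreover obtain H where "is_lift H g" using obtain_lift fg by blast
    ultimately have "is_lift (\<lambda>x. F (H x)) (compose M f g)" by (rule compose_lift)
    then show ?thesis using mult_BijM fg is_liftD(1) by simp
  qed
  show "\<one>\<^bsub>BijGroup M\<^esub> \<in> C" using is_liftD(1)[OF id_lift] by (simp add: BijGroup_def)
  show "inv\<^bsub>BijGroup M\<^esub> f \<in> C" if f: "f \<in> C" for f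
  proof -
    obtain F where F: "is_lift F f" using obtain_lift[OF f] by blast
    obtain H h where h: "is_lift H h" "\<forall>x\<in>S. F (H x) = x \<and> H (F x) = x"
      "compose M h f = (\<lambda>z\<in>M. z)" by (rule inverse_lift[OF F])
    have hC: "h \<in> C" using h is_liftD by blast
    have "h \<otimes>\<^bsub>BijGroup M\<^esub> f = \<one>\<^bsub>BijGroup M\<^esub>"
      using mult_BijM[OF hC f] h(3) by (simp add: BijGroup_def)
    then have "inv\<^bsub>BijGroup M\<^esub> f = h"
      using f hC C_Bij by (intro group.inv_equality[OF group_BijM]) (auto simp: BijGroup_def)
    then show ?thesis using hC by simp
  qed
qed

lemma carrier_G [simp]: "carrier G = C"
  by (simp add: G_def)

lemma one_G: "\<iota> = (\<lambda>z\<in>M. z)"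
  by (simp add: G_def BijGroup_def)

lemma mult_G: "f \<in> C \<Longrightarrow> g \<in> C \<Longrightarrow> f \<star> g = compose M f g"
  using mult_BijM by (simp add: G_def)

sublocale group G
  unfolding G_def by (rule subgroup.subgroup_is_group[OF subgroup_C group_BijM])

lemma one_in_C [simp]: "\<iota> \<in> C"
  using one_closed by simp

lemma mult_in_C [simp]: "f \<in> C \<Longrightarrow> g \<in> C \<Longrightarrow> f \<star> g \<in> C"
  using m_closed by simp

lemma inv_in_C [simp]: "f \<in> C \<Longrightarrow> ginv f \<in> C"
  using inv_closed by simp

lemma one_lift: "is_lift (\<lambda>x. x) \<iota>"
  using id_lift one_G by simp

lemma mult_lift: "is_lift F f \<Longrightarrow> is_lift H h \<Longrightarrow> is_lift (\<lambda>x. F (H x)) (f \<star> h)"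
  using compose_lift mult_G is_liftD(1) by metis

lemma inv_lift:
  assumes "is_lift F f"
  obtains H where "is_lift H (ginv f)" "\<forall>x\<in>S. F (H x) = x \<and> H (F x) = x"
proof -
  obtain H h where h: "is_lift H h" "\<forall>x\<in>S. F (H x) = x \<and> H (F x) = x"
    "compose M h f = (\<lambda>z\<in>M. z)" by (rule inverse_lift[OF assms])
  have c: "h \<in> C" "f \<in> C" using h assms is_liftD by blast+
  have "h \<star> f = \<iota>" using mult_G[OF c] h(3) one_G by simp
  then have "ginv f = h" using c by (intro inv_equality) simp_all
  then show thesis using that[of H] h(1,2) by simp
qed

lemma mult_apply: "f \<in> C \<Longrightarrow> g \<in> C \<Longrightarrow> z \<in> M \<Longrightarrow> (f \<star> g) z = f (g z)"
  using mult_G by (simp add: compose_def)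

lemma one_apply: "z \<in> M \<Longrightarrow> \<iota> z = z"
  using one_G by simp

lemma maps_M: "f \<in> C \<Longrightarrow> z \<in> M \<Longrightarrow> f z \<in> M"
  using C_Bij by (force simp: Bij_def bij_betw_def)

lemma M_nonempty: "M \<noteq> {}"
  using p_image S_cases by auto

lemma D_continuous:
  assumes f: "f \<in> C" and j: "1 \<le> j" "enat j \<le> k"
  shows "continuous_on {0..1} (D j f)"
proof -
  obtain F where F: "is_lift F f" using obtain_lift f by blast
  have "continuous_on S (dS j F)" using liftsD(2)[OF is_liftD(2)[OF F]] j by (simp add: Ck_on_def)
  moreover have "{0..1} \<subseteq> S" using S_cases by auto
  ultimately have "continuous_on {0..1} (dS j F)" by (rule continuous_on_subset)
  moreover have "D j f x = dS j F x" if "x \<in> {0..1}" for x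
    using D_lift[OF f is_liftD(2)[OF F]] F j that by (simp add: is_lift_def)
  ultimately show ?thesis using continuous_on_cong[of "{0..1}" "{0..1}" "D j f" "dS j F"] by blast
qed

lemma Metric_space_\<rho>: "enat n \<le> k \<Longrightarrow> Metric_space C (\<rho> n)"
  using M_nonempty bounded_M C_Bij D_continuous
  by (intro Metric_space_Ck_metric) (meson enat_ord_simps(1) order_trans)+

lemma \<rho>_expand:
  "f \<in> C \<Longrightarrow> g \<in> C \<Longrightarrow> \<rho> n f g = (SUP x\<in>M. dist (f x) (g x)) + (\<Sum>j=1..n. SUP x\<in>{0..1}. \<bar>D j f x - D j g x\<bar>)"
  by (simp add: Ck_metric_def)

lemma dist_bdd: "f \<in> C \<Longrightarrow> g \<in> C \<Longrightarrow> bdd_above ((\<lambda>x. dist (f x) (g x)) ` M)"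
proof -
  assume fg: "f \<in> C" "g \<in> C"
  obtain B where "\<And>x y. x \<in> M \<Longrightarrow> y \<in> M \<Longrightarrow> dist x y \<le> B" using bounded_M by (metis bounded_two_points)
  then show ?thesis using maps_M fg by (intro bdd_aboveI2[of _ _ B]) blast
qed

lemma D_bdd:
  assumes "f \<in> C" "g \<in> C" "1 \<le> j" "enat j \<le> k"
  shows "bdd_above ((\<lambda>x. \<bar>D j f x - D j g x\<bar>) ` {0..1})"
  by (intro bounded_imp_bdd_above compact_imp_bounded compact_continuous_image
        continuous_intros D_continuous assms compact_Icc)

lemma sup_D_nonneg:
  assumes "f \<in> C" "g \<in> C" "1 \<le> j" "enat j \<le> k"
  shows "0 \<le> (SUP x\<in>{0..1}. \<bar>D j f x - D j g x\<bar>)"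
proof -
  have "\<bar>D j f 0 - D j g 0\<bar> \<le> (SUP x\<in>{0..1}. \<bar>D j f x - D j g x\<bar>)"
    using D_bdd[OF assms] by (intro cSUP_upper) auto
  then show ?thesis by linarith
qed

lemma sup_dist_nonneg:
  assumes "f \<in> C" "g \<in> C" shows "0 \<le> (SUP x\<in>M. dist (f x) (g x))"
proof -
  obtain z where "z \<in> M" using M_nonempty by blast
  then have "dist (f z) (g z) \<le> (SUP x\<in>M. dist (f x) (g x))"
    using dist_bdd[OF assms] by (intro cSUP_upper)
  then show ?thesis by (metis order_trans zero_le_dist)
qed

lemma le_k: "j \<le> n \<Longrightarrow> enat n \<le> k \<Longrightarrow> enat j \<le> k"
  by (meson enat_ord_simps(1) order_trans)

lemma dist_le_\<rho>:
  assumes "f \<in> C" "g \<in> C" "enat n \<le> k" "z \<in> M" shows "dist (f z) (g z) \<le> \<rho> n f g"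
proof -
  have "dist (f z) (g z) \<le> (SUP x\<in>M. dist (f x) (g x))"
    using dist_bdd assms by (intro cSUP_upper)
  moreover have "0 \<le> (\<Sum>j=1..n. SUP x\<in>{0..1}. \<bar>D j f x - D j g x\<bar>)"
    using assms le_k by (intro sum_nonneg sup_D_nonneg) auto
  ultimately show ?thesis using \<rho>_expand assms by simp
qed

lemma \<rho>_mono:
  assumes "f \<in> C" "g \<in> C" "m \<le> n" "enat n \<le> k" shows "\<rho> m f g \<le> \<rho> n f g"
proof -
  have "(\<Sum>j=1..m. SUP x\<in>{0..1}. \<bar>D j f x - D j g x\<bar>) \<le> (\<Sum>j=1..n. SUP x\<in>{0..1}. \<bar>D j f x - D j g x\<bar>)"
    using assms le_k by (intro sum_mono2 sup_D_nonneg) auto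
  then show ?thesis using \<rho>_expand assms by simp
qed

lemma dS_diff_lift:
  assumes F: "is_lift F f" and H: "is_lift H g" and j: "1 \<le> j" "enat j \<le> k" and x: "x \<in> {0..1}"
  shows "dS j (\<lambda>y. F y - H y) x = D j f x - D j g x"
proof -
  have xS: "x \<in> S" using x S_cases by auto
  have "D j f x = dS j F x" "D j g x = dS j H x"
    using D_lift F H j x by (auto simp: is_lift_def)
  then show ?thesis using dS_diff[OF lift_Ck[OF F j(2)] lift_Ck[OF H j(2)] xS] by simp
qed

lemma jet_norm_le_\<rho>:
  assumes F: "is_lift F f" and H: "is_lift H g" and n: "enat n \<le> k" and x: "x \<in> S"
  shows "jet_norm n (\<lambda>y. F y - H y) x \<le> \<rho> n f g"
proof -
  have fg: "f \<in> C" "g \<in> C" using F H is_liftD by blast+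
  obtain y where y: "y \<in> {0..1}" "y \<in> S"
    "\<forall>F. equivariant F \<longrightarrow> F x - x = F y - y \<and> (\<forall>j\<ge>1. dS j F x = dS j F y)"
    by (rule reduce_to_unit_interval[OF x])
  have eq: "dS j (\<lambda>y. F y - H y) x = D j f y - D j g y" if j: "1 \<le> j" "j \<le> n" for j
  proof -
    have jk: "enat j \<le> k" using j n le_k by blast
    have "dS j (\<lambda>y. F y - H y) x = dS j F x - dS j H x"
      using dS_diff[OF lift_Ck[OF F jk] lift_Ck[OF H jk] x] .
    also have "\<dots> = dS j F y - dS j H y"
      using y(3) liftsD(3)[OF is_liftD(2)[OF F]] liftsD(3)[OF is_liftD(2)[OF H]] j(1) by simp
    also have "\<dots> = dS j (\<lambda>y. F y - H y) y"
      using dS_diff[OF lift_Ck[OF F jk] lift_Ck[OF H jk] y(2)] by simp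
    finally show ?thesis using dS_diff_lift[OF F H j(1) jk y(1)] by simp
  qed
  have "jet_norm n (\<lambda>y. F y - H y) x = (\<Sum>j=1..n. \<bar>D j f y - D j g y\<bar>)"
    unfolding jet_norm_def using eq by (intro sum.cong) auto
  also have "\<dots> \<le> (\<Sum>j=1..n. SUP x\<in>{0..1}. \<bar>D j f x - D j g x\<bar>)"
    using D_bdd[OF fg] le_k[OF _ n] y(1) by (intro sum_mono cSUP_upper) auto
  also have "\<dots> \<le> \<rho> n f g" using \<rho>_expand[OF fg] sup_dist_nonneg[OF fg] by simp
  finally show ?thesis .
qed

text \<open>Together with the bounds of displacement and jets by \<open>\<rho>\<close>, this exchanges the \<open>C\<^sup>n\<close>-metric
  for pointwise estimates on lifts.\<close>

lemma \<rho>_le: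
  assumes F: "is_lift F f" and H: "is_lift H g" and n: "enat n \<le> k"
    and a: "\<And>z. z \<in> M \<Longrightarrow> dist (f z) (g z) \<le> a" and b: "\<And>x. x \<in> S \<Longrightarrow> jet_norm n (\<lambda>y. F y - H y) x \<le> b"
  shows "\<rho> n f g \<le> a + real n * b"
proof -
  have fg: "f \<in> C" "g \<in> C" using F H is_liftD by blast+
  have "(SUP x\<in>M. dist (f x) (g x)) \<le> a" using a M_nonempty by (intro cSUP_least) auto
  moreover have "(SUP x\<in>{0..1}. \<bar>D j f x - D j g x\<bar>) \<le> b" if j: "j \<in> {1..n}" for j
  proof (rule cSUP_least)
    fix x :: real assume x: "x \<in> {0..1}"
    then have xS: "x \<in> S" using S_cases by auto
    have "\<bar>D j f x - D j g x\<bar> = \<bar>dS j (\<lambda>y. F y - H y) x\<bar>"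
      using dS_diff_lift[OF F H _ _ x, of j] j le_k[OF _ n] by simp
    also have "\<dots> \<le> jet_norm n (\<lambda>y. F y - H y) x" using j by (intro abs_dS_le_jet_norm) auto
    also have "\<dots> \<le> b" using b xS by simp
    finally show "\<bar>D j f x - D j g x\<bar> \<le> b" .
  qed simp
  then have "(\<Sum>j=1..n. SUP x\<in>{0..1}. \<bar>D j f x - D j g x\<bar>) \<le> (\<Sum>j=1..n. b)" by (rule sum_mono)
  ultimately show ?thesis using \<rho>_expand[OF fg] by simp
qed

end

section \<open>The smooth topology and right translations\<close>

context diffeo_model begin

text \<open>One description of the neighbourhoods for all \<open>k\<close>: for finite \<open>k\<close> the order \<open>n\<close> may be raised to
  \<open>k\<close>, and for \<open>k = \<infinity>\<close> the metrics of all finite orders contribute.\<close>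

definition Ck_neighbourhood :: "('a \<Rightarrow> 'a) set \<Rightarrow> ('a \<Rightarrow> 'a) \<Rightarrow> bool" where
  "Ck_neighbourhood U g \<longleftrightarrow> (\<exists>n r. 1 \<le> n \<and> enat n \<le> k \<and> 0 < r \<and> (\<forall>f\<in>C. \<rho> n f g < r \<longrightarrow> f \<in> U))"

lemma openin_\<rho>_iff:
  assumes n: "enat n \<le> k"
  shows "openin (Metric_space.mtopology C (\<rho> n)) U \<longleftrightarrow>
    U \<subseteq> C \<and> (\<forall>g\<in>U. \<exists>r>0. \<forall>f\<in>C. \<rho> n f g < r \<longrightarrow> f \<in> U)"
proof -
  interpret Metric_space C "\<rho> n" using n by (rule Metric_space_\<rho>)
  have "mball g r \<subseteq> U \<longleftrightarrow> (\<forall>f\<in>C. \<rho> n f g < r \<longrightarrow> f \<in> U)" if "g \<in> C" for g r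
    using that commute by (auto simp: subset_iff)
  then show ?thesis unfolding openin_mtopology by (metis subsetD)
qed

lemma Ck_neighbourhood_Int: "Ck_neighbourhood U g \<Longrightarrow> Ck_neighbourhood V g \<Longrightarrow> g \<in> C \<Longrightarrow> Ck_neighbourhood (U \<inter> V) g"
proof -
  assume "Ck_neighbourhood U g" "Ck_neighbourhood V g" and g: "g \<in> C"
  then obtain m r n s where m: "1 \<le> m" "enat m \<le> k" "0 < r" "\<forall>f\<in>C. \<rho> m f g < r \<longrightarrow> f \<in> U"
    and n: "1 \<le> n" "enat n \<le> k" "0 < s" "\<forall>f\<in>C. \<rho> n f g < s \<longrightarrow> f \<in> V"
    unfolding Ck_neighbourhood_def by (elim exE conjE)
  have k: "enat (max m n) \<le> k" using m n by (simp add: max_def)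
  have "f \<in> U \<inter> V" if f: "f \<in> C" "\<rho> (max m n) f g < min r s" for f
    using \<rho>_mono[OF f(1) g _ k, of m] \<rho>_mono[OF f(1) g _ k, of n] f m(4) n(4) by simp
  then show "Ck_neighbourhood (U \<inter> V) g"
    unfolding Ck_neighbourhood_def using m n k by (intro exI[of _ "max m n"] exI[of _ "min r s"]) auto
qed

lemma Ck_neighbourhood_mono: "Ck_neighbourhood U g \<Longrightarrow> U \<subseteq> V \<Longrightarrow> Ck_neighbourhood V g"
  unfolding Ck_neighbourhood_def by (elim exE, intro exI) auto

text \<open>The metrics increase with the order. For infinite \<open>k\<close> two generating neighbourhoods
  therefore intersect in one of the larger order.\<close>

lemma openin_T_iff: "openin T U \<longleftrightarrow> U \<subseteq> C \<and> (\<forall>g\<in>U. Ck_neighbourhood U g)"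
proof (cases k)
  case (enat n)
  have "1 \<le> n" using k_ge_1 enat by (simp add: one_enat_def)
  have nk: "enat n \<le> k" using enat by simp
  have "Ck_neighbourhood U g \<longleftrightarrow> (\<exists>r>0. \<forall>f\<in>C. \<rho> n f g < r \<longrightarrow> f \<in> U)" if g: "g \<in> C" for g
  proof
    assume "Ck_neighbourhood U g"
    then obtain m r where m: "enat m \<le> k" "0 < r" "\<forall>f\<in>C. \<rho> m f g < r \<longrightarrow> f \<in> U"
      unfolding Ck_neighbourhood_def by (elim exE conjE)
    have "f \<in> U" if f: "f \<in> C" "\<rho> n f g < r" for f
    proof -
      have "\<rho> m f g \<le> \<rho> n f g" using m(1) enat by (intro \<rho>_mono f g nk) simp
      then show ?thesis using m(3) f by simp
    qed
    then show "\<exists>r>0. \<forall>f\<in>C. \<rho> n f g < r \<longrightarrow> f \<in> U" using m(2) by (intro exI[of _ r]) simp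
  next
    assume "\<exists>r>0. \<forall>f\<in>C. \<rho> n f g < r \<longrightarrow> f \<in> U"
    then obtain r where "0 < r" "\<forall>f\<in>C. \<rho> n f g < r \<longrightarrow> f \<in> U" by (elim exE conjE)
    then show "Ck_neighbourhood U g" unfolding Ck_neighbourhood_def using \<open>1 \<le> n\<close> nk by (intro exI[of _ n] exI[of _ r]) simp
  qed
  moreover have "T = Metric_space.mtopology C (\<rho> n)" unfolding T_def Ck_topology_def by (simp add: enat)
  ultimately show ?thesis using openin_\<rho>_iff[OF nk, of U] by (auto simp: subset_iff)
next
  case infinity
  define B where "B = {U. \<exists>n\<ge>1. openin (Metric_space.mtopology C (\<rho> n)) U}"
  have kn: "enat n \<le> k" for n using infinity by simp
  have T: "T = topology_generated_by B" unfolding T_def Ck_topology_def B_def by (simp add: infinity)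
  show ?thesis
  proof
    assume "openin T U"
    then have "generate_topology_on B U" unfolding T by (simp add: openin_topology_generated_by_iff)
    then show "U \<subseteq> C \<and> (\<forall>g\<in>U. Ck_neighbourhood U g)"
    proof induction
      case Empty then show ?case by simp
    next
      case (Int a b)
      then show ?case using Ck_neighbourhood_Int by blast
    next
      case (UN K)
      have "\<Union>K \<subseteq> C" using UN by blast
      moreover have "Ck_neighbourhood (\<Union>K) g" if gK: "g \<in> \<Union>K" for g
      proof -
        obtain a where a: "a \<in> K" "g \<in> a" using gK by blast
        then have "Ck_neighbourhood a g" using UN by blast
        then show ?thesis by (rule Ck_neighbourhood_mono) (use a(1) in blast)
      qed
      ultimately show ?case by blast
    next
      case (Basis s)
      then obtain n where n: "1 \<le> n" "openin (Metric_space.mtopology C (\<rho> n)) s" by (auto simp: B_def)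
      then have s: "s \<subseteq> C" "\<forall>g\<in>s. \<exists>r>0. \<forall>f\<in>C. \<rho> n f g < r \<longrightarrow> f \<in> s"
        using openin_\<rho>_iff[OF kn] by blast+
      have "Ck_neighbourhood s g" if g: "g \<in> s" for g
      proof -
        obtain r where "0 < r" "\<forall>f\<in>C. \<rho> n f g < r \<longrightarrow> f \<in> s" using bspec[OF s(2) g] by (elim exE conjE)
        then show ?thesis unfolding Ck_neighbourhood_def using n(1) kn by (intro exI[of _ n] exI[of _ r]) simp
      qed
      then show ?case using s(1) by blast
    qed
  next
    assume U: "U \<subseteq> C \<and> (\<forall>g\<in>U. Ck_neighbourhood U g)"
    show "openin T U"
    proof (subst openin_subopen, intro ballI)
      fix g assume g: "g \<in> U"
      then have "Ck_neighbourhood U g" using U by blast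
      then obtain n r where n: "1 \<le> n" "0 < r" "\<forall>f\<in>C. \<rho> n f g < r \<longrightarrow> f \<in> U"
        unfolding Ck_neighbourhood_def by (elim exE conjE)
      interpret Metric_space C "\<rho> n" using kn by (rule Metric_space_\<rho>)
      have "mball g r \<in> B" unfolding B_def using n(1) openin_mball by blast
      then have "openin T (mball g r)" unfolding T by (rule topology_generated_by_Basis)
      moreover have "g \<in> mball g r" using g U n(2) by auto
      moreover have "mball g r \<subseteq> U" using n(3) commute by (auto simp: subset_iff)
      ultimately show "\<exists>V. openin T V \<and> g \<in> V \<and> V \<subseteq> U" by blast
    qed
  qed
qed

lemma topspace_T_eq: "topspace T = C"
proof
  show "topspace T \<subseteq> C" using openin_T_iff[of "topspace T"] by simp
  have "Ck_neighbourhood C g" for g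
    unfolding Ck_neighbourhood_def using k_ge_1 by (intro exI[of _ 1]) (auto simp: one_enat_def intro: exI[of _ 1])
  then have "openin T C" using openin_T_iff by simp
  then show "C \<subseteq> topspace T" by (rule openin_subset)
qed

text \<open>Right translation by \<open>h\<close> acts on lifts by composition with \<open>H\<close>, which is linear in the left
  factor: \<open>F \<circ> H - E \<circ> H = (F - E) \<circ> H\<close>. The distortion of \<open>H\<close> bounds the jets of the right-hand side.\<close>

lemma \<rho>_translate_le:
  assumes f: "f \<in> C" and g: "g \<in> C" and H: "is_lift H h" and n: "enat n \<le> k"
    and c: "distortion_le n c H" "0 \<le> c"
  shows "\<rho> n (f \<star> h) (g \<star> h) \<le> (1 + real n * (1 + c)) * \<rho> n f g"
proof -
  obtain F where F: "is_lift F f" using obtain_lift[OF f] by blast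
  obtain E where E: "is_lift E g" using obtain_lift[OF g] by blast
  have h: "h \<in> C" using H is_liftD(1) by blast
  have "\<rho> n (f \<star> h) (g \<star> h) \<le> \<rho> n f g + real n * ((1 + c) * \<rho> n f g)"
  proof (rule \<rho>_le[OF mult_lift[OF F H] mult_lift[OF E H] n])
    fix z assume z: "z \<in> M"
    then show "dist ((f \<star> h) z) ((g \<star> h) z) \<le> \<rho> n f g"
      using dist_le_\<rho>[OF f g n maps_M[OF h z]] mult_apply f g h by simp
  next
    fix x assume x: "x \<in> S"
    have "Ck_on (enat n) S (\<lambda>y. F y - E y)" by (intro Ck_diff lift_Ck[OF F n] lift_Ck[OF E n])
    then have "jet_norm n (\<lambda>y. F (H y) - E (H y)) x \<le> (1 + c) * jet_norm n (\<lambda>y. F y - E y) (H x)"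
      using jet_norm_compose_le[OF c(1) _ x, of "\<lambda>y. F y - E y"] by simp
    also have "\<dots> \<le> (1 + c) * \<rho> n f g"
      using c(2) jet_norm_le_\<rho>[OF F E n lift_maps[OF H x]] by (intro mult_left_mono) auto
    finally show "jet_norm n (\<lambda>y. F (H y) - E (H y)) x \<le> (1 + c) * \<rho> n f g" .
  qed
  then show ?thesis by (simp add: algebra_simps)
qed

lemma distortion_le_\<rho>_one:
  assumes n: "enat n \<le> k" and B: "0 \<le> B"
  obtains K where "0 \<le> K" "\<forall>F f. is_lift F f \<and> \<rho> n f \<iota> \<le> B \<longrightarrow> distortion_le n (K * \<rho> n f \<iota>) F"
proof -
  obtain K where K0: "0 \<le> K" and
    K: "\<forall>e F. 0 \<le> e \<and> e \<le> B \<and> F \<in> S \<rightarrow> S \<and> Ck_on (enat n) S F \<and>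
      (\<forall>x\<in>S. \<forall>j\<in>{1..n}. \<bar>dS j (\<lambda>y. F y - y) x\<bar> \<le> e) \<longrightarrow> distortion_le n (K * e) F"
    by (rule distortion_le_bound[OF B])
  have "distortion_le n (K * \<rho> n f \<iota>) F" if F: "is_lift F f" and b: "\<rho> n f \<iota> \<le> B" for F f
  proof (rule K[rule_format], intro conjI ballI b)
    show "0 \<le> \<rho> n f \<iota>" using Metric_space.nonneg[OF Metric_space_\<rho>[OF n]] .
    show "F \<in> S \<rightarrow> S" using is_liftD(2)[OF F] liftsD(1) by blast
    show "Ck_on (enat n) S F" using lift_Ck[OF F n] .
    show "\<bar>dS j (\<lambda>y. F y - y) x\<bar> \<le> \<rho> n f \<iota>" if "x \<in> S" "j \<in> {1..n}" for x j
    proof -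
      have "\<bar>dS j (\<lambda>y. F y - y) x\<bar> \<le> jet_norm n (\<lambda>y. F y - y) x" using that(2) by (intro abs_dS_le_jet_norm) simp_all
      also have "\<dots> \<le> \<rho> n f \<iota>" by (rule jet_norm_le_\<rho>[OF F one_lift n that(1)])
      finally show ?thesis .
    qed
  qed
  then show thesis using that[of K] K0 by blast
qed

lemma distortion_finite:
  assumes F: "is_lift F f" and n: "enat n \<le> k" obtains c where "0 \<le> c" "distortion_le n c F"
proof -
  have 0: "0 \<le> \<rho> n f \<iota>" using Metric_space.nonneg[OF Metric_space_\<rho>[OF n]] .
  obtain K where "0 \<le> K" "\<forall>F g. is_lift F g \<and> \<rho> n g \<iota> \<le> \<rho> n f \<iota> \<longrightarrow> distortion_le n (K * \<rho> n g \<iota>) F"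
    by (rule distortion_le_\<rho>_one[OF n 0])
  then show thesis using F 0 by (intro that[of "K * \<rho> n f \<iota>"]) auto
qed

sublocale topologized_group G T
proof
  show "topspace T = carrier G" by (simp add: topspace_T_eq)
  fix U h assume U: "openin T U" and "h \<in> carrier G"
  then have h: "h \<in> C" by simp
  obtain H where H: "is_lift H h" using obtain_lift[OF h] by blast
  have "Ck_neighbourhood {f \<in> C. f \<star> h \<in> U} g" if g: "g \<in> C" "g \<star> h \<in> U" for g
  proof -
    have "Ck_neighbourhood U (g \<star> h)" using U g(2) openin_T_iff by blast
    then obtain n r where n: "1 \<le> n" "enat n \<le> k" "0 < r" "\<forall>f\<in>C. \<rho> n f (g \<star> h) < r \<longrightarrow> f \<in> U"
      unfolding Ck_neighbourhood_def by (elim exE conjE)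
    obtain c where c: "0 \<le> c" "distortion_le n c H" using distortion_finite[OF H n(2)] by blast
    define K where "K = 1 + real n * (1 + c)"
    have K: "0 < K" using c by (simp add: K_def add_pos_nonneg)
    have "f \<star> h \<in> U" if f: "f \<in> C" "\<rho> n f g < r / K" for f
    proof -
      have "\<rho> n (f \<star> h) (g \<star> h) \<le> K * \<rho> n f g"
        unfolding K_def by (rule \<rho>_translate_le[OF f(1) g(1) H n(2) c(2,1)])
      also have "\<dots> < r" using f(2) K by (simp add: field_simps)
      finally show ?thesis using n(4) f(1) h by simp
    qed
    then show ?thesis unfolding Ck_neighbourhood_def using n K by (intro exI[of _ n] exI[of _ "r / K"]) simp
  qed
  then show "openin T {f \<in> carrier G. f \<star> h \<in> U}" by (auto simp: openin_T_iff)
qed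

text \<open>The displacement of points is included because derivatives alone do not see rotations. Moving
  points by at most \<open>c\<close> obeys the same laws under products and inverses as distortion \<open>c\<close>, so one constant
  serves for both.\<close>

definition displaces_le :: "nat \<Rightarrow> real \<Rightarrow> ('a \<Rightarrow> 'a) \<Rightarrow> bool" where
  "displaces_le n c f \<longleftrightarrow> 0 \<le> c \<and> (\<forall>z\<in>M. dist (f z) z \<le> c) \<and> (\<exists>F. is_lift F f \<and> distortion_le n c F)"

lemma displaces_leI:
  "0 \<le> c \<Longrightarrow> (\<And>z. z \<in> M \<Longrightarrow> dist (f z) z \<le> c) \<Longrightarrow> is_lift F f \<Longrightarrow> distortion_le n c F \<Longrightarrow> displaces_le n c f"
  unfolding displaces_le_def by blast

lemma displaces_leE:
  assumes "displaces_le n c f"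
  obtains F where "0 \<le> c" "\<forall>z\<in>M. dist (f z) z \<le> c" "is_lift F f" "distortion_le n c F"
  using assms unfolding displaces_le_def by blast

lemma displaces_le_mono:
  assumes "displaces_le n c f" "c \<le> d" shows "displaces_le n d f"
proof -
  obtain F where F: "0 \<le> c" "\<forall>z\<in>M. dist (f z) z \<le> c" "is_lift F f" "distortion_le n c F"
    using assms(1) by (rule displaces_leE)
  show ?thesis
  proof (rule displaces_leI[OF _ _ F(3)])
    show "distortion_le n d F" using F(4) assms(2) by (rule distortion_le_mono)
    show "dist (f z) z \<le> d" if "z \<in> M" for z using bspec[OF F(2) that] assms(2) by linarith
  qed (use F assms in linarith)
qed

lemma displaces_le_one: "displaces_le n 0 \<iota>"
  using one_apply by (intro displaces_leI[OF _ _ one_lift distortion_le_id]) auto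

lemma displaces_le_mult:
  assumes f: "displaces_le n c f" and g: "displaces_le n d g" and n: "enat n \<le> k"
  shows "displaces_le n ((1 + c) * (1 + d) - 1) (f \<star> g)"
proof -
  obtain F where F: "0 \<le> c" "\<forall>z\<in>M. dist (f z) z \<le> c" "is_lift F f" "distortion_le n c F"
    using f by (rule displaces_leE)
  obtain E where E: "0 \<le> d" "\<forall>z\<in>M. dist (g z) z \<le> d" "is_lift E g" "distortion_le n d E"
    using g by (rule displaces_leE)
  have fg: "f \<in> C" "g \<in> C" using F E is_liftD(1) by blast+
  have cd: "0 \<le> c * d" using F E by simp
  show ?thesis
  proof (rule displaces_leI[OF _ _ mult_lift[OF F(3) E(3)]])
    show "0 \<le> (1 + c) * (1 + d) - 1" using F E cd by (simp add: algebra_simps)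
    have F': "F \<in> S \<rightarrow> S" and E': "E \<in> S \<rightarrow> S" using F(3) E(3) is_liftD(2) liftsD(1) by blast+
    show "distortion_le n ((1 + c) * (1 + d) - 1) (\<lambda>x. F (E x))"
      by (rule distortion_le_compose[OF F(4) lift_Ck[OF F(3) n] F' F(1) E(4) E' E(1)])
    fix z assume z: "z \<in> M"
    have "dist (f (g z)) z \<le> dist (f (g z)) (g z) + dist (g z) z" by (rule dist_triangle)
    also have "\<dots> \<le> c + d" using F(2) E(2) z maps_M[OF fg(2) z] by (intro add_mono) blast+
    finally show "dist ((f \<star> g) z) z \<le> (1 + c) * (1 + d) - 1"
      using mult_apply[OF fg z] cd by (simp add: algebra_simps)
  qed
qed

lemma displaces_le_inv:
  assumes f: "displaces_le n c f" and c: "c < 1" and n: "enat n \<le> k"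
  shows "displaces_le n (c / (1 - c)) (ginv f)"
proof -
  obtain F where F: "0 \<le> c" "\<forall>z\<in>M. dist (f z) z \<le> c" "is_lift F f" "distortion_le n c F"
    using f by (rule displaces_leE)
  obtain H where H: "is_lift H (ginv f)" "\<forall>x\<in>S. F (H x) = x \<and> H (F x) = x"
    by (rule inv_lift[OF F(3)])
  have fC: "f \<in> C" "ginv f \<in> C" using F(3) H is_liftD(1) by blast+
  have le: "c \<le> c / (1 - c)" using F(1) c by (simp add: field_simps)
  show ?thesis
  proof (rule displaces_leI[OF _ _ H(1)])
    show "0 \<le> c / (1 - c)" using F c by simp
    have F': "F \<in> S \<rightarrow> S" and H': "H \<in> S \<rightarrow> S" using F(3) H(1) is_liftD(2) liftsD(1) by blast+
    show "distortion_le n (c / (1 - c)) H"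
      using H(2) by (intro distortion_le_inverse[OF F(4) F' F(1) c lift_Ck[OF H(1) n] H']) auto
    fix z assume z: "z \<in> M"
    define w where "w = (ginv f) z"
    have w: "w \<in> M" "f w = z"
      using maps_M[OF fC(2) z] mult_apply[OF fC z] r_inv[of f] fC one_apply[OF z] by (auto simp: w_def)
    then have "dist w z \<le> c" using F(2) by (metis dist_commute)
    then show "dist ((ginv f) z) z \<le> c / (1 - c)" using le by (simp add: w_def)
  qed
qed

lemma displaces_le_imp_\<rho>:
  assumes "displaces_le n c f" "enat n \<le> k" shows "\<rho> n f \<iota> \<le> (1 + real n) * c"
proof -
  obtain F where F: "0 \<le> c" "\<forall>z\<in>M. dist (f z) z \<le> c" "is_lift F f" "distortion_le n c F"
    using assms(1) by (rule displaces_leE)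
  have F': "F \<in> S \<rightarrow> S" using F(3) is_liftD(2) liftsD(1) by blast
  have "\<rho> n f \<iota> \<le> c + real n * c"
  proof (rule \<rho>_le[OF F(3) one_lift assms(2)])
    show "dist (f z) (\<iota> z) \<le> c" if "z \<in> M" for z using F(2) one_apply that by simp
    show "jet_norm n (\<lambda>y. F y - y) x \<le> c" if "x \<in> S" for x
      using jet_norm_diff_id_le[OF F(4) lift_Ck[OF F(3) assms(2)] F' F(1) that] .
  qed
  then show ?thesis by (simp add: algebra_simps)
qed

lemma displaces_le_if_\<rho>:
  assumes n: "enat n \<le> k" and B: "0 \<le> B"
  obtains K where "1 \<le> K" "\<forall>f\<in>C. \<rho> n f \<iota> \<le> B \<longrightarrow> displaces_le n (K * \<rho> n f \<iota>) f"
proof -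
  obtain K where K: "0 \<le> K" "\<forall>F f. is_lift F f \<and> \<rho> n f \<iota> \<le> B \<longrightarrow> distortion_le n (K * \<rho> n f \<iota>) F"
    by (rule distortion_le_\<rho>_one[OF n B])
  have "displaces_le n ((1 + K) * \<rho> n f \<iota>) f" if f: "f \<in> C" "\<rho> n f \<iota> \<le> B" for f
  proof -
    obtain F where F: "is_lift F f" using obtain_lift[OF f(1)] by blast
    have 0: "0 \<le> \<rho> n f \<iota>" using Metric_space.nonneg[OF Metric_space_\<rho>[OF n]] .
    have le: "\<rho> n f \<iota> \<le> (1 + K) * \<rho> n f \<iota>" "K * \<rho> n f \<iota> \<le> (1 + K) * \<rho> n f \<iota>"
      using K(1) 0 by (simp_all add: distrib_right)
    show ?thesis
    proof (rule displaces_leI[OF _ _ F])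
      show "0 \<le> (1 + K) * \<rho> n f \<iota>" using K(1) 0 by simp
      show "dist (f z) z \<le> (1 + K) * \<rho> n f \<iota>" if "z \<in> M" for z
        using dist_le_\<rho>[OF f(1) one_in_C n that] one_apply[OF that] le(1) by simp
      have "distortion_le n (K * \<rho> n f \<iota>) F" using K(2) F f(2) by blast
      then show "distortion_le n ((1 + K) * \<rho> n f \<iota>) F" using le(2) by (rule distortion_le_mono)
    qed
  qed
  then show thesis using K(1) by (intro that[of "1 + K"]) simp_all
qed

end

section \<open>Compatible length functions on the diffeomorphism group\<close>

context diffeo_model begin

text \<open>The logarithmic scale \<open>c = exp s - 1\<close> turns the submultiplicativity of \<open>1 + c\<close> into
  additivity of \<open>s\<close>, and including the inverse enforces symmetry.\<close>

definition displacement_levels :: "nat \<Rightarrow> ('a \<Rightarrow> 'a) \<Rightarrow> real set" where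
  "displacement_levels n f = {s. 0 \<le> s \<and> displaces_le n (exp s - 1) f \<and> displaces_le n (exp s - 1) (ginv f)}"

definition jet_length :: "nat \<Rightarrow> ('a \<Rightarrow> 'a) \<Rightarrow> real" where
  "jet_length n f = Inf (displacement_levels n f)"

lemma displacement_levels_upward: "s \<in> displacement_levels n f \<Longrightarrow> s \<le> t \<Longrightarrow> t \<in> displacement_levels n f"
proof -
  assume s: "s \<in> displacement_levels n f" and st: "s \<le> t"
  have "exp s - 1 \<le> exp t - 1" using st by simp
  then show ?thesis using s st unfolding displacement_levels_def by (auto intro: displaces_le_mono)
qed

lemma bdd_below_displacement_levels: "bdd_below (displacement_levels n f)"
  by (rule bdd_belowI[of _ 0]) (simp add: displacement_levels_def)

lemma displacement_levelsI:
  assumes "displaces_le n c f" "displaces_le n d (ginv f)" "c \<le> b" "d \<le> b"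
  shows "ln (1 + b) \<in> displacement_levels n f"
proof -
  have b: "0 \<le> b" using assms(1,3) by (auto simp: displaces_le_def)
  then have "exp (ln (1 + b)) - 1 = b" by simp
  moreover have "0 \<le> ln (1 + b)" using b by simp
  ultimately show ?thesis
    using displaces_le_mono[OF assms(1,3)] displaces_le_mono[OF assms(2,4)] by (simp add: displacement_levels_def)
qed

lemma displaces_le_exists:
  assumes f: "f \<in> C" and n: "enat n \<le> k" obtains c where "displaces_le n c f"
proof -
  have 0: "0 \<le> \<rho> n f \<iota>" using Metric_space.nonneg[OF Metric_space_\<rho>[OF n]] .
  obtain K where "1 \<le> K" "\<forall>g\<in>C. \<rho> n g \<iota> \<le> \<rho> n f \<iota> \<longrightarrow> displaces_le n (K * \<rho> n g \<iota>) g"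
    by (rule displaces_le_if_\<rho>[OF n 0])
  then show thesis using f by (intro that[of "K * \<rho> n f \<iota>"]) simp
qed

lemma displacement_levels_nonempty:
  assumes f: "f \<in> C" and n: "enat n \<le> k" shows "displacement_levels n f \<noteq> {}"
proof -
  obtain c where c: "displaces_le n c f" by (rule displaces_le_exists[OF f n])
  obtain d where d: "displaces_le n d (ginv f)" by (rule displaces_le_exists[OF inv_in_C[OF f] n])
  have "ln (1 + max c d) \<in> displacement_levels n f" using c d by (rule displacement_levelsI) simp_all
  then show ?thesis by blast
qed

lemma jet_length_less_imp:
  assumes f: "f \<in> C" and n: "enat n \<le> k" and l: "jet_length n f < s" shows "s \<in> displacement_levels n f"
proof -
  obtain t where "t \<in> displacement_levels n f" "t < s"
    using cInf_lessD[OF displacement_levels_nonempty[OF f n]] l unfolding jet_length_def by blast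
  then show ?thesis using displacement_levels_upward by simp
qed

lemma jet_length_le: "s \<in> displacement_levels n f \<Longrightarrow> jet_length n f \<le> s"
  unfolding jet_length_def using bdd_below_displacement_levels by (rule cInf_lower[rotated])

lemma jet_length_nonneg:
  assumes f: "f \<in> C" and n: "enat n \<le> k" shows "0 \<le> jet_length n f"
  unfolding jet_length_def using displacement_levels_nonempty[OF f n]
  by (rule cInf_greatest) (simp add: displacement_levels_def)

lemma jet_length_one: "jet_length n \<iota> \<le> 0"
  using displaces_le_one by (intro jet_length_le) (simp add: displacement_levels_def)

lemma jet_length_inv: "f \<in> C \<Longrightarrow> jet_length n (ginv f) = jet_length n f"
proof -
  assume "f \<in> C"
  then have "ginv (ginv f) = f" by simp
  then have "displacement_levels n (ginv f) = displacement_levels n f" by (auto simp: displacement_levels_def)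
  then show ?thesis by (simp add: jet_length_def)
qed

lemma displacement_levels_mult:
  assumes f: "f \<in> C" "s \<in> displacement_levels n f" and g: "g \<in> C" "t \<in> displacement_levels n g" and n: "enat n \<le> k"
  shows "s + t \<in> displacement_levels n (f \<star> g)"
proof -
  have e: "(1 + (exp s - 1)) * (1 + (exp t - 1)) - 1 = exp (s + t) - 1"
    "(1 + (exp t - 1)) * (1 + (exp s - 1)) - 1 = exp (s + t) - 1"
    by (simp_all add: exp_add)
  have "displaces_le n (exp (s + t) - 1) (f \<star> g)"
    using displaces_le_mult[OF _ _ n, of "exp s - 1" f "exp t - 1" g] f g unfolding e displacement_levels_def by simp
  moreover have "displaces_le n (exp (s + t) - 1) (ginv g \<star> ginv f)"
    using displaces_le_mult[OF _ _ n, of "exp t - 1" "ginv g" "exp s - 1" "ginv f"] f g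
    unfolding e displacement_levels_def by simp
  moreover have "ginv (f \<star> g) = ginv g \<star> ginv f" using f g by (intro inv_mult_group) simp_all
  ultimately show ?thesis using f g by (simp add: displacement_levels_def)
qed

lemma jet_length_mult:
  assumes f: "f \<in> C" and g: "g \<in> C" and n: "enat n \<le> k"
  shows "jet_length n (f \<star> g) \<le> jet_length n f + jet_length n g"
proof (rule field_le_epsilon)
  fix e :: real assume e: "0 < e"
  have "jet_length n f + e / 2 \<in> displacement_levels n f" "jet_length n g + e / 2 \<in> displacement_levels n g"
    using e by (intro jet_length_less_imp f g n; simp)+
  from displacement_levels_mult[OF f this(1) g this(2) n]
  have "(jet_length n f + e / 2) + (jet_length n g + e / 2) \<in> displacement_levels n (f \<star> g)" .
  then show "jet_length n (f \<star> g) \<le> jet_length n f + jet_length n g + e"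
    using jet_length_le by fastforce
qed

lemma jet_length_less_imp_\<rho>:
  assumes f: "f \<in> C" and n: "enat n \<le> k" and l: "jet_length n f < s"
  shows "\<rho> n f \<iota> \<le> (1 + real n) * (exp s - 1)"
  using jet_length_less_imp[OF f n l] displaces_le_imp_\<rho>[OF _ n] by (simp add: displacement_levels_def)

text \<open>This and the next lemma say that the length of order \<open>n\<close> and the \<open>C\<^sup>n\<close>-distance to the identity have
  the same small balls.\<close>

lemma \<rho>_small_if_jet_length_small:
  assumes n: "enat n \<le> k" and e: "0 < e"
  obtains d where "0 < d" "\<forall>f\<in>C. jet_length n f < d \<longrightarrow> \<rho> n f \<iota> < e"
proof -
  define b where "b = e / (2 * (1 + real n))"
  have b: "0 < b" using e by (simp add: b_def)
  have "(1 + real n) * b = e / 2" by (simp add: b_def field_simps)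
  then have lt: "(1 + real n) * b < e" using e by simp
  have "\<rho> n f \<iota> < e" if f: "f \<in> C" "jet_length n f < ln (1 + b)" for f
  proof -
    have "exp (ln (1 + b)) - 1 = b" using b by simp
    then have "\<rho> n f \<iota> \<le> (1 + real n) * b" using jet_length_less_imp_\<rho>[OF f(1) n f(2)] by simp
    then show ?thesis using lt by linarith
  qed
  then show thesis using b by (intro that[of "ln (1 + b)"]) simp_all
qed

text \<open>The only delicate point is the inverse of \<open>f\<close>, which is small because the distortion of \<open>f\<close> is
  below \<open>1\<close>. Here \<open>b\<close> is the target for the inverse and \<open>c\<close> the solution of \<open>c / (1 - c) = b\<close>.\<close>

lemma jet_length_small_if_\<rho>_small:
  assumes n: "enat n \<le> k" and e: "0 < e"
  obtains d where "0 < d" "\<forall>f\<in>C. \<rho> n f \<iota> < d \<longrightarrow> jet_length n f < e"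
proof -
  define b where "b = exp (e / 2) - 1"
  have b: "0 < b" using e by (simp add: b_def)
  obtain K where K: "1 \<le> K" "\<forall>f\<in>C. \<rho> n f \<iota> \<le> 1 \<longrightarrow> displaces_le n (K * \<rho> n f \<iota>) f"
    by (rule displaces_le_if_\<rho>[OF n zero_le_one])
  define c where "c = b / (1 + b)"
  have c: "0 < c" "c < 1" "c / (1 - c) = b" "c \<le> b" using b by (auto simp: c_def field_simps)
  have "jet_length n f < e" if f: "f \<in> C" "\<rho> n f \<iota> < c / K" for f
  proof -
    have "c / K \<le> c" using c(1) K(1) by (simp add: field_simps)
    then have "\<rho> n f \<iota> \<le> 1" using f(2) c(2) by linarith
    then have "displaces_le n (K * \<rho> n f \<iota>) f" using K(2) f(1) by blast
    moreover have "K * \<rho> n f \<iota> \<le> c" using f(2) K(1) by (simp add: field_simps)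
    ultimately have d: "displaces_le n c f" by (rule displaces_le_mono)
    have "displaces_le n b (ginv f)" using displaces_le_inv[OF d c(2) n] c(3) by simp
    then have "ln (1 + b) \<in> displacement_levels n f" by (rule displacement_levelsI[OF d _ c(4) order_refl])
    then have "jet_length n f \<le> e / 2" using jet_length_le by (force simp: b_def)
    then show ?thesis using e by linarith
  qed
  then show thesis using c(1) K(1) by (intro that[of "c / K"]) simp_all
qed

lemma jet_length_eq_0:
  assumes f: "f \<in> C" and n: "enat n \<le> k" shows "jet_length n f = 0 \<longleftrightarrow> f = \<iota>"
proof
  assume 0: "jet_length n f = 0"
  have "\<rho> n f \<iota> \<le> 0"
  proof (rule ccontr)
    assume "\<not> \<rho> n f \<iota> \<le> 0"
    then have e: "0 < \<rho> n f \<iota>" by simp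
    obtain d where "0 < d" "\<forall>g\<in>C. jet_length n g < d \<longrightarrow> \<rho> n g \<iota> < \<rho> n f \<iota>"
      by (rule \<rho>_small_if_jet_length_small[OF n e])
    then show False using f 0 by (metis order_less_irrefl)
  qed
  moreover have "0 \<le> \<rho> n f \<iota>" using Metric_space.nonneg[OF Metric_space_\<rho>[OF n]] .
  ultimately have "\<rho> n f \<iota> = 0" by simp
  then show "f = \<iota>" using Metric_space.zero[OF Metric_space_\<rho>[OF n] f one_in_C] by blast
next
  assume "f = \<iota>"
  then show "jet_length n f = 0" using jet_length_one[of n] jet_length_nonneg[OF one_in_C n] by simp
qed

definition orders :: "nat set" where "orders = {n. 1 \<le> n \<and> enat n \<le> k}"

lemma one_in_orders: "1 \<in> orders"
  using k_ge_1 by (simp add: orders_def one_enat_def)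

lemma orders_le_k: "n \<in> orders \<Longrightarrow> enat n \<le> k"
  by (simp add: orders_def)

text \<open>The cut-off \<open>1 / n\<close> tends to \<open>0\<close>, so a small supremum over \<open>n\<close> requires only finitely many
  orders to be small. This keeps the supremum continuous for \<open>k = \<infinity>\<close>.\<close>

definition clipped :: "nat \<Rightarrow> ('a \<Rightarrow> 'a) \<Rightarrow> real" where
  "clipped n f = min (1 / real n) (jet_length n f)"

definition sup_length :: "('a \<Rightarrow> 'a) \<Rightarrow> real" where
  "sup_length f = (SUP n\<in>orders. clipped n f)"

text \<open>The supremum alone is compatible with the topology but bounded by \<open>1\<close>; the unclipped summand makes
  the order \<open>N\<close> visible on a large scale.\<close>

definition combined_length :: "nat \<Rightarrow> ('a \<Rightarrow> 'a) \<Rightarrow> real" where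
  "combined_length N f = sup_length f + jet_length N f"

lemma clipped_bdd: "bdd_above ((\<lambda>n. clipped n f) ` orders)"
proof (rule bdd_aboveI2)
  fix n assume "n \<in> orders"
  then have "1 / real n \<le> 1" by (auto simp: orders_def)
  then show "clipped n f \<le> 1" unfolding clipped_def by linarith
qed

lemma clipped_le_sup: "n \<in> orders \<Longrightarrow> clipped n f \<le> sup_length f"
  unfolding sup_length_def using clipped_bdd by (rule cSUP_upper[rotated])

lemma sup_length_leI: "(\<And>n. n \<in> orders \<Longrightarrow> clipped n f \<le> a) \<Longrightarrow> sup_length f \<le> a"
  unfolding sup_length_def using one_in_orders by (intro cSUP_least) auto

lemma clipped_nonneg: "f \<in> C \<Longrightarrow> n \<in> orders \<Longrightarrow> 0 \<le> clipped n f"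
  using jet_length_nonneg orders_le_k by (simp add: clipped_def)

lemma sup_length_nonneg: "f \<in> C \<Longrightarrow> 0 \<le> sup_length f"
  using clipped_nonneg[OF _ one_in_orders] clipped_le_sup[OF one_in_orders] order_trans by blast

lemma sup_length_mult:
  assumes f: "f \<in> C" and g: "g \<in> C"
  shows "sup_length (f \<star> g) \<le> sup_length f + sup_length g"
proof (rule sup_length_leI)
  fix n assume n: "n \<in> orders"
  have "0 \<le> 1 / real n" by simp
  then have "clipped n (f \<star> g) \<le> clipped n f + clipped n g"
    using jet_length_mult[OF f g orders_le_k[OF n]] jet_length_nonneg[OF f orders_le_k[OF n]]
      jet_length_nonneg[OF g orders_le_k[OF n]] unfolding clipped_def by linarith
  then show "clipped n (f \<star> g) \<le> sup_length f + sup_length g"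
    using clipped_le_sup[OF n, of f] clipped_le_sup[OF n, of g] by linarith
qed

lemma length_function_combined:
  assumes N: "enat N \<le> k" shows "length_function G (combined_length N)"
  unfolding length_function_def carrier_G
proof (intro conjI ballI)
  fix f assume f: "f \<in> C"
  have nn: "0 \<le> sup_length f" "0 \<le> jet_length N f" using sup_length_nonneg[OF f] jet_length_nonneg[OF f N] .
  then show "0 \<le> combined_length N f" by (simp add: combined_length_def)
  show "combined_length N f = 0 \<longleftrightarrow> f = \<iota>"
  proof
    assume "combined_length N f = 0"
    then have "jet_length N f = 0" using nn by (simp add: combined_length_def)
    then show "f = \<iota>" using jet_length_eq_0[OF f N] by simp
  next
    assume f1: "f = \<iota>"
    have "clipped n f \<le> 0" for n unfolding clipped_def f1 using jet_length_one[of n] by linarith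
    then have "sup_length f \<le> 0" by (intro sup_length_leI)
    then show "combined_length N f = 0"
      using nn jet_length_one[of N] by (simp add: combined_length_def f1)
  qed
  show "combined_length N (ginv f) = combined_length N f"
    using jet_length_inv[OF f] by (simp add: combined_length_def sup_length_def clipped_def)
next
  fix f g assume fg: "f \<in> C" "g \<in> C"
  show "combined_length N (f \<star> g) \<le> combined_length N f + combined_length N g"
    using sup_length_mult[OF fg] jet_length_mult[OF fg N] by (simp add: combined_length_def)
qed

lemma openin_\<rho>_ball:
  assumes n: "n \<in> orders" and h: "h \<in> C" shows "openin T {f \<in> C. \<rho> n f h < r}"
  unfolding openin_T_iff
proof (intro conjI ballI)
  interpret Metric_space C "\<rho> n" using orders_le_k[OF n] by (rule Metric_space_\<rho>)
  have ball: "{f \<in> C. \<rho> n f h < r} = mball h r" using h commute by (auto simp: in_mball)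
  fix g assume g: "g \<in> {f \<in> C. \<rho> n f h < r}"
  have "openin mtopology {f \<in> C. \<rho> n f h < r}" unfolding ball by (rule openin_mball)
  then have "\<exists>s>0. \<forall>f\<in>C. \<rho> n f g < s \<longrightarrow> f \<in> {f \<in> C. \<rho> n f h < r}"
    using openin_\<rho>_iff[OF orders_le_k[OF n]] g by blast
  then show "Ck_neighbourhood {f \<in> C. \<rho> n f h < r} g" unfolding Ck_neighbourhood_def using n by (auto simp: orders_def)
qed auto

lemma open_jet_length_nbhd:
  assumes n: "n \<in> orders" and e: "0 < e"
  obtains U where "openin T U" "\<iota> \<in> U" "\<forall>f\<in>U. jet_length n f < e"
proof -
  obtain d where d: "0 < d" "\<forall>f\<in>C. \<rho> n f \<iota> < d \<longrightarrow> jet_length n f < e"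
    by (rule jet_length_small_if_\<rho>_small[OF orders_le_k[OF n] e])
  have "\<rho> n \<iota> \<iota> = 0"
    using Metric_space.mdist_zero[OF Metric_space_\<rho>[OF orders_le_k[OF n]] one_in_C] .
  then show thesis
    using d by (intro that[OF openin_\<rho>_ball[OF n one_in_C, of d]]) auto
qed

lemma compatible_combined_length:
  assumes N: "N \<in> orders" shows "compatible_length (combined_length N)"
  unfolding compatible_length_def
proof (intro conjI allI impI)
  show "length_function G (combined_length N)" using orders_le_k[OF N] by (rule length_function_combined)
next
  fix e :: real assume e: "0 < e"
  have "\<forall>n\<in>orders. \<exists>U. openin T U \<and> \<iota> \<in> U \<and> (\<forall>f\<in>U. jet_length n f < e / 3)"
  proof
    fix n assume n: "n \<in> orders"
    have "0 < e / 3" using e by simp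
    then obtain U where "openin T U" "\<iota> \<in> U" "\<forall>f\<in>U. jet_length n f < e / 3"
      by (rule open_jet_length_nbhd[OF n])
    then show "\<exists>U. openin T U \<and> \<iota> \<in> U \<and> (\<forall>f\<in>U. jet_length n f < e / 3)"
      by (intro exI conjI)
  qed
  from bchoice[OF this] obtain W where
    W: "\<forall>n\<in>orders. openin T (W n) \<and> \<iota> \<in> W n \<and> (\<forall>f\<in>W n. jet_length n f < e / 3)"
    by (rule exE)
  \<comment> \<open>Orders above \<open>m\<close> are below \<open>e / 3\<close> by the cut-off.\<close>
  obtain m :: nat where m: "3 / e < real m" using reals_Archimedean2 by blast
  define U where "U = (\<Inter>n\<in>insert N (orders \<inter> {..m}). W n)"
  have "openin T U" unfolding U_def using W N by (intro openin_INT2) auto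
  moreover have "\<iota> \<in> U" unfolding U_def using W N by auto
  moreover have "combined_length N f < e" if f: "f \<in> U" for f
  proof -
    have "sup_length f \<le> e / 3"
    proof (rule sup_length_leI)
      fix n assume n: "n \<in> orders"
      show "clipped n f \<le> e / 3"
      proof (cases "n \<le> m")
        case True
        then have "f \<in> W n" using f n by (auto simp: U_def)
        then have "jet_length n f < e / 3" using bspec[OF W n] by blast
        then show ?thesis by (simp add: clipped_def)
      next
        case False
        then have "3 / e < real n" using m by linarith
        moreover have "0 < real n" using n by (simp add: orders_def)
        ultimately have "1 / real n \<le> e / 3" using e by (simp add: field_simps)
        then show ?thesis by (simp add: clipped_def)
      qed
    qed
    moreover have "jet_length N f < e / 3" using bspec[OF W N] f by (auto simp: U_def)
    ultimately show ?thesis using e by (simp add: combined_length_def)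
  qed
  ultimately show "\<exists>U. openin T U \<and> \<iota> \<in> U \<and> (\<forall>f\<in>U. combined_length N f < e)" by blast
next
  fix U assume U: "openin T U \<and> \<iota> \<in> U"
  then have "Ck_neighbourhood U \<iota>" using openin_T_iff by blast
  then obtain n r where n: "1 \<le> n" "enat n \<le> k" "0 < r" "\<forall>f\<in>C. \<rho> n f \<iota> < r \<longrightarrow> f \<in> U"
    unfolding Ck_neighbourhood_def by (elim exE conjE)
  have no: "n \<in> orders" using n by (simp add: orders_def)
  obtain d where d: "0 < d" "\<forall>f\<in>C. jet_length n f < d \<longrightarrow> \<rho> n f \<iota> < r"
    by (rule \<rho>_small_if_jet_length_small[OF n(2,3)])
  have "f \<in> U" if f: "f \<in> C" "combined_length N f < min d (1 / real n)" for f
  proof -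
    have "clipped n f \<le> combined_length N f"
      using clipped_le_sup[OF no, of f] jet_length_nonneg[OF f(1) orders_le_k[OF N]]
      by (simp add: combined_length_def)
    then have "clipped n f < d" "clipped n f < 1 / real n" using f(2) by simp_all
    then have "jet_length n f < d" unfolding clipped_def by linarith
    then show ?thesis using d(2) n(4) f(1) by blast
  qed
  then show "\<exists>e>0. \<forall>f\<in>carrier G. combined_length N f < e \<longrightarrow> f \<in> U"
    using d(1) n(1) by (intro exI[of _ "min d (1 / real n)"]) simp
qed

end

section \<open>Small balls have the property (OB) and generate\<close>

context topologized_group begin

lemma openin_length_ball:
  assumes len: "compatible_length len" shows "openin T {f \<in> carrier G. len f < e}"
proof -
  have L: "length_function G len" using len by (rule compatible_lengthD)
  interpret Metric_space "carrier G" "length_metric G len" using L by (rule Metric_space_length_metric)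
  have T: "mtopology = T"
    using right_invariant_compatible_length_metric[OF len] by (simp add: right_invariant_compatible_metric_def)
  have "length_metric G len \<one> f = len f" if "f \<in> carrier G" for f
    using that L by (simp add: length_metric_def length_function_def)
  then have "{f \<in> carrier G. len f < e} = mball \<one> e" by (auto simp: in_mball)
  then show ?thesis using openin_mball T by metis
qed

end

context diffeo_model begin

definition segment :: "(real \<Rightarrow> real) \<Rightarrow> real \<Rightarrow> real \<Rightarrow> real" where
  "segment F t x = (1 - t) * x + t * F x"

lemma segment_path:
  assumes F: "is_lift F f"
  obtains \<gamma> where "\<gamma> 0 = \<iota>" "\<gamma> 1 = f" "\<forall>t\<in>{0..1}. is_lift (segment F t) (\<gamma> t)"
proof -
  have "\<forall>t\<in>{0..1}. \<exists>g. is_lift (segment F t) g"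
  proof
    fix t :: real assume "t \<in> {0..1}"
    then have "segment F t \<in> lifts k"
      using lifts_convex[OF is_liftD(2)[OF F] k_ge_1, of t] unfolding segment_def[abs_def] by simp
    then show "\<exists>g. is_lift (segment F t) g" using obtain_projection by blast
  qed
  from bchoice[OF this] obtain \<gamma> where \<gamma>: "\<forall>t\<in>{0..1}. is_lift (segment F t) (\<gamma> t)" by (rule exE)
  have "is_lift (segment F 0) (\<gamma> 0)" "is_lift (segment F 1) (\<gamma> 1)" using \<gamma> by simp_all
  then have "\<gamma> 0 = \<iota>" "\<gamma> 1 = f"
    using is_lift_unique[OF _ one_lift] is_lift_unique[OF _ F] by (simp_all add: segment_def)
  then show thesis using \<gamma> by (rule that)
qed

lemma jet_norm_scale: "Ck_on (enat n) S u \<Longrightarrow> x \<in> S \<Longrightarrow> jet_norm n (\<lambda>y. a * u y) x = \<bar>a\<bar> * jet_norm n u x"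
  unfolding jet_norm_def sum_distrib_left
proof (rule sum.cong[OF refl])
  fix j assume u: "Ck_on (enat n) S u" "x \<in> S" and j: "j \<in> {1..n}"
  have "enat j \<le> enat n" using j by simp
  then show "\<bar>dS j (\<lambda>y. a * u y) x\<bar> = \<bar>a\<bar> * \<bar>dS j u x\<bar>"
    using dS_scale[OF Ck_mono[OF u(1)] u(2), of j a] by (simp add: abs_mult)
qed

lemma \<kappa>_nonneg: "0 \<le> \<kappa>"
proof -
  have "0 \<in> S" "1 \<in> S" using S_cases by auto
  then have "dist (p 0) (p 1) \<le> \<kappa>" using p_lipschitz[of 0 1] by simp
  then show ?thesis by (meson order_trans zero_le_dist)
qed

lemma \<rho>_segment_le:
  assumes F: "is_lift F f" "\<bar>F 0\<bar> \<le> 1" and n: "enat n \<le> k"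
    and s: "is_lift (segment F s) g" and t: "is_lift (segment F t) h"
    and b: "\<And>x. x \<in> S \<Longrightarrow> jet_norm n (\<lambda>y. F y - y) x \<le> b"
  shows "\<rho> n g h \<le> \<bar>s - t\<bar> * (2 * \<kappa> + real n * b)"
proof -
  have eq: "segment F s x - segment F t x = (s - t) * (F x - x)" for x
    by (simp add: segment_def algebra_simps)
  have "\<rho> n g h \<le> \<bar>s - t\<bar> * (2 * \<kappa>) + real n * (\<bar>s - t\<bar> * b)"
  proof (rule \<rho>_le[OF s t n])
    fix z assume "z \<in> M"
    then obtain x where x: "x \<in> S" "z = p x" using in_M by blast
    have "dist (g z) (h z) \<le> \<kappa> * \<bar>segment F s x - segment F t x\<bar>"
      using p_lipschitz[OF lift_maps[OF s x(1)] lift_maps[OF t x(1)]]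
        is_liftD(3)[OF s x(1)] is_liftD(3)[OF t x(1)] x(2) by simp
    also have "\<dots> \<le> \<kappa> * (\<bar>s - t\<bar> * 2)"
      unfolding eq abs_mult using lift_near_id[OF is_liftD(2)[OF F(1)] F(2) x(1)] \<kappa>_nonneg
      by (intro mult_left_mono) simp_all
    finally show "dist (g z) (h z) \<le> \<bar>s - t\<bar> * (2 * \<kappa>)" by (simp add: algebra_simps)
  next
    fix x assume x: "x \<in> S"
    have "Ck_on (enat n) S (\<lambda>y. F y - y)" by (intro Ck_diff lift_Ck[OF F(1) n] Ck_id)
    then have "jet_norm n (\<lambda>y. (s - t) * (F y - y)) x = \<bar>s - t\<bar> * jet_norm n (\<lambda>y. F y - y) x"
      using x by (rule jet_norm_scale)
    also have "\<dots> \<le> \<bar>s - t\<bar> * b" using b[OF x] by (simp add: mult_left_mono)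
    finally show "jet_norm n (\<lambda>y. segment F s y - segment F t y) x \<le> \<bar>s - t\<bar> * b" unfolding eq .
  qed
  then show ?thesis by (simp add: algebra_simps)
qed

lemma \<rho>_quotient_le:
  assumes g: "g \<in> C" and h: "h \<in> C" and n: "enat n \<le> k"
    and H: "is_lift H (ginv h)" "distortion_le n c H" "0 \<le> c"
  shows "\<rho> n (g \<star> ginv h) \<iota> \<le> (1 + real n * (1 + c)) * \<rho> n g h"
  using \<rho>_translate_le[OF g h H(1) n H(2,3)] h by simp

text \<open>The chain to \<open>f\<close> consists of \<open>N\<close> equidistant points of the affine path. For \<open>f\<close> in a small ball
  every point of the path has distortion at most \<open>1 / 2\<close>, hence its inverse has distortion at most
  \<open>1\<close>, and the \<open>C\<^sup>n\<close>-size of a quotient of consecutive points is at most \<open>q / N\<close> with \<open>q\<close> independent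
  of \<open>f\<close>.\<close>

lemma property_OB_ball:
  assumes k: "k = enat n"
  obtains e where "0 < e" "property_OB G T {f \<in> C. \<rho> n f \<iota> < e}"
proof -
  have n: "enat n \<le> k" using k by simp
  obtain K where K0: "0 \<le> K" and K: "\<forall>e F. 0 \<le> e \<and> e \<le> 1 \<and> F \<in> S \<rightarrow> S \<and> Ck_on (enat n) S F \<and>
      (\<forall>x\<in>S. \<forall>j\<in>{1..n}. \<bar>dS j (\<lambda>y. F y - y) x\<bar> \<le> e) \<longrightarrow> distortion_le n (K * e) F"
    by (rule distortion_le_bound[OF zero_le_one])
  define e where "e = 1 / (2 * (1 + K))"
  have e: "0 < e" "e \<le> 1" "K * e \<le> 1 / 2" using K0 by (auto simp: e_def field_simps)
  \<comment> \<open>The factor \<open>1 + 1\<close> is one plus the distortion of the inverse of a path point.\<close>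
  define q where "q = (1 + real n * (1 + 1)) * (2 * \<kappa> + real n * e)"
  have q0: "0 \<le> q" unfolding q_def using \<kappa>_nonneg e(1) by (intro mult_nonneg_nonneg add_nonneg_nonneg) simp_all
  have "property_OB G T {f \<in> C. \<rho> n f \<iota> < e}"
  proof (rule property_OB_if_chains)
    show "{f \<in> C. \<rho> n f \<iota> < e} \<subseteq> carrier G" by auto
    fix V assume V: "openin T V" "\<iota> \<in> V"
    then have "Ck_neighbourhood V \<iota>" using openin_T_iff by blast
    then obtain m r where m: "enat m \<le> k" "0 < r" "\<forall>f\<in>C. \<rho> m f \<iota> < r \<longrightarrow> f \<in> V"
      unfolding Ck_neighbourhood_def by (elim exE conjE)
    have mn: "m \<le> n" using m(1) k by simp
    obtain N0 :: nat where N0: "q / r < real N0" using reals_Archimedean2 by blast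
    define N where "N = Suc N0"
    have N: "0 < N" "q / real N < r"
    proof -
      have "q / r < real N" using N0 by (simp add: N_def)
      then show "q / real N < r" using m(2) by (simp add: N_def field_simps)
    qed (simp add: N_def)
    have chain: "\<exists>\<phi>. \<phi> 0 = \<iota> \<and> \<phi> N = f \<and>
        (\<forall>i\<le>N. \<phi> i \<in> carrier G) \<and> (\<forall>i<N. \<phi> (Suc i) \<star> ginv (\<phi> i) \<in> V)"
      if f: "f \<in> C" "\<rho> n f \<iota> < e" for f
    proof -
      obtain F where F: "is_lift F f" "\<bar>F 0\<bar> \<le> 1" by (rule obtain_lift[OF f(1)])
      obtain \<gamma> where \<gamma>: "\<gamma> 0 = \<iota>" "\<gamma> 1 = f" "\<forall>t\<in>{0..1}. is_lift (segment F t) (\<gamma> t)"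
        by (rule segment_path[OF F(1)])
      have jF: "jet_norm n (\<lambda>y. F y - y) x \<le> e" if "x \<in> S" for x
        using jet_norm_le_\<rho>[OF F(1) one_lift n that] f(2) by linarith
      have wC: "Ck_on (enat n) S (\<lambda>y. F y - y)" by (intro Ck_diff lift_Ck[OF F(1) n] Ck_id)
      have step: "\<gamma> s \<star> ginv (\<gamma> t) \<in> V" if st: "s \<in> {0..1}" "t \<in> {0..1}" "\<bar>s - t\<bar> = 1 / real N" for s t
      proof -
        have Fs: "is_lift (segment F s) (\<gamma> s)" and Ft: "is_lift (segment F t) (\<gamma> t)"
          using \<gamma>(3) st by blast+
        have C: "\<gamma> s \<in> C" "\<gamma> t \<in> C" using Fs Ft is_liftD(1) by blast+
        have Ft': "segment F t \<in> S \<rightarrow> S" "Ck_on (enat n) S (segment F t)"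
          using is_liftD(2)[OF Ft] liftsD(1) lift_Ck[OF Ft n] by blast+
        have "\<forall>x\<in>S. \<forall>j\<in>{1..n}. \<bar>dS j (\<lambda>y. segment F t y - y) x\<bar> \<le> e"
        proof (intro ballI)
          fix x j assume x: "x \<in> S" and j: "j \<in> {1..n}"
          have "(\<lambda>y. segment F t y - y) = (\<lambda>y. t * (F y - y))"
            by (auto simp: segment_def algebra_simps)
          then have "\<bar>dS j (\<lambda>y. segment F t y - y) x\<bar> \<le> jet_norm n (\<lambda>y. t * (F y - y)) x"
            using j abs_dS_le_jet_norm[of j n "\<lambda>y. t * (F y - y)" x] by simp
          also have "\<dots> = \<bar>t\<bar> * jet_norm n (\<lambda>y. F y - y) x" using wC x by (rule jet_norm_scale)
          also have "\<dots> \<le> 1 * e" using st(2) jF[OF x] jet_norm_nonneg by (intro mult_mono) auto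
          finally show "\<bar>dS j (\<lambda>y. segment F t y - y) x\<bar> \<le> e" by simp
        qed
        then have "distortion_le n (K * e) (segment F t)"
          using K e(1,2) Ft' by (intro K[rule_format]) simp
        then have dF: "distortion_le n (1 / 2) (segment F t)" using e(3) by (rule distortion_le_mono)
        obtain H where H: "is_lift H (ginv (\<gamma> t))" "\<forall>x\<in>S. segment F t (H x) = x \<and> H (segment F t x) = x"
          by (rule inv_lift[OF Ft])
        have H': "Ck_on (enat n) S H" "H \<in> S \<rightarrow> S" using lift_Ck[OF H(1) n] is_liftD(2)[OF H(1)] liftsD(1) by blast+
        have "distortion_le n ((1 / 2) / (1 - 1 / 2)) H"
          using H(2) by (intro distortion_le_inverse[OF dF Ft'(1) _ _ H']) simp_all
        then have dH: "distortion_le n 1 H" by simp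
        have "\<rho> n (\<gamma> s \<star> ginv (\<gamma> t)) \<iota> \<le> (1 + real n * (1 + 1)) * \<rho> n (\<gamma> s) (\<gamma> t)"
          by (rule \<rho>_quotient_le[OF C n H(1) dH zero_le_one])
        also have "\<dots> \<le> (1 + real n * (1 + 1)) * (\<bar>s - t\<bar> * (2 * \<kappa> + real n * e))"
          using \<rho>_segment_le[OF F n Fs Ft jF] by (intro mult_left_mono) simp_all
        also have "\<dots> = q / real N" by (simp add: q_def st(3))
        finally have "\<rho> n (\<gamma> s \<star> ginv (\<gamma> t)) \<iota> < r" using N(2) by linarith
        moreover have qC: "\<gamma> s \<star> ginv (\<gamma> t) \<in> C" using C by simp
        ultimately have "\<rho> m (\<gamma> s \<star> ginv (\<gamma> t)) \<iota> < r"
          using \<rho>_mono[OF qC one_in_C mn n] by linarith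
        then show ?thesis using m(3) qC by blast
      qed
      show ?thesis
      proof (intro exI[of _ "\<lambda>i. \<gamma> (real i / real N)"] conjI allI impI)
        show "\<gamma> (real 0 / real N) = \<iota>" "\<gamma> (real N / real N) = f" using \<gamma> N(1) by simp_all
        have in01: "real i / real N \<in> {0..1}" if "i \<le> N" for i using that N(1) by simp
        show "\<gamma> (real i / real N) \<in> carrier G" if "i \<le> N" for i
          using is_liftD(1)[OF bspec[OF \<gamma>(3) in01[OF that]]] by simp
        show "\<gamma> (real (Suc i) / real N) \<star> ginv (\<gamma> (real i / real N)) \<in> V" if i: "i < N" for i
        proof (rule step)
          show "real (Suc i) / real N \<in> {0..1}" "real i / real N \<in> {0..1}" using i in01 by simp_all
          show "\<bar>real (Suc i) / real N - real i / real N\<bar> = 1 / real N"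
            by (simp add: diff_divide_distrib[symmetric])
        qed
      qed
    qed
    then show "\<exists>N. \<forall>f\<in>{f \<in> C. \<rho> n f \<iota> < e}. \<exists>\<phi>. \<phi> 0 = \<iota> \<and> \<phi> N = f \<and>
        (\<forall>i\<le>N. \<phi> i \<in> carrier G) \<and> (\<forall>i<N. \<phi> (Suc i) \<star> ginv (\<phi> i) \<in> V)"
      by (intro exI[of _ N] ballI) simp
  qed
  then show thesis using e(1) by (intro that)
qed

text \<open>Near any \<open>t\<close> the quotients of the affine path from the identity to \<open>f\<close> stay in \<open>U\<close>, so whether the
  path is inside the subgroup generated by \<open>U\<close> is locally constant in \<open>t\<close>. Unlike in the previous
  lemma, the size of the neighbourhood may depend on \<open>f\<close> and \<open>t\<close>.\<close>

lemma generate_open: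
  assumes U: "openin T U" "\<iota> \<in> U" shows "generate G U = carrier G"
proof
  have UC: "U \<subseteq> carrier G" using openin_subset[OF U(1)] topspace_T by simp
  then show "generate G U \<subseteq> carrier G" by (rule generate_incl)
  interpret H: subgroup "generate G U" G using UC by (rule generate_is_subgroup)
  have "Ck_neighbourhood U \<iota>" using U openin_T_iff by blast
  then obtain n r where n: "enat n \<le> k" "0 < r" "\<forall>f\<in>C. \<rho> n f \<iota> < r \<longrightarrow> f \<in> U"
    unfolding Ck_neighbourhood_def by (elim exE conjE)
  show "carrier G \<subseteq> generate G U"
  proof
    fix f assume "f \<in> carrier G"
    then have f: "f \<in> C" by simp
    obtain F where F: "is_lift F f" "\<bar>F 0\<bar> \<le> 1" by (rule obtain_lift[OF f])
    obtain \<gamma> where \<gamma>: "\<gamma> 0 = \<iota>" "\<gamma> 1 = f" "\<forall>t\<in>{0..1}. is_lift (segment F t) (\<gamma> t)"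
      by (rule segment_path[OF F(1)])
    define b where "b = \<rho> n f \<iota>"
    have b: "jet_norm n (\<lambda>y. F y - y) x \<le> b" if "x \<in> S" for x
      unfolding b_def by (rule jet_norm_le_\<rho>[OF F(1) one_lift n(1) that])
    have b0: "0 \<le> b" unfolding b_def using Metric_space.nonneg[OF Metric_space_\<rho>[OF n(1)]] .
    have "(\<lambda>t. \<gamma> t \<in> generate G U) constant_on {0..1}"
    proof (rule locally_constant_imp_constant)
      show "connected {0..1::real}" by simp
      fix t :: real assume t: "t \<in> {0..1}"
      have Ft: "is_lift (segment F t) (\<gamma> t)" using \<gamma>(3) t by blast
      have Ct: "\<gamma> t \<in> C" using Ft is_liftD(1) by blast
      obtain H where H: "is_lift H (ginv (\<gamma> t))" "\<forall>x\<in>S. segment F t (H x) = x \<and> H (segment F t x) = x"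
        by (rule inv_lift[OF Ft])
      obtain c where c: "0 \<le> c" "distortion_le n c H" by (rule distortion_finite[OF H(1) n(1)])
      define q where "q = (1 + real n * (1 + c)) * (2 * \<kappa> + real n * b) + 1"
      have "0 \<le> (1 + real n * (1 + c)) * (2 * \<kappa> + real n * b)"
        using \<kappa>_nonneg b0 c(1) by (intro mult_nonneg_nonneg add_nonneg_nonneg) simp_all
      then have q: "0 < q" by (simp add: q_def)
      have locally_constant: "\<gamma> s \<in> generate G U \<longleftrightarrow> \<gamma> t \<in> generate G U" if s: "s \<in> {0..1}" "\<bar>s - t\<bar> < r / q" for s
      proof -
        have Fs: "is_lift (segment F s) (\<gamma> s)" using \<gamma>(3) s by blast
        have Cs: "\<gamma> s \<in> C" using Fs is_liftD(1) by blast
        have "\<rho> n (\<gamma> s \<star> ginv (\<gamma> t)) \<iota> \<le> (1 + real n * (1 + c)) * \<rho> n (\<gamma> s) (\<gamma> t)"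
          by (rule \<rho>_quotient_le[OF Cs Ct n(1) H(1) c(2,1)])
        also have "\<dots> \<le> (1 + real n * (1 + c)) * (\<bar>s - t\<bar> * (2 * \<kappa> + real n * b))"
          using \<rho>_segment_le[OF F n(1) Fs Ft b] c(1) by (intro mult_left_mono) simp_all
        also have "\<dots> \<le> \<bar>s - t\<bar> * q" by (simp add: q_def algebra_simps)
        also have "\<dots> < r" using s(2) q by (simp add: field_simps)
        finally have u: "\<gamma> s \<star> ginv (\<gamma> t) \<in> generate G U"
          using n(3) Cs Ct by (intro generate.incl) simp
        have "(\<gamma> s \<star> ginv (\<gamma> t)) \<star> \<gamma> t = \<gamma> s"
          using Cs Ct by (simp add: m_assoc)
        moreover have "ginv (\<gamma> s \<star> ginv (\<gamma> t)) \<star> \<gamma> s = \<gamma> t"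
          using Cs Ct by (simp add: inv_mult_group m_assoc)
        ultimately show ?thesis
          using H.m_closed[OF u, of "\<gamma> t"] H.m_closed[OF H.m_inv_closed[OF u], of "\<gamma> s"] by auto
      qed
      show "\<exists>V. openin (top_of_set {0..1}) V \<and> t \<in> V \<and> (\<forall>s\<in>V. (\<gamma> s \<in> generate G U) = (\<gamma> t \<in> generate G U))"
      proof (intro exI[of _ "{0..1} \<inter> ball t (r / q)"] conjI ballI)
        show "openin (top_of_set {0..1}) ({0..1} \<inter> ball t (r / q))" by (intro openin_open_Int) simp
        show "t \<in> {0..1} \<inter> ball t (r / q)" using t n(2) q by simp
        show "(\<gamma> s \<in> generate G U) = (\<gamma> t \<in> generate G U)" if "s \<in> {0..1} \<inter> ball t (r / q)" for s
          using that by (intro locally_constant) (auto simp: dist_real_def abs_minus_commute)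
      qed
    qed
    then have "\<gamma> 1 \<in> generate G U \<longleftrightarrow> \<gamma> 0 \<in> generate G U" unfolding constant_on_def by force
    then show "f \<in> generate G U" using \<gamma> H.one_closed by simp
  qed
qed

end

section \<open>Unbounded lengths from rapidly oscillating diffeomorphisms\<close>

context coordinate_domain begin

lemma abs_dS_sin_le:
  assumes "x \<in> S" "0 \<le> w" shows "\<bar>dS j (\<lambda>x. sin (w * x)) x\<bar> \<le> w ^ j"
proof (cases "even j")
  case True
  then obtain i where "j = 2 * i" by (rule evenE)
  then show ?thesis using sin_derivs(1)[OF assms(1), of i w] assms(2)
    by (simp add: abs_mult mult_left_le)
next
  case False
  then obtain i where "j = 2 * i + 1" by (rule oddE)
  then have j: "j = Suc (2 * i)" by simp
  show ?thesis unfolding j sin_derivs(2)[OF assms(1)] abs_mult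
    using assms(2) by (simp add: mult_left_le mult_left_le[of "\<bar>cos (w * x)\<bar>" "w * w ^ (2 * i)"])
qed

lemma abs_dS_sin_attained:
  assumes w: "pi / 2 \<le> w" shows "\<exists>x\<in>S. \<bar>dS j (\<lambda>x. sin (w * x)) x\<bar> = w ^ j"
proof (cases "even j")
  case True
  then obtain i where i: "j = 2 * i" by (rule evenE)
  have w0: "0 < w" using w pi_gt_zero by linarith
  define x where "x = pi / (2 * w)"
  have "w * x = pi / 2" using w0 by (simp add: x_def)
  then have "sin (w * x) = 1" by (simp only: sin_pi_half)
  moreover have "x \<in> S" using S_cases w w0 by (auto simp: x_def field_simps)
  ultimately show ?thesis
    using sin_derivs(1)[of x i w] w0 by (intro bexI[of _ x]) (simp_all add: i abs_mult)
next
  case False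
  then obtain i where "j = 2 * i + 1" by (rule oddE)
  then have j: "j = Suc (2 * i)" by simp
  have "0 < w" using w pi_gt_zero by linarith
  moreover have "0 \<in> S" using S_cases by auto
  ultimately show ?thesis
    unfolding j using sin_derivs(2)[of 0 i w] by (intro bexI[of _ 0]) (simp_all add: abs_mult)
qed

end

context diffeo_model begin

lemma combined_length_less_imp_\<rho>:
  assumes f: "f \<in> C" and N: "enat N \<le> k" and B: "combined_length N f \<le> B"
  shows "\<rho> N f \<iota> \<le> (1 + real N) * (exp (B + 1) - 1)"
proof -
  have "jet_length N f < B + 1" using sup_length_nonneg[OF f] B unfolding combined_length_def by linarith
  then show ?thesis by (rule jet_length_less_imp_\<rho>[OF f N])
qed

text \<open>The lift \<open>x + b * sin (2 * pi * x)\<close> fixes \<open>1 / 2\<close> with derivative \<open>1 - 2 * pi * b\<close>, and the derivative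
  of its inverse there is the reciprocal, which is large when \<open>b\<close> is close to \<open>1 / (2 * pi)\<close>.\<close>

lemma combined_length_unbounded: "\<exists>f\<in>C. B < combined_length 1 f"
proof (rule ccontr)
  assume "\<not> (\<exists>f\<in>C. B < combined_length 1 f)"
  then have le: "combined_length 1 f \<le> max B 0" if "f \<in> C" for f using that by fastforce
  have k1: "enat 1 \<le> k" using k_ge_1 by (simp add: one_enat_def)
  define R where "R = (1 + real 1) * (exp (max B 0 + 1) - 1)"
  have R0: "0 \<le> R" by (simp add: R_def)
  \<comment> \<open>Chosen so that the derivative at \<open>1 / 2\<close> is \<open>1 / (R + 2)\<close>.\<close>
  define b where "b = (1 - 1 / (R + 2)) / (2 * pi)"
  have "b * (2 * pi) = 1 - 1 / (R + 2)" by (simp add: b_def)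
  moreover have "0 < 1 / (R + 2)" "1 / (R + 2) \<le> 1" using R0 by simp_all
  ultimately have b: "0 \<le> b" "b * (2 * pi) < 1" "1 - b * (2 * pi) = 1 / (R + 2)"
    unfolding b_def by (linarith | simp)+
  define F where "F = (\<lambda>x. x + b * sin ((2 * pi) * x))"
  have "F \<in> lifts k" unfolding F_def by (rule sine_lift[OF k_ge_1 b(1,2), of 1]) simp
  then obtain f where F: "is_lift F f" by (rule obtain_projection)
  obtain H where H: "is_lift H (ginv f)" "\<forall>x\<in>S. F (H x) = x \<and> H (F x) = x" by (rule inv_lift[OF F])
  define x :: real where "x = 1 / 2"
  have x: "x \<in> S" using S_cases by (auto simp: x_def)
  have Fx: "F x = x" by (simp add: F_def x_def)
  have dF: "dS 1 F x = 1 / (R + 2)"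
  proof -
    have "(F has_real_derivative 1 + b * (cos (2 * pi * x) * (2 * pi))) (at x within S)"
      unfolding F_def by (auto intro!: derivative_eq_intros)
    moreover have "cos (2 * pi * x) = - 1" by (simp add: x_def)
    ultimately show ?thesis using dS_1_eq x b(3) by (metis mult_minus1 mult_minus_right uminus_add_conv_diff add.commute)
  qed
  have dif: "H differentiable_on S" "F differentiable_on S"
    using Ck_differentiable[OF liftsD(2)[OF is_liftD(2)] k_ge_1] H(1) F by blast+
  have "((\<lambda>y. H (F y)) has_real_derivative dS 1 H (F x) * dS 1 F x) (at x within S)"
    using liftsD(1)[OF is_liftD(2)[OF F]] by (intro has_deriv_compose dif x)
  then have "dS 1 (\<lambda>y. H (F y)) x = dS 1 H x * dS 1 F x" using dS_1_eq x Fx by simp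
  moreover have "dS 1 (\<lambda>y. H (F y)) x = dS 1 (\<lambda>y. y) x" using H(2) x by (intro dS_cong) auto
  ultimately have "dS 1 H x * (1 / (R + 2)) = 1" using dS_1_id[OF x] dF by simp
  then have dH: "dS 1 H x = R + 2" using R0 by (simp add: field_simps)
  have "dS 1 (\<lambda>y. H y - y) x = dS 1 H x - dS 1 (\<lambda>y. y) x"
    by (rule dS_diff[OF lift_Ck[OF H(1) k1] Ck_id x])
  then have "\<bar>dS 1 (\<lambda>y. H y - y) x\<bar> = R + 1" using dH dS_1_id[OF x] R0 by simp
  moreover have "\<bar>dS 1 (\<lambda>y. H y - y) x\<bar> \<le> jet_norm 1 (\<lambda>y. H y - y) x" by (rule abs_dS_le_jet_norm) simp_all
  moreover have "jet_norm 1 (\<lambda>y. H y - y) x \<le> \<rho> 1 (ginv f) \<iota>" by (rule jet_norm_le_\<rho>[OF H(1) one_lift k1 x])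
  moreover have "\<rho> 1 (ginv f) \<iota> \<le> R"
    unfolding R_def using is_liftD(1)[OF H(1)] k1 le[OF is_liftD(1)[OF H(1)]] by (rule combined_length_less_imp_\<rho>)
  ultimately show False by linarith
qed

text \<open>The non-triviality needs a symmetric generating set that is open and has the property (OB); a
  ball of the compatible length inside the (OB) neighbourhood is symmetric by construction.\<close>

lemma qi_class_if_finite_order:
  assumes k: "k = enat n"
  shows "locally_OB G T \<and> has_qi_class G T \<and> nontrivial_qi_class G T"
proof -
  have "1 \<le> n" using k k_ge_1 by (simp add: one_enat_def)
  moreover have "enat n \<le> k" using k by simp
  ultimately have n: "n \<in> orders" by (simp add: orders_def)
  obtain e where e: "0 < e" "property_OB G T {f \<in> C. \<rho> n f \<iota> < e}" by (rule property_OB_ball[OF k])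
  define U where "U = {f \<in> C. \<rho> n f \<iota> < e}"
  have U: "openin T U" unfolding U_def by (rule openin_\<rho>_ball[OF n one_in_C])
  have oneU: "\<iota> \<in> U"
    using Metric_space.mdist_zero[OF Metric_space_\<rho>[OF orders_le_k[OF n]] one_in_C] e(1) by (simp add: U_def)
  have OB: "property_OB G T U" using e(2) by (simp add: U_def)
  have "locally_OB G T" unfolding locally_OB_def using U oneU OB by blast
  moreover have "has_qi_class G T" unfolding has_qi_class_def using U OB generate_open[OF U oneU] by blast
  moreover have "nontrivial_qi_class G T"
  proof -
    have len: "compatible_length (combined_length 1)" using one_in_orders by (rule compatible_combined_length)
    then have L: "length_function G (combined_length 1)" by (rule compatible_lengthD)
    obtain d where d: "0 < d" "\<forall>f\<in>carrier G. combined_length 1 f < d \<longrightarrow> f \<in> U"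
      using compatible_lengthD(3)[OF len U oneU] by (elim exE conjE)
    define A where "A = {f \<in> carrier G. combined_length 1 f < d}"
    have A: "openin T A" unfolding A_def using len by (rule openin_length_ball)
    have "combined_length 1 \<iota> = 0" using L unfolding length_function_def by auto
    then have oneA: "\<iota> \<in> A" using d(1) by (simp add: A_def)
    have "ginv f \<in> A" if "f \<in> A" for f
    proof -
      have "f \<in> carrier G" using that by (simp add: A_def)
      then have "combined_length 1 (ginv f) = combined_length 1 f" using L unfolding length_function_def by blast
      then show ?thesis using that by (simp add: A_def)
    qed
    moreover have "A \<subseteq> carrier G" by (simp add: A_def)
    ultimately have "symmetric_generating_set G A"
      unfolding symmetric_generating_set_def using generate_open[OF A oneA] by blast
    moreover have "property_OB G T A" using OB d(2) by (intro property_OB_subset[OF OB]) (auto simp: A_def)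
    ultimately show ?thesis
      using combined_length_unbounded by (intro nontrivial_qi_class_if_unbounded_length[OF A _ _ len]) simp_all
  qed
  ultimately show ?thesis by blast
qed

text \<open>A neighbourhood \<open>U\<close> of the identity contains a \<open>C\<^sup>n\<close>-ball of some radius \<open>r\<close>. With \<open>b = a / w\<^sup>n\<close>
  the derivatives of \<open>b * sin (w * x)\<close> up to order \<open>n\<close> are at most \<open>a\<close>, whereas those of order \<open>n + 1\<close>
  reach \<open>a * w\<close>.\<close>

lemma not_locally_OB_if_infinite_order:
  assumes k: "k = \<infinity>" shows "\<not> locally_OB G T"
proof
  assume "locally_OB G T"
  then obtain W U where U: "openin T U" "\<iota> \<in> U" "U \<subseteq> W" "property_OB G T W"
    unfolding locally_OB_def by blast
  have kn: "enat n \<le> k" for n using k by simp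
  have "Ck_neighbourhood U \<iota>" using U openin_T_iff by blast
  then obtain n r where n: "1 \<le> n" "0 < r" "\<forall>f\<in>C. \<rho> n f \<iota> < r \<longrightarrow> f \<in> U"
    unfolding Ck_neighbourhood_def by (elim exE conjE)
  have "Suc n \<in> orders" using kn by (simp add: orders_def)
  then have len: "compatible_length (combined_length (Suc n))" by (rule compatible_combined_length)
  obtain B where B: "\<And>f. f \<in> W \<Longrightarrow> combined_length (Suc n) f \<le> B"
    using property_OB_imp_length_bounded[OF U(4) len] by blast
  define R where "R = (1 + real (Suc n)) * (exp (B + 1) - 1)"
  define q where "q = \<kappa> + real n * real n + 1"
  have q: "0 < q" using \<kappa>_nonneg by (simp add: q_def add_nonneg_pos)
  \<comment> \<open>Below \<open>1\<close> to keep the derivative of the lift positive, and small enough for the ball.\<close>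
  define a where "a = min (1 / 2) (r / (2 * q))"
  have a: "0 < a" "a < 1" using n(2) q by (auto simp: a_def)
  have aq: "(\<kappa> + real n * real n) * a < r"
  proof -
    have "a \<le> r / (2 * q)" by (simp add: a_def)
    then have "q * a \<le> r / 2" using q by (simp add: field_simps)
    moreover have "(\<kappa> + real n * real n) * a \<le> q * a" using a(1) by (intro mult_right_mono) (simp_all add: q_def)
    ultimately show ?thesis using n(2) by linarith
  qed
  obtain m0 :: nat where m0: "R / a < real m0" using reals_Archimedean2 by blast
  define m where "m = Suc m0"
  define w where "w = 2 * pi * real m"
  have m: "R / a < real m" "1 \<le> real m" using m0 by (simp_all add: m_def)
  have "2 * pi * 1 \<le> w" unfolding w_def using m(2) by (intro mult_left_mono) simp_all
  moreover have "1 * real m \<le> w" unfolding w_def using pi_gt3 by (intro mult_right_mono) simp_all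
  ultimately have w: "1 \<le> w" "pi / 2 \<le> w" "R / a < w" using m pi_gt3 by linarith+
  define b where "b = a / w ^ n"
  have wn: "1 \<le> w ^ j" for j using w(1) by simp
  have w0: "0 < w ^ j" for j using w(1) by simp
  have bw: "b * w ^ j \<le> a" if "j \<le> n" for j
  proof -
    have "w ^ j \<le> w ^ n" using that w(1) by (rule power_increasing)
    then have "b * w ^ j \<le> b * w ^ n" using a(1) w0 by (intro mult_left_mono) (simp_all add: b_def less_imp_le)
    also have "\<dots> = a" using w(1) by (simp add: b_def)
    finally show ?thesis .
  qed
  have b0: "0 \<le> b" using a(1) w0[of n] by (simp add: b_def)
  have bw1: "b * w < 1" using bw[OF n(1)] a(2) by simp
  have ba: "b \<le> a" using bw[of 0] by simp
  define u where "u = (\<lambda>x. sin (w * x))"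
  define F where "F = (\<lambda>x. x + b * u x)"
  have "F \<in> lifts k" unfolding F_def u_def by (rule sine_lift[OF k_ge_1 b0 bw1 w_def])
  then obtain f where F: "is_lift F f" by (rule obtain_projection)
  have f: "f \<in> C" using F by (rule is_liftD)
  have Fid: "(\<lambda>y. F y - y) = (\<lambda>y. b * u y)" by (auto simp: F_def)
  have uC: "Ck_on l S u" for l unfolding u_def by (rule Ck_sin)
  have dF: "dS j (\<lambda>y. F y - y) x = b * dS j u x" if "x \<in> S" for x j
    unfolding Fid using that by (rule dS_scale[OF uC])
  have "\<rho> n f \<iota> \<le> \<kappa> * a + real n * (real n * a)"
  proof (rule \<rho>_le[OF F one_lift kn])
    fix z assume z: "z \<in> M"
    then obtain x where x: "x \<in> S" "z = p x" using in_M by blast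
    have "dist (f z) (\<iota> z) \<le> \<kappa> * \<bar>F x - x\<bar>"
      using p_lipschitz[OF lift_maps[OF F x(1)] x(1)] is_liftD(3)[OF F x(1)] one_apply[OF z] x(2) by simp
    also have "\<bar>F x - x\<bar> \<le> b * 1" unfolding F_def u_def using b0 by (simp add: abs_mult mult_left_le)
    also have "b * 1 \<le> a" using ba by simp
    finally show "dist (f z) (\<iota> z) \<le> \<kappa> * a" using \<kappa>_nonneg by (simp add: mult_left_mono)
  next
    fix x assume x: "x \<in> S"
    have "\<bar>dS j (\<lambda>y. F y - y) x\<bar> \<le> a" if "j \<in> {1..n}" for j
    proof -
      have "\<bar>dS j (\<lambda>y. F y - y) x\<bar> = b * \<bar>dS j u x\<bar>" using dF[OF x] b0 by (simp add: abs_mult)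
      also have "\<dots> \<le> b * w ^ j"
        unfolding u_def using b0 abs_dS_sin_le[OF x, of w j] w(1) by (intro mult_left_mono) simp_all
      also have "\<dots> \<le> a" using that by (intro bw) simp
      finally show ?thesis .
    qed
    then have "jet_norm n (\<lambda>y. F y - y) x \<le> (\<Sum>j=1..n. a)" unfolding jet_norm_def by (rule sum_mono)
    then show "jet_norm n (\<lambda>y. F y - y) x \<le> real n * a" by simp
  qed
  also have "\<dots> = (\<kappa> + real n * real n) * a" by (simp add: algebra_simps)
  finally have "\<rho> n f \<iota> < r" using aq by linarith
  then have "f \<in> W" using n(3) f U(3) by blast
  then have R: "\<rho> (Suc n) f \<iota> \<le> R"
    unfolding R_def by (intro combined_length_less_imp_\<rho>[OF f kn] B)
  obtain x where x: "x \<in> S" "\<bar>dS (Suc n) u x\<bar> = w ^ Suc n"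
    using abs_dS_sin_attained[OF w(2), of "Suc n"] unfolding u_def by blast
  have "a * w = b * w ^ Suc n" using w(1) by (simp add: b_def)
  also have "\<dots> = \<bar>dS (Suc n) (\<lambda>y. F y - y) x\<bar>" using dF[OF x(1), of "Suc n"] x(2) b0 by (simp add: abs_mult)
  also have "\<dots> \<le> jet_norm (Suc n) (\<lambda>y. F y - y) x" by (rule abs_dS_le_jet_norm) simp_all
  also have "\<dots> \<le> \<rho> (Suc n) f \<iota>" by (rule jet_norm_le_\<rho>[OF F one_lift kn x(1)])
  also have "\<dots> \<le> R" by (rule R)
  also have "R < a * w" using w(3) a(1) by (simp add: field_simps)
  finally show False by simp
qed

end

section \<open>The interval\<close>

lemma (in coordinate_domain) Ck_continuous: "Ck_on k S f \<Longrightarrow> continuous_on S f"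
  using Ck_mono[of k f 0] Ck_0 by simp

interpretation unit_interval: coordinate_domain "{0..1}"
  by standard simp

lemma diff_interval_set_lifts:
  assumes f: "f \<in> diff_interval_set k" shows "f \<in> unit_interval.lifts k" "f 0 = 0"
proof -
  have bij: "bij_betw f {0..1} {0..1}" and ck: "Ck_on k {0..1} f" "Ck_on k {0..1} (inv_into {0..1} f)"
    and mono: "strict_mono_on {0..1} f"
    using f by (auto simp: diff_interval_set_def Bij_def)
  have maps: "f \<in> {0..1} \<rightarrow> {0..1}" using bij by (rule bij_betw_imp_funcset)
  have le: "f x \<le> f y" if "x \<in> {0..1}" "y \<in> {0..1}" "x \<le> y" for x y
    using mono that by (metis nle_le order_le_less strict_mono_onD)
  have img: "f ` {0..1} = {0..1}" using bij by (simp add: bij_betw_def)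
  have "0 \<in> f ` {0..1}" "1 \<in> f ` {0..1}" unfolding img by simp_all
  then obtain x y where x: "x \<in> {0..1}" "f x = 0" and y: "y \<in> {0..1}" "f y = 1" by (metis imageE)
  show f0: "f 0 = 0" using le[of 0 x] x funcset_mem[OF maps, of 0] by simp
  have f1: "f 1 = 1" using le[of y 1] y funcset_mem[OF maps, of 1] by simp
  show "f \<in> unit_interval.lifts k"
    unfolding unit_interval.lifts_def
  proof (intro CollectI conjI maps ck(1) mono bexI[of _ "inv_into {0..1} f"] ck(2) ballI)
    show "unit_interval.equivariant f"
      unfolding unit_interval.equivariant_def
    proof (intro ballI impI)
      fix x :: real assume "x \<in> {0..1}" "x + 1 \<in> {0..1}"
      then have "x = 0" by simp
      then show "f (x + 1) = f x + 1" using f0 f1 by simp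
    qed
    show "inv_into {0..1} f \<in> {0..1} \<rightarrow> {0..1}"
      using bij_betw_inv_into[OF bij] by (rule bij_betw_imp_funcset)
    show "f (inv_into {0..1} f x) = x" if "x \<in> {0..1}" for x using bij that by (rule bij_betw_inv_into_right)
    show "inv_into {0..1} f (f x) = x" if "x \<in> {0..1}" for x using bij that by (rule bij_betw_inv_into_left)
  qed
qed

lemma restrict_lift_diff_interval:
  assumes F: "F \<in> unit_interval.lifts k" shows "restrict F {0..1} \<in> diff_interval_set k"
proof -
  note FD = unit_interval.liftsD[OF F]
  obtain H where H: "H \<in> unit_interval.lifts k" "\<forall>x\<in>{0..1}. F (H x) = x \<and> H (F x) = x"
    by (rule unit_interval.lifts_inverse[OF F])
  note HD = unit_interval.liftsD[OF H(1)]
  have bij: "bij_betw (restrict F {0..1}) {0..1} {0..1}"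
    using FD(1) HD(1) H(2) by (intro bij_betwI[where g = H]) (auto simp: Pi_iff)
  have inv: "inv_into {0..1} (restrict F {0..1}) x = H x" if x: "x \<in> {0..1}" for x
    using bij HD(1) H(2) x by (intro inv_into_f_eq) (auto simp: bij_betw_def Pi_iff)
  show ?thesis unfolding diff_interval_set_def
  proof (intro CollectI conjI)
    show "restrict F {0..1} \<in> Bij {0..1}" using bij by (simp add: Bij_def)
    show "Ck_on k {0..1} (restrict F {0..1})"
      using FD(2) unit_interval.Ck_cong[of "restrict F {0..1}" F k] by simp
    show "Ck_on k {0..1} (inv_into {0..1} (restrict F {0..1}))"
      using HD(2) unit_interval.Ck_cong[of "inv_into {0..1} (restrict F {0..1})" H k] inv by simp
    show "strict_mono_on {0..1} (restrict F {0..1})"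
      using FD(4) unfolding strict_mono_on_def by simp
  qed
qed

lemma diffeo_model_interval:
  assumes k: "1 \<le> k"
  shows "diffeo_model {0..1} {0..1} (\<lambda>x. x) (iter_deriv {0..1}) (diff_interval_set k) k 1"
proof unfold_locales
  show "diff_interval_set k \<subseteq> Bij {0..1}" by (auto simp: diff_interval_set_def)
  show "\<exists>F\<in>unit_interval.lifts k. \<bar>F 0\<bar> \<le> 1 \<and> (\<forall>x\<in>{0..1}. f x = F x)"
    if "f \<in> diff_interval_set k" for f
    using diff_interval_set_lifts[OF that] by (intro bexI[of _ f]) simp_all
  show "\<exists>f\<in>diff_interval_set k. \<forall>x\<in>{0..1}. f x = F x" if "F \<in> unit_interval.lifts k" for F
    using restrict_lift_diff_interval[OF that] by (intro bexI[of _ "restrict F {0..1}"]) simp_all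
  show "iter_deriv {0..1} j f x = iter_deriv {0..1} j F x"
    if "\<forall>x\<in>{0..1}. f x = F x" "x \<in> {0..1}" for f F :: "real \<Rightarrow> real" and j and x :: real
    using that(1) by (intro unit_interval.dS_cong that(2)) blast
qed (use k in \<open>simp_all add: dist_real_def\<close>)

section \<open>The circle\<close>

interpretation real_line: coordinate_domain UNIV
  by standard simp

lemma cis_2pi_eq_iff: "cis (2 * pi * x) = cis (2 * pi * y) \<longleftrightarrow> x - y \<in> \<int>"
proof -
  have "cis (2 * pi * x) = cis (2 * pi * y) \<longleftrightarrow> cis (2 * pi * (x - y)) = 1"
    by (simp add: right_diff_distrib cis_divide[symmetric] field_simps)
  also have "\<dots> \<longleftrightarrow> cos (2 * pi * (x - y)) = 1"
  proof
    assume "cos (2 * pi * (x - y)) = 1"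
    moreover from this have "sin (2 * pi * (x - y)) = 0"
      using sin_cos_squared_add[of "2 * pi * (x - y)"] by simp
    ultimately show "cis (2 * pi * (x - y)) = 1" by (simp add: complex_eq_iff)
  qed (simp add: complex_eq_iff)
  also have "\<dots> \<longleftrightarrow> x - y \<in> \<int>"
  proof
    assume "cos (2 * pi * (x - y)) = 1"
    then obtain m :: int where "2 * pi * (x - y) = of_int m * 2 * pi" using cos_one_2pi_int by auto
    then have "x - y = of_int m" by simp
    then show "x - y \<in> \<int>" by simp
  next
    assume "x - y \<in> \<int>"
    then obtain m :: int where "x - y = of_int m" by (rule Ints_cases)
    then have "2 * pi * (x - y) = of_int m * 2 * pi" by simp
    then show "cos (2 * pi * (x - y)) = 1" using cos_one_2pi_int by blast
  qed
  finally show ?thesis .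
qed

lemma dist_cis_le: "dist (cis a) (cis b) \<le> \<bar>a - b\<bar>"
proof -
  define p q where "p = (a - b) / 2" and "q = (a + b) / 2"
  have "(b - a) / 2 = - p" by (simp add: p_def diff_divide_distrib)
  then have c: "cos a - cos b = - 2 * sin q * sin p" and s: "sin a - sin b = 2 * sin p * cos q"
    unfolding cos_diff_cos sin_diff_sin p_def[symmetric] q_def[symmetric] by simp_all
  have "(dist (cis a) (cis b))\<^sup>2 = (cos a - cos b)\<^sup>2 + (sin a - sin b)\<^sup>2"
    by (simp add: dist_norm cmod_power2)
  also have "\<dots> = 4 * (sin p)\<^sup>2 * ((sin q)\<^sup>2 + (cos q)\<^sup>2)"
    unfolding c s by (simp only: power_mult_distrib distrib_left) simp
  also have "\<dots> = (2 * \<bar>sin p\<bar>)\<^sup>2" by (simp add: power_mult_distrib)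
  also have "\<dots> \<le> \<bar>a - b\<bar>\<^sup>2"
    using abs_sin_x_le_abs_x[of p] by (intro power_mono) (simp_all add: p_def)
  finally show ?thesis by (rule power2_le_imp_le) simp
qed

lemma circle_cis: "circle = range (\<lambda>x. cis (2 * pi * x))"
proof
  show "circle \<subseteq> range (\<lambda>x. cis (2 * pi * x))"
  proof
    fix z :: complex assume "z \<in> circle"
    then have "z \<noteq> 0" "sgn z = z" by (auto simp: sgn_div_norm)
    then have "z = cis (2 * pi * (Arg z / (2 * pi)))" using cis_Arg[of z] by simp
    then show "z \<in> range (\<lambda>x. cis (2 * pi * x))" by blast
  qed
qed auto

lemma equivariant_int:
  assumes "real_line.equivariant F" shows "F (x + of_int i) = F x + of_int i"
proof (induction i rule: int_induct[where k = 0])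
  case (step1 i)
  have "F ((x + of_int i) + 1) = F (x + of_int i) + 1"
    using assms by (simp add: real_line.equivariant_def)
  then show ?case using step1 by (simp add: add.assoc)
next
  case (step2 i)
  have "F ((x + of_int (i - 1)) + 1) = F (x + of_int (i - 1)) + 1"
    using assms unfolding real_line.equivariant_def by blast
  then show ?case using step2 by (simp add: algebra_simps)
qed simp

text \<open>The map \<open>F (x + 1)\<close> lifts \<open>f\<close> at the same point of the circle as \<open>F x\<close>, so they differ by an
  integer, which is positive by monotonicity. If it exceeded \<open>1\<close>, then \<open>F\<close> would take the value \<open>F x + 1\<close>
  strictly between \<open>x\<close> and \<open>x + 1\<close>, against the injectivity of \<open>f\<close>.\<close>

lemma circle_lift_shift_1:
  assumes f: "inj_on f circle" and F: "circle_lift f F" "strict_mono F"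
  shows "F (x + 1) = F x + 1"
proof -
  have lift: "f (cis (2 * pi * y)) = cis (2 * pi * F y)" for y using F(1) by (simp add: circle_lift_def)
  have cont: "continuous_on UNIV F" using F(1) by (simp add: circle_lift_def)
  have "cis (2 * pi * (y + 1)) = cis (2 * pi * y)" for y by (simp add: cis_2pi_eq_iff)
  then have "cis (2 * pi * F (x + 1)) = cis (2 * pi * F x)" by (simp only: lift[symmetric])
  then have "F (x + 1) - F x \<in> \<int>" by (simp add: cis_2pi_eq_iff)
  then obtain m :: int where m: "F (x + 1) - F x = of_int m" by (rule Ints_cases)
  have "F x < F (x + 1)" using F(2) by (simp add: strict_mono_def)
  then have "0 < m" using m by linarith
  moreover have "\<not> 1 < m"
  proof
    assume "1 < m"
    then have "F x \<le> F x + 1" "F x + 1 \<le> F (x + 1)" using m by linarith+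
    then have "\<exists>y. x \<le> y \<and> y \<le> x + 1 \<and> F y = F x + 1"
      using cont by (intro IVT') (auto intro: continuous_on_subset)
    then obtain y where y: "x \<le> y" "y \<le> x + 1" "F y = F x + 1" by blast
    then have "f (cis (2 * pi * y)) = f (cis (2 * pi * x))" unfolding lift cis_2pi_eq_iff by simp
    then have "cis (2 * pi * y) = cis (2 * pi * x)" by (rule inj_onD[OF f]) simp_all
    then have "y - x \<in> \<int>" by (simp add: cis_2pi_eq_iff)
    then obtain i :: int where i: "y - x = of_int i" by (rule Ints_cases)
    have "y \<noteq> x" "y \<noteq> x + 1" using y(3) m \<open>1 < m\<close> by auto
    then have "0 < y - x" "y - x < 1" using y(1,2) by simp_all
    then show False unfolding i by simp
  qed
  ultimately show ?thesis using m by simp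
qed

text \<open>Smoothness and monotonicity are asserted for possibly different lifts, which differ by constants;
  so one normalized lift \<open>F\<close> has both. A lift of the inverse map is inverse to \<open>F\<close> up to a constant
  \<open>d\<close>, which a translation of the argument removes.\<close>

lemma diff_circle_set_lift:
  assumes f: "f \<in> diff_circle_set k"
  shows "\<exists>F\<in>real_line.lifts k. \<bar>F 0\<bar> \<le> 1 \<and> (\<forall>x. f (cis (2 * pi * x)) = cis (2 * pi * F x))"
proof -
  have bij: "bij_betw f circle circle" using f by (simp add: diff_circle_set_def Bij_def)
  obtain F1 where F1: "circle_lift f F1" "Ck_on k UNIV F1" using f by (auto simp: diff_circle_set_def Ck_circle_def)
  obtain H1 where H1: "circle_lift (inv_into circle f) H1" "Ck_on k UNIV H1"
    using f by (auto simp: diff_circle_set_def Ck_circle_def)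
  obtain F2 where F2: "circle_lift f F2" "strict_mono F2"
    using f by (auto simp: diff_circle_set_def orientation_preserving_circle_def)
  define F where "F = (\<lambda>x. F1 x - of_int \<lfloor>F1 0\<rfloor>)"
  have "cis (2 * pi * F x) = cis (2 * pi * F1 x)" for x by (simp add: cis_2pi_eq_iff F_def)
  then have FL: "circle_lift f F"
    using F1(1) unfolding circle_lift_def F_def by (auto intro!: continuous_intros)
  have lift: "f (cis (2 * pi * y)) = cis (2 * pi * F y)" for y using FL by (simp add: circle_lift_def)
  have FC: "Ck_on k UNIV F" unfolding F_def by (intro real_line.Ck_diff F1(2) real_line.Ck_const)
  obtain c where c: "F = (\<lambda>x. F2 x + c)" by (rule circle_lift_unique[OF F2(1) FL])
  have mono: "strict_mono F" using F2(2) by (simp add: c strict_mono_def)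
  have "F (x + 1) = F x + 1" for x
    using bij_betw_imp_inj_on[OF bij] FL mono by (rule circle_lift_shift_1)
  then have eqv: "real_line.equivariant F" by (simp add: real_line.equivariant_def)
  have id: "circle_lift (\<lambda>z. z) (\<lambda>x. x)" by (simp add: circle_lift_def)
  have "cis (2 * pi * F (H1 x)) = cis (2 * pi * x)" for x
  proof -
    have "cis (2 * pi * F (H1 x)) = f (inv_into circle f (cis (2 * pi * x)))"
      using H1(1) lift by (simp add: circle_lift_def)
    also have "\<dots> = cis (2 * pi * x)" by (rule bij_betw_inv_into_right[OF bij]) simp
    finally show ?thesis .
  qed
  moreover have "continuous_on UNIV (\<lambda>x. F (H1 x))"
    using FL H1(1) unfolding circle_lift_def by (intro continuous_on_compose2[of UNIV F UNIV H1]) auto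
  ultimately have "circle_lift (\<lambda>z. z) (\<lambda>x. F (H1 x))" by (simp add: circle_lift_def)
  with id obtain d where "(\<lambda>x. F (H1 x)) = (\<lambda>x. x + d)" by (rule circle_lift_unique)
  then have d: "F (H1 x) = x + d" for x by metis
  define H where "H = (\<lambda>x. H1 (x - d))"
  have FH: "F (H x) = x" for x by (simp add: H_def d)
  have HF: "H (F x) = x" for x
    using FH[of "F x"] strict_mono_imp_inj_on[OF mono] by (simp add: inj_eq)
  have HC: "Ck_on k UNIV H"
    unfolding H_def by (rule real_line.Ck_compose[OF H1(2)]) (auto intro: real_line.Ck_diff real_line.Ck_id real_line.Ck_const)
  have "F \<in> real_line.lifts k"
    unfolding real_line.lifts_def
    using FC eqv mono HC FH HF by (auto intro!: bexI[of _ H])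
  moreover have "\<bar>F 0\<bar> \<le> 1" unfolding F_def by linarith
  ultimately show ?thesis using lift by blast
qed

text \<open>\<open>Arg z / (2 * pi)\<close> is a preimage of \<open>z\<close> under the coordinate; equivariance makes the choice of the
  preimage immaterial.\<close>

definition circle_map :: "(real \<Rightarrow> real) \<Rightarrow> complex \<Rightarrow> complex" where
  "circle_map F = (\<lambda>z\<in>circle. cis (2 * pi * F (Arg z / (2 * pi))))"

lemma circle_map_cis:
  assumes "real_line.equivariant F" shows "circle_map F (cis (2 * pi * x)) = cis (2 * pi * F x)"
proof -
  define y where "y = Arg (cis (2 * pi * x)) / (2 * pi)"
  have "cis (2 * pi * y) = cis (2 * pi * x)"
    using cis_Arg[of "cis (2 * pi * x)"] by (simp add: y_def)
  then have "y - x \<in> \<int>" by (simp add: cis_2pi_eq_iff)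
  then obtain i :: int where "y - x = of_int i" by (rule Ints_cases)
  then have "y = x + of_int i" by simp
  then have "F y - F x \<in> \<int>" using equivariant_int[OF assms] by simp
  then show ?thesis by (simp add: circle_map_def y_def[symmetric] cis_2pi_eq_iff)
qed

lemma circle_map_in_diff_circle_set:
  assumes F: "F \<in> real_line.lifts k" shows "circle_map F \<in> diff_circle_set k"
proof -
  note FD = real_line.liftsD[OF F]
  obtain H where H: "H \<in> real_line.lifts k" "\<forall>x\<in>UNIV. F (H x) = x \<and> H (F x) = x"
    by (rule real_line.lifts_inverse[OF F])
  note HD = real_line.liftsD[OF H(1)]
  have FH: "F (H x) = x" "H (F x) = x" for x using H(2) by simp_all
  have cont: "continuous_on UNIV F" "continuous_on UNIV H"
    using real_line.Ck_continuous[OF FD(2)] real_line.Ck_continuous[OF HD(2)] .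
  have bij: "bij_betw (circle_map F) circle circle"
    using FH circle_map_cis[OF FD(3)] circle_map_cis[OF HD(3)]
    by (intro bij_betwI[where g = "circle_map H"]) (auto simp: circle_cis)
  have FL: "circle_lift (circle_map F) F" using cont(1) circle_map_cis[OF FD(3)] by (simp add: circle_lift_def)
  have "inv_into circle (circle_map F) (cis (2 * pi * x)) = cis (2 * pi * H x)" for x
    using bij_betw_imp_inj_on[OF bij] circle_map_cis[OF FD(3), of "H x"] FH(1)
    by (intro inv_into_f_eq) simp_all
  then have HL: "circle_lift (inv_into circle (circle_map F)) H" using cont(2) by (simp add: circle_lift_def)
  have "circle_map F \<in> Bij circle" using bij by (simp add: Bij_def circle_map_def)
  moreover have "Ck_circle k (circle_map F)" unfolding Ck_circle_def using FL FD(2) by blast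
  moreover have "Ck_circle k (inv_into circle (circle_map F))" unfolding Ck_circle_def using HL HD(2) by blast
  moreover have "orientation_preserving_circle (circle_map F)"
    unfolding orientation_preserving_circle_def using FL FD(4) by blast
  ultimately show ?thesis by (simp add: diff_circle_set_def)
qed

lemma diffeo_model_circle:
  assumes k: "1 \<le> k"
  shows "diffeo_model UNIV circle (\<lambda>x. cis (2 * pi * x)) circle_deriv (diff_circle_set k) k (2 * pi)"
proof unfold_locales
  show "diff_circle_set k \<subseteq> Bij circle" by (auto simp: diff_circle_set_def)
  show "range (\<lambda>x. cis (2 * pi * x)) = circle" by (rule circle_cis[symmetric])
  show "dist (cis (2 * pi * x)) (cis (2 * pi * y)) \<le> 2 * pi * \<bar>x - y\<bar>" for x y
    using dist_cis_le[of "2 * pi * x" "2 * pi * y"] by (simp add: right_diff_distrib[symmetric] abs_mult)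
  show "\<exists>F\<in>real_line.lifts k. \<bar>F 0\<bar> \<le> 1 \<and> (\<forall>x\<in>UNIV. f (cis (2 * pi * x)) = cis (2 * pi * F x))"
    if "f \<in> diff_circle_set k" for f
    using diff_circle_set_lift[OF that] by simp
  show "\<exists>f\<in>diff_circle_set k. \<forall>x\<in>UNIV. f (cis (2 * pi * x)) = cis (2 * pi * F x)"
    if F: "F \<in> real_line.lifts k" for F
    using circle_map_in_diff_circle_set[OF F] circle_map_cis[OF real_line.liftsD(3)[OF F]] by blast
  show "circle_deriv j f x = iter_deriv UNIV j F x"
    if F: "F \<in> real_line.lifts k" and eq: "\<forall>x\<in>UNIV. f (cis (2 * pi * x)) = cis (2 * pi * F x)" and j: "1 \<le> j" for f F j x
  proof -
    have "continuous_on UNIV F"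
      using real_line.liftsD(2)[OF F] by (rule real_line.Ck_continuous)
    then have "circle_lift f F" using eq by (simp add: circle_lift_def)
    then show ?thesis using j by (simp add: circle_deriv_eq)
  qed
qed (use k in simp_all)

section \<open>The two diffeomorphism groups\<close>

lemma (in diffeo_model) qi_class_iff_finite:
  "locally_OB G T \<and> has_qi_class G T \<and> nontrivial_qi_class G T \<longleftrightarrow> k < \<infinity>"
proof (cases k)
  case (enat n)
  then have "k < \<infinity>" by simp
  then show ?thesis using qi_class_if_finite_order[OF enat] by blast
next
  case infinity
  then have "\<not> k < \<infinity>" by simp
  then show ?thesis using not_locally_OB_if_infinite_order[OF infinity] by blast
qed

theorem theorem1p2:
  fixes k :: enat
  assumes "1 \<le> k"
  shows "(locally_OB (diff_interval k) (diff_interval_topology k) \<and>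
          has_qi_class (diff_interval k) (diff_interval_topology k) \<and>
          nontrivial_qi_class (diff_interval k) (diff_interval_topology k)
          \<longleftrightarrow> k < \<infinity>) \<and>
         (locally_OB (diff_circle k) (diff_circle_topology k) \<and>
          has_qi_class (diff_circle k) (diff_circle_topology k) \<and>
          nontrivial_qi_class (diff_circle k) (diff_circle_topology k)
          \<longleftrightarrow> k < \<infinity>)"
proof
  interpret I: diffeo_model "{0..1}" "{0..1}" "\<lambda>x. x" "iter_deriv {0..1}" "diff_interval_set k" k 1
    using assms by (rule diffeo_model_interval)
  have "I.G = diff_interval k" "I.T = diff_interval_topology k"
    unfolding I.G_def I.T_def diff_interval_def diff_interval_topology_def by simp_all
  then show "locally_OB (diff_interval k) (diff_interval_topology k) \<and>
      has_qi_class (diff_interval k) (diff_interval_topology k) \<and>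
      nontrivial_qi_class (diff_interval k) (diff_interval_topology k) \<longleftrightarrow> k < \<infinity>"
    using I.qi_class_iff_finite by simp
next
  interpret K: diffeo_model UNIV circle "\<lambda>x. cis (2 * pi * x)" circle_deriv "diff_circle_set k" k "2 * pi"
    using assms by (rule diffeo_model_circle)
  have "K.G = diff_circle k" "K.T = diff_circle_topology k"
    unfolding K.G_def K.T_def diff_circle_def diff_circle_topology_def by simp_all
  then show "locally_OB (diff_circle k) (diff_circle_topology k) \<and>
      has_qi_class (diff_circle k) (diff_circle_topology k) \<and>
      nontrivial_qi_class (diff_circle k) (diff_circle_topology k) \<longleftrightarrow> k < \<infinity>"
    using K.qi_class_iff_finite by simp
qed

end
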